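(* Assume either that $\alpha\in(-1/2,1/2)$ and $k\in(-\cos(\pi\alpha),\cos(\pi\alpha))$, or that $\alpha,k\in i\mathbb R$. Put $s_1=-\sin(\pi\alpha)-ik$, $s_3=-\sin(\pi\alpha)+ik$, so that $1-s_1s_3=\cos^2(\pi\alpha)-k^2>0$, and $\nu=-(2\pi i)^{-1}\ln(1-s_1s_3)$ with the real logarithm. For $t>0$ define on the closed disc $D(0,\delta)$ the function $$T_0(z)=\begin{cases}E(z)\bar\Phi(t\eta(z))e^{-it\eta(z)\sigma_3}e^{-i\pi\nu\sigma_3},&\operatorname{Im}z>0,\\ E(z)\bar\Phi(t\eta(z))e^{-it\eta(z)\sigma_3}e^{i\pi\nu\sigma_3},&\operatorname{Im}z<0,\end{cases}\qquad E(z)=\begin{cases}N(z)e^{i\pi\nu\sigma_3},&\operatorname{Im}z>0,\\ N(z)e^{-i\pi\nu\sigma_3},&\operatorname{Im}z<0,\end{cases}$$ where $\eta,N,\bar\Phi,\delta,\Sigma_3$ are as in the context. Then $T_0$ is a solution of the following Riemann–Hilbert problem. (G1) $T_0$ is analytic in $D(0,\delta)\setminus\Sigma_3$. (G2) On $D(0,\delta)\cap\Sigma_3$ (away from $0$) the boundary values satisfy the following jump relations, where $\tilde\theta(z)=i(\frac43z^3-z)$ and $T_0^{U}$, $T_0^{L}$, $T_0^{R\pm}$, $T_0^{L\pm}$ denote the restrictions of $T_0$ to the parts of $D(0,\delta)$ where $\arg\eta(z)$ lies respectively in $(\frac\pi4,\frac{3\pi}4)$; $(-\frac{3\pi}4,-\frac\pi4)$;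 $(0,\frac\pi4)$ for $R+$ and $(-\frac\pi4,0)$ for $R-$; $(\frac{3\pi}4,\pi)$ for $L+$ and $(-\pi,-\frac{3\pi}4)$ for $L-$: $$T_0^{R+}=T_0^{R-}(1-s_1s_3)^{\sigma_3},\qquad T_0^{L+}=T_0^{L-}(1-s_1s_3)^{\sigma_3}\quad\text{on the real axis},$$ $$T_0^{U}=T_0^{R+}\begin{pmatrix}1&-\frac{s_3e^{-2t\tilde\theta(z)}}{1-s_1s_3}\\0&1\end{pmatrix}\ \ (\arg\eta(z)=\tfrac\pi4),\qquad T_0^{U}=T_0^{L+}\begin{pmatrix}1&\frac{s_1e^{-2t\tilde\theta(z)}}{1-s_1s_3}\\0&1\end{pmatrix}\ \ (\arg\eta(z)=\tfrac{3\pi}4),$$ $$T_0^{L}=T_0^{R-}\begin{pmatrix}1&0\\-\frac{s_1e^{2t\tilde\theta(z)}}{1-s_1s_3}&1\end{pmatrix}\ \ (\arg\eta(z)=-\tfrac\pi4),\qquad T_0^{L}=T_0^{L-}\begin{pmatrix}1&0\\\frac{s_3e^{2t\tilde\theta(z)}}{1-s_1s_3}&1\end{pmatrix}\ \ (\arg\eta(z)=-\tfrac{3\pi}4).$$ (G3) $T_0(z)N(z)^{-1}=I+O(t^{-1})$ as $t\to+\infty$, uniformly for $z\in\partial D(0,\delta)$. (G4) As $z\to0$, every entry of $T_0(z)$ is $O(|z|^{-\operatorname{Re}\alpha})$ if $0<\operatorname{Re}\alpha<1/2$, and $O(|z|^{\operatorname{Re}\alpha})$ if $-1/2<\operatorn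ame{Re}\alpha\le0$.
   Context: $\sigma_2=\begin{pmatrix}0&-i\\ i&0\end{pmatrix}$, $\sigma_3=\begin{pmatrix}1&0\\0&-1\end{pmatrix}$; $a^{c\sigma_3}=\operatorname{diag}(a^c,a^{-c})$. $\eta(z)=i\tilde\theta(z)=z-\frac43z^3$; $\delta>0$ is small, such that $\eta$ is biholomorphic on $B(0,2\delta)$. Inside $D(0,\delta)$ the contour $\Sigma_3$ is the preimage under $\eta|_{B(0,2\delta)}$ of the six rays $\arg w\in\{0,\pi,\pm\frac\pi4,\pm\frac{3\pi}4\}$ together with $0$. $N(z)=\left(\frac{z+1/2}{z-1/2}\right)^{\nu\sigma_3}$ for $z\in\mathbb C\setminus[-\frac12,\frac12]$, with branches $\arg(z\pm\frac12)\in(-\pi,\pi)$. The function $\hat\Phi^0$ is defined on the universal covering of $\mathbb C\setminus\{0\}$ by $$\hat\Phi^0(z)=\frac12e^{-i\frac\pi4\sigma_3}\begin{pmatrix}1&1\\-1&1\end{pmatrix}\begin{pmatrix}1&0\\-\alpha/z&1\end{pmatrix}\begin{pmatrix}v_1(z)&v_2(z)\\ v_1'(z)&v_2'(z)\end{pmatrix},$$ $$v_1(z)=\sum_{n\ge0}\frac{\Gamma(\alpha+\frac12)z^{\alpha+2n}}{4^nn!\,\Gamma(\alpha+\frac12+n)},\qquad v_2(z)=\sum_{n\ge0}\frac{\Gamma(\frac32-\alpha)z^{1-\alpha+2n}}{4^nn!\,\Gamma(\frac32-\alpha+n)}.$$ Let $$\hat E=\frac{\sqrt\pi}{2\cos\pi\alpha}\begin{pmatrix}\frac{2^{1-\alpha}}{\Gamma(\frac12+\alpha)}&0\\0&\frac{2^\alpha}{\Gamma(\frac32-\alpha)}\end{pmatrix}e^{i\frac\pi4\sigma_3}\begin{pmatrix}e^{-i\pi\alpha}&i\\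 ie^{i\pi\alpha}&1\end{pmatrix},$$ $\hat S_1=\begin{pmatrix}1&2\sin(\pi\alpha)\\0&1\end{pmatrix}$, $\hat S_2=\begin{pmatrix}1&0\\-2\sin(\pi\alpha)&1\end{pmatrix}$, and $\hat\Phi^1=\hat\Phi^0\hat E$, $\hat\Phi^2=\hat\Phi^1\hat S_1$, $\hat\Phi^3=\hat\Phi^2\hat S_2$. For $z\in\mathbb C\setminus\mathbb R$ with $\arg z\in(-\pi,\pi)$ put $\check\Phi(z)=\hat\Phi^3(e^{2\pi i}z)$ if $\operatorname{Im}z>0$ and $\check\Phi(z)=\hat\Phi^2(e^{2\pi i}z)$ if $\operatorname{Im}z<0$ ($e^{2\pi i}z$ is the point of the covering with argument increased by $2\pi$). Put $\tilde\Phi(z)=\check\Phi(iz)$ for $\operatorname{Re}z\ne0$. Finally $\bar\Phi$ is defined by: $\bar\Phi=\tilde\Phi$ if $|\arg z|<\frac\pi4$ or $|\arg(-z)|<\frac\pi4$; $\bar\Phi=\tilde\Phi\begin{pmatrix}1&-s_3\\0&1\end{pmatrix}$ if $\frac\pi4<\arg z<\frac\pi2$; $\bar\Phi=\tilde\Phi\begin{pmatrix}1&s_1\\0&1\end{pmatrix}$ if $\frac\pi2<\arg z<\frac{3\pi}4$; $\bar\Phi=\tilde\Phi\begin{pmatrix}1&0\\-s_1&1\end{pmatrix}$ if $-\frac\pi2<\arg z<-\frac\pi4$; $\bar\Phi=\tilde\Phi\begin{pmatrix}1&0\\ s_3&1\end{pmatrix}$ if $-\frac{3\pi}4<\arg z<-\frac\pi2$;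 on the imaginary axis minus the origin $\bar\Phi$ is defined by analytic continuation (the definitions from the two sides agree there). Likewise $E(z)$ extends analytically across the real axis in $B(0,2\delta)$. *)

theory Defs
  imports
    "HOL-Complex_Analysis.Complex_Analysis"
    "HOL-Library.Landau_Symbols"
begin

section \<open>Two-by-two matrices\<close>

definition mat2 :: "complex \<Rightarrow> complex \<Rightarrow> complex \<Rightarrow> complex \<Rightarrow> complex^2^2" where
  "mat2 a b c d = vector [vector [a, b], vector [c, d]]"

text \<open>The matrix exponential of \<open>x \<sigma>\<^sub>3\<close>. A power \<open>a\<close> to the \<open>c \<sigma>\<^sub>3\<close> is \<open>exp_sigma3 (c * L)\<close>,
  where \<open>L\<close> is the branch of the logarithm of \<open>a\<close> in question.\<close>

definition exp_sigma3 :: "complex \<Rightarrow> complex^2^2" where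
  "exp_sigma3 x = mat2 (exp x) 0 0 (exp (- x))"

section \<open>Stokes data\<close>

definition s1 :: "complex \<Rightarrow> complex \<Rightarrow> complex" where
  "s1 \<alpha> k = - sin (of_real pi * \<alpha>) - \<i> * k"

definition s3 :: "complex \<Rightarrow> complex \<Rightarrow> complex" where
  "s3 \<alpha> k = - sin (of_real pi * \<alpha>) + \<i> * k"

text \<open>For the admissible parameters \<open>1 - s\<^sub>1 s\<^sub>3\<close> is a positive real number, so that its real
  logarithm is \<open>ln (Re (1 - s\<^sub>1 s\<^sub>3))\<close>.\<close>

definition nu :: "complex \<Rightarrow> complex \<Rightarrow> complex" where
  "nu \<alpha> k = - (1 / (2 * of_real pi * \<i>)) * of_real (ln (Re (1 - s1 \<alpha> k * s3 \<alpha> k)))"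

section \<open>The phase function and the contour\<close>

definition theta :: "complex \<Rightarrow> complex" where
  "theta z = \<i> * (4 / 3 * z ^ 3 - z)"

definition eta :: "complex \<Rightarrow> complex" where
  "eta z = \<i> * theta z"

lemma eta_eq: "eta z = z - 4 / 3 * z ^ 3"
proof -
  have "eta z = (\<i> * \<i>) * (4 / 3 * z ^ 3 - z)"
    unfolding eta_def theta_def by (simp only: mult.assoc)
  thus ?thesis by simp
qed

definition biholomorphic_on :: "(complex \<Rightarrow> complex) \<Rightarrow> complex set \<Rightarrow> bool" where
  "biholomorphic_on f S \<longleftrightarrow>
     f holomorphic_on S \<and> open (f ` S) \<and>
     (\<exists>g. g holomorphic_on (f ` S) \<and> (\<forall>z\<in>S. g (f z) = z))"

text \<open>The preimage under \<open>eta\<close> (restricted to the disc of radius \<open>2 \<delta>\<close>) of six rays and \<open>0\<close>.\<close>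

definition Sigma3 :: "real \<Rightarrow> complex set" where
  "Sigma3 \<delta> = {z \<in> ball 0 (2 * \<delta>).
     eta z = 0 \<or> Arg (eta z) \<in> {0, pi, pi / 4, - (pi / 4), 3 * pi / 4, - (3 * pi / 4)}}"

text \<open>The part of the closed disc of radius \<open>\<delta>\<close> with \<open>a < arg \<eta> < b\<close>. The Isabelle convention is
  \<open>Arg 0 = 0\<close>; the theorem only uses intervals that do not contain \<open>0\<close>.\<close>

definition eta_sector :: "real \<Rightarrow> real \<Rightarrow> real \<Rightarrow> complex set" where
  "eta_sector \<delta> a b = {z \<in> cball 0 \<delta>. a < Arg (eta z) \<and> Arg (eta z) < b}"

section \<open>The functions N and E\<close>

text \<open>Only used off the segment from \<open>-1/2\<close> to \<open>1/2\<close>. On the real axis to the left of the segment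
  both values of \<open>Ln\<close> have imaginary part \<open>\<pi>\<close>, and the difference is still the analytic branch.\<close>

definition N :: "complex \<Rightarrow> complex \<Rightarrow> complex \<Rightarrow> complex^2^2" where
  "N \<alpha> k z = exp_sigma3 (nu \<alpha> k * (Ln (z + 1 / 2) - Ln (z - 1 / 2)))"

text \<open>Only used for \<open>Im z \<noteq> 0\<close>; on the real axis, which belongs to the contour, the value is
  immaterial.\<close>

definition E :: "complex \<Rightarrow> complex \<Rightarrow> complex \<Rightarrow> complex^2^2" where
  "E \<alpha> k z =
     (if Im z > 0 then N \<alpha> k z ** exp_sigma3 (\<i> * of_real pi * nu \<alpha> k)
      else N \<alpha> k z ** exp_sigma3 (- \<i> * of_real pi * nu \<alpha> k))"

section \<open>The Bessel-type parametrix\<close>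

text \<open>A point of the universal covering of \<open>\<complex> - {0}\<close> is represented by its logarithm \<open>w\<close>: it lies over
  \<open>z = exp w\<close>, its argument is \<open>Im w\<close>, and \<open>z\<close> to the power \<open>c\<close> is \<open>exp (c * w)\<close>. Increasing the
  argument by \<open>2 \<pi>\<close> is adding \<open>2 \<pi> \<i>\<close> to \<open>w\<close>, and \<open>d/dz\<close> is \<open>exp (- w) d/dw\<close>.\<close>

definition v1 :: "complex \<Rightarrow> complex \<Rightarrow> complex" where
  "v1 \<alpha> w = (\<Sum>n. Gamma (\<alpha> + 1 / 2) * exp ((\<alpha> + 2 * of_nat n) * w) /
                   (4 ^ n * fact n * Gamma (\<alpha> + 1 / 2 + of_nat n)))"

definition v2 :: "complex \<Rightarrow> complex \<Rightarrow> complex" where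
  "v2 \<alpha> w = (\<Sum>n. Gamma (3 / 2 - \<alpha>) * exp ((1 - \<alpha> + 2 * of_nat n) * w) /
                   (4 ^ n * fact n * Gamma (3 / 2 - \<alpha> + of_nat n)))"

definition covering_deriv :: "(complex \<Rightarrow> complex) \<Rightarrow> complex \<Rightarrow> complex" where
  "covering_deriv f w = exp (- w) * deriv f w"

definition Phi0 :: "complex \<Rightarrow> complex \<Rightarrow> complex^2^2" where
  "Phi0 \<alpha> w =
     mat (1 / 2) ** exp_sigma3 (- \<i> * of_real pi / 4) ** mat2 1 1 (- 1) 1 **
     mat2 1 0 (- \<alpha> / exp w) 1 **
     mat2 (v1 \<alpha> w) (v2 \<alpha> w) (covering_deriv (v1 \<alpha>) w) (covering_deriv (v2 \<alpha>) w)"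

definition E_hat :: "complex \<Rightarrow> complex^2^2" where
  "E_hat \<alpha> =
     mat (of_real (sqrt pi) / (2 * cos (of_real pi * \<alpha>))) **
     mat2 (2 powr (1 - \<alpha>) / Gamma (1 / 2 + \<alpha>)) 0
          0 (2 powr \<alpha> / Gamma (3 / 2 - \<alpha>)) **
     exp_sigma3 (\<i> * of_real pi / 4) **
     mat2 (exp (- \<i> * of_real pi * \<alpha>)) \<i>
          (\<i> * exp (\<i> * of_real pi * \<alpha>)) 1"

definition S1_hat :: "complex \<Rightarrow> complex^2^2" where
  "S1_hat \<alpha> = mat2 1 (2 * sin (of_real pi * \<alpha>)) 0 1"

definition S2_hat :: "complex \<Rightarrow> complex^2^2" where
  "S2_hat \<alpha> = mat2 1 0 (- 2 * sin (of_real pi * \<alpha>)) 1"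

definition Phi1 :: "complex \<Rightarrow> complex \<Rightarrow> complex^2^2" where
  "Phi1 \<alpha> w = Phi0 \<alpha> w ** E_hat \<alpha>"

definition Phi2 :: "complex \<Rightarrow> complex \<Rightarrow> complex^2^2" where
  "Phi2 \<alpha> w = Phi1 \<alpha> w ** S1_hat \<alpha>"

definition Phi3 :: "complex \<Rightarrow> complex \<Rightarrow> complex^2^2" where
  "Phi3 \<alpha> w = Phi2 \<alpha> w ** S2_hat \<alpha>"

text \<open>From here on the arguments are complex numbers again. The value \<open>undefined\<close> marks points
  where the function is not defined.\<close>

definition Phi_check :: "complex \<Rightarrow> complex \<Rightarrow> complex^2^2" where
  "Phi_check \<alpha> z =
     (if Im z > 0 then Phi3 \<alpha> (Ln z + 2 * of_real pi * \<i>)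
      else if Im z < 0 then Phi2 \<alpha> (Ln z + 2 * of_real pi * \<i>)
      else undefined)"

definition Phi_tilde :: "complex \<Rightarrow> complex \<Rightarrow> complex^2^2" where
  "Phi_tilde \<alpha> z = Phi_check \<alpha> (\<i> * z)"

definition Phi_sectors :: "complex \<Rightarrow> complex \<Rightarrow> complex \<Rightarrow> complex^2^2" where
  "Phi_sectors \<alpha> k z =
     (if \<bar>Arg z\<bar> < pi / 4 \<or> \<bar>Arg (- z)\<bar> < pi / 4 then Phi_tilde \<alpha> z
      else if pi / 4 < Arg z \<and> Arg z < pi / 2
        then Phi_tilde \<alpha> z ** mat2 1 (- s3 \<alpha> k) 0 1
      else if pi / 2 < Arg z \<and> Arg z < 3 * pi / 4
        then Phi_tilde \<alpha> z ** mat2 1 (s1 \<alpha> k) 0 1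
      else if - (pi / 2) < Arg z \<and> Arg z < - (pi / 4)
        then Phi_tilde \<alpha> z ** mat2 1 0 (- s1 \<alpha> k) 1
      else if - (3 * pi / 4) < Arg z \<and> Arg z < - (pi / 2)
        then Phi_tilde \<alpha> z ** mat2 1 0 (s3 \<alpha> k) 1
      else undefined)"

text \<open>On the imaginary axis the continuation is the two-sided limit. That it exists and gives an
  analytic function is not built into the definition.\<close>

definition Phi_bar :: "complex \<Rightarrow> complex \<Rightarrow> complex \<Rightarrow> complex^2^2" where
  "Phi_bar \<alpha> k z =
     (if Re z = 0 \<and> z \<noteq> 0 then Lim (at z within {w. Re w \<noteq> 0}) (Phi_sectors \<alpha> k)
      else Phi_sectors \<alpha> k z)"

section \<open>The local parametrix and boundary values\<close>

definition T0 :: "complex \<Rightarrow> complex \<Rightarrow> real \<Rightarrow> complex \<Rightarrow> complex^2^2" where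
  "T0 \<alpha> k t z =
     (if Im z > 0 then
        E \<alpha> k z ** Phi_bar \<alpha> k (of_real t * eta z) **
        exp_sigma3 (- \<i> * of_real t * eta z) ** exp_sigma3 (- \<i> * of_real pi * nu \<alpha> k)
      else if Im z < 0 then
        E \<alpha> k z ** Phi_bar \<alpha> k (of_real t * eta z) **
        exp_sigma3 (- \<i> * of_real t * eta z) ** exp_sigma3 (\<i> * of_real pi * nu \<alpha> k)
      else undefined)"

text \<open>The boundary values of \<open>T\<close> at \<open>z\<close> from \<open>A\<close> and from \<open>B\<close> exist and satisfy
  \<open>T\<^sub>A = T\<^sub>B J\<close>.\<close>

definition jump_at ::
  "(complex \<Rightarrow> complex^2^2) \<Rightarrow> complex set \<Rightarrow> complex set \<Rightarrow> complex^2^2 \<Rightarrow> complex \<Rightarrow> bool" where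
  "jump_at T A B J z \<longleftrightarrow>
     z \<in> closure A \<and> z \<in> closure B \<and>
     (\<exists>TA TB. (T \<longlongrightarrow> TA) (at z within A) \<and> (T \<longlongrightarrow> TB) (at z within B) \<and> TA = TB ** J)"

end

theory Submission
  imports Defs
begin

text \<open>Up to constant factors, the columns of \<open>Phi0\<close> solve the Dirac system
  \<open>P' = P - (\<alpha>/z) Q\<close>, \<open>Q' = - Q - (\<alpha>/z) P\<close>. One integration by parts removes the oscillating
  coefficients of order \<open>1/z\<close>, so that along vertical lines in a half-plane the modified functions
  \<open>exp (- z) P\<close> and \<open>exp z Q\<close> have derivatives bounded by \<open>|z|\<^sup>-\<^sup>2\<close> times their size. They
  therefore have limits, which do not depend on the line, with error \<open>O(1/z)\<close> uniformly up to the real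
  axis. The two limits are determined by the growth on the positive and the negative real axis; the
  negative axis is reached by the explicit monodromy of the series, and the one remaining constant
  \<open>\<Gamma>(\<alpha> + 1/2) 2\<^sup>\<alpha> / \<surd>\<pi>\<close> comes from the Laplace transform of the Bessel series. The jump relations and
  the continuation across the imaginary axis are matrix identities that follow from the monodromy, and the
  growth at the origin is read off the series.\<close>

section \<open>A Dirac system on a half-plane\<close>

text \<open>On a vertical line Re z is fixed, so the weight exp (-2 Re z) between the growing and
  the decaying exponential is a constant there. Attaching it to the second component makes the
  perturbation integrable for both components at once, without singling out a dominant solution. The
  price is an error of the form |A| + exp (-2 Re z) |B|, which is not small relative to both
  exponentials if a column contains both. The matrix \<open>E_hat\<close> and the Stokes factors
  remove this obstacle: in each half-plane one column of the parametrix has B = 0 and the other has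
  A = 0, so the weight disappears from the estimate. The lower half-plane needs no analysis of its
  own, because rotation by pi exchanges P and Q. In the variable z = i w the half-planes become Re w
  \<ge> 0 and Re w < 0. The triangular factors in the upper and lower sectors of w, conjugated by
  the exponential, are exponentially close to I between the diagonals. Since |eta| is bounded below
  on the circle, w = t eta turns O(1/w) into O(1/t).\<close>

lemma integrable_coefficient_limit:
  fixes g g' :: "real \<Rightarrow> 'a::euclidean_space"
  assumes deriv: "\<And>s. s \<ge> 0 \<Longrightarrow> (g has_vector_derivative g' s) (at s)"
    and bound: "\<And>s. s \<ge> 0 \<Longrightarrow> norm (g' s) \<le> K / (r + s)\<^sup>2 * norm (g s)"
    and r: "r \<ge> 1" and K: "K \<ge> 0"
  obtains L where "(g \<longlongrightarrow> L) at_top"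
    and "\<And>s. s \<ge> 0 \<Longrightarrow> norm (g s - L) \<le> K * exp K * norm L / (r + s)"
    and "\<And>s. s \<ge> 0 \<Longrightarrow> norm (g s) \<le> exp K * norm L"
    and "\<And>s. s \<ge> 0 \<Longrightarrow> norm (g s) \<le> exp K * norm (g 0)"
proof -
  \<comment> \<open>The squared norm is differentiable even where \<open>g\<close> vanishes. The
    functions exp (2 K / (r + s)) and exp (- 2 K / (r + s)) are integrating factors for |n'| \<le> 2
    K n / (r + s)^2: multiplied by them, n becomes monotone in either direction. Since r \<ge> 1,
    both stay between exp (- 2 K) and exp (2 K).\<close>
  define n where "n = (\<lambda>s. g s \<bullet> g s)"
  have dn: "(n has_real_derivative 2 * (g s \<bullet> g' s)) (at s)" if "s \<ge> 0" for s
  proof -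
    have "((\<lambda>s. g s \<bullet> g s) has_vector_derivative (g s \<bullet> g' s + g' s \<bullet> g s)) (at s)"
      using deriv[OF that]
      by (intro bounded_bilinear.has_vector_derivative[OF bounded_bilinear_inner])
    thus ?thesis unfolding n_def has_real_derivative_iff_has_vector_derivative
      by (simp add: inner_commute)
  qed
  have dn_bound: "\<bar>2 * (g s \<bullet> g' s)\<bar> \<le> 2 * K / (r + s)\<^sup>2 * n s" if "s \<ge> 0" for s
  proof -
    have "\<bar>g s \<bullet> g' s\<bar> \<le> norm (g s) * norm (g' s)"
      by (rule Cauchy_Schwarz_ineq2)
    also have "\<dots> \<le> norm (g s) * (K / (r + s)\<^sup>2 * norm (g s))"
      using bound[OF that] by (intro mult_left_mono) auto
    also have "\<dots> = K / (r + s)\<^sup>2 * n s"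
      by (simp add: n_def power2_norm_eq_inner[symmetric] power2_eq_square)
    finally show ?thesis by (simp add: abs_mult)
  qed
  have de: "((\<lambda>s. exp (c * (2 * K / (r + s)))) has_real_derivative
      exp (c * (2 * K / (r + s))) * (- c * (2 * K / (r + s)\<^sup>2))) (at s)" if "s \<ge> 0" for s c
    using that r by (auto intro!: derivative_eq_intros simp: power2_eq_square)
  \<comment> \<open>The comparison is needed both ways: forwards it bounds \<open>g\<close> by
    \<open>g 0\<close> and yields convergence, backwards it bounds \<open>g\<close> by its limit, so
    that the final error is proportional to |L|.\<close>
  have compare: "n t \<le> exp (2 * K) * n s \<and> n s \<le> exp (2 * K) * n t" if st: "0 \<le> s" "s \<le> t" for s t
  proof -
    have small: "0 \<le> 2 * K / (r + x) \<and> 2 * K / (r + x) \<le> 2 * K" if "x \<ge> 0" for x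
      using that r K by (auto simp: divide_simps mult_left_le mult_le_cancel_left1)
    have nn: "n x \<ge> 0" for x by (simp add: n_def)
    have 1: "n t * exp (1 * (2 * K / (r + t))) \<le> n s * exp (1 * (2 * K / (r + s)))"
    proof (rule DERIV_nonpos_imp_nonincreasing[OF \<open>s \<le> t\<close>], intro exI conjI)
      fix x assume x: "s \<le> x" "x \<le> t"
      hence x0: "x \<ge> 0" using st by simp
      show "((\<lambda>s. n s * exp (1 * (2 * K / (r + s)))) has_real_derivative
         (2 * (g x \<bullet> g' x)) * exp (1 * (2 * K / (r + x))) +
         (exp (1 * (2 * K / (r + x))) * (- 1 * (2 * K / (r + x)\<^sup>2))) * n x) (at x)"
        by (rule DERIV_mult[OF dn[OF x0] de[OF x0]])
      have "2 * (g x \<bullet> g' x) - 2 * K / (r + x)\<^sup>2 * n x \<le> 0"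
        using dn_bound[OF x0] by simp
      hence "exp (1 * (2 * K / (r + x))) * (2 * (g x \<bullet> g' x) - 2 * K / (r + x)\<^sup>2 * n x) \<le> 0"
        by (simp add: mult_nonneg_nonpos)
      thus "(2 * (g x \<bullet> g' x)) * exp (1 * (2 * K / (r + x))) +
         (exp (1 * (2 * K / (r + x))) * (- 1 * (2 * K / (r + x)\<^sup>2))) * n x \<le> 0"
        by (simp add: algebra_simps)
    qed
    have 2: "n s * exp ((-1) * (2 * K / (r + s))) \<le> n t * exp ((-1) * (2 * K / (r + t)))"
    proof (rule DERIV_nonneg_imp_nondecreasing[OF \<open>s \<le> t\<close>], intro exI conjI)
      fix x assume x: "s \<le> x" "x \<le> t"
      hence x0: "x \<ge> 0" using st by simp
      show "((\<lambda>s. n s * exp ((-1) * (2 * K / (r + s)))) has_real_derivative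
         (2 * (g x \<bullet> g' x)) * exp ((-1) * (2 * K / (r + x))) +
         (exp ((-1) * (2 * K / (r + x))) * (- (-1) * (2 * K / (r + x)\<^sup>2))) * n x) (at x)"
        by (rule DERIV_mult[OF dn[OF x0] de[OF x0]])
      have "2 * (g x \<bullet> g' x) + 2 * K / (r + x)\<^sup>2 * n x \<ge> 0"
        using dn_bound[OF x0] by simp
      hence "exp ((-1) * (2 * K / (r + x))) * (2 * (g x \<bullet> g' x) + 2 * K / (r + x)\<^sup>2 * n x) \<ge> 0"
        by simp
      thus "(2 * (g x \<bullet> g' x)) * exp ((-1) * (2 * K / (r + x))) +
         (exp ((-1) * (2 * K / (r + x))) * (- (-1) * (2 * K / (r + x)\<^sup>2))) * n x \<ge> 0"
        by (simp add: algebra_simps)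
    qed
    have "n t \<le> n t * exp (1 * (2 * K / (r + t)))"
      using nn[of t] small[of t] st by (simp add: mult_le_cancel_left1)
    also note 1
    also have "n s * exp (1 * (2 * K / (r + s))) \<le> n s * exp (2 * K)"
      using nn[of s] small[of s] st by (intro mult_left_mono) auto
    finally have A: "n t \<le> exp (2 * K) * n s" by (simp add: mult.commute)
    have "exp (-(2 * K)) * n s \<le> n s * exp ((-1) * (2 * K / (r + s)))"
      using nn[of s] small[of s] st by (subst mult.commute, intro mult_left_mono) auto
    also note 2
    also have "n t * exp ((-1) * (2 * K / (r + t))) \<le> n t"
      using nn[of t] small[of t] st by (simp add: mult_left_le)
    finally have B: "n s \<le> exp (2 * K) * n t"
      by (simp add: exp_minus field_simps)
    show ?thesis using A B by blast
  qed
  have root: "norm x \<le> exp K * norm y" if "x \<bullet> x \<le> exp (2 * K) * (y \<bullet> y)" for x y :: 'a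
  proof -
    have "(norm x)\<^sup>2 \<le> (exp K * norm y)\<^sup>2"
      using that by (simp add: power2_norm_eq_inner power_mult_distrib exp_double)
    thus ?thesis by (rule power2_le_imp_le) simp
  qed
  have le1: "norm (g t) \<le> exp K * norm (g s)" and le2: "norm (g s) \<le> exp K * norm (g t)"
    if "0 \<le> s" "s \<le> t" for s t
    using compare[OF that] root unfolding n_def by auto
  \<comment> \<open>Here - K M / (r + x) is a primitive of the bound on the derivative. The majorant
    \<open>M\<close> stays free because the estimate is used twice: with exp K |g 0| to obtain the
    limit, and with exp K |L| for the stated error.\<close>
  have diff: "norm (g t - g s) \<le> K * M / (r + s) - K * M / (r + t)"
    if st: "0 \<le> s" "s \<le> t" and M: "\<And>x. x \<ge> s \<Longrightarrow> norm (g x) \<le> M" for s t M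
  proof (cases "s = t")
    case False
    hence "s < t" using st by simp
    thus ?thesis
    proof -
      have "norm (g t - g s) \<le> - (K * M / (r + t)) - (- (K * M / (r + s)))"
      proof (rule differentiable_bound_general[of s t g "\<lambda>x. - (K * M / (r + x))" g'
            "\<lambda>x. K * M / (r + x)\<^sup>2"])
        show "s < t" by fact
        show "continuous_on {s..t} g"
          using st by (intro continuous_at_imp_continuous_on ballI has_vector_derivative_continuous[OF deriv]) auto
        show "continuous_on {s..t} (\<lambda>x. - (K * M / (r + x)))"
          using st r by (intro continuous_intros) auto
        fix x assume x: "s < x" "x < t"
        show "(g has_vector_derivative g' x) (at x)" using deriv x st by auto
        show "((\<lambda>x. - (K * M / (r + x))) has_vector_derivative K * M / (r + x)\<^sup>2) (at x)"
          using x st r unfolding has_real_derivative_iff_has_vector_derivative[symmetric]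
          by (auto intro!: derivative_eq_intros simp: power2_eq_square)
        have "norm (g' x) \<le> K / (r + x)\<^sup>2 * norm (g x)" using bound x st by auto
        also have "\<dots> \<le> K / (r + x)\<^sup>2 * M"
          using M[of x] x K by (intro mult_left_mono) auto
        finally show "norm (g' x) \<le> K * M / (r + x)\<^sup>2" by simp
      qed
      thus ?thesis by simp
    qed
  qed simp
  have tend0: "((\<lambda>t. c / (r + t)) \<longlongrightarrow> 0) at_top" for c :: real
    by (rule real_tendsto_divide_at_top[OF tendsto_const])
      (auto intro: filterlim_tendsto_add_at_top tendsto_const filterlim_ident)
  define M0 where "M0 = exp K * norm (g 0)"
  have M0: "M0 \<ge> 0" by (simp add: M0_def)
  have step: "norm (g t - g s) \<le> K * M0 / (r + s)" if "0 \<le> s" "s \<le> t" for s t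
  proof -
    have "norm (g t - g s) \<le> K * M0 / (r + s) - K * M0 / (r + t)"
      by (rule diff[OF that]) (use le1[of 0] that in \<open>auto simp: M0_def\<close>)
    moreover have "K * M0 / (r + t) \<ge> 0" using that r K M0 by simp
    ultimately show ?thesis by linarith
  qed
  have "Cauchy (\<lambda>m. g (real m))"
  proof (rule metric_CauchyI)
    fix e :: real assume e: "e > 0"
    have "\<forall>\<^sub>F t in at_top. K * M0 / (r + t) < e / 2"
      using order_tendstoD(2)[OF tend0, of "e / 2"] e by simp
    then obtain T where T: "\<And>t. t \<ge> T \<Longrightarrow> K * M0 / (r + t) < e / 2"
      by (auto simp: eventually_at_top_linorder)
    define m0 where "m0 = nat \<lceil>T\<rceil>"
    have near: "norm (g (real m) - g (real m0)) < e / 2" if "m \<ge> m0" for m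
    proof -
      have "norm (g (real m) - g (real m0)) \<le> K * M0 / (r + real m0)"
        using that by (intro step) auto
      also have "\<dots> < e / 2" using T[OF real_nat_ceiling_ge[of T]] by (simp add: m0_def)
      finally show ?thesis .
    qed
    show "\<exists>M. \<forall>m\<ge>M. \<forall>n\<ge>M. dist (g (real m)) (g (real n)) < e"
      using near by (metis dist_norm dist_triangle_half_l)
  qed
  then obtain L where L: "(\<lambda>m. g (real m)) \<longlonglongrightarrow> L"
    using Cauchy_convergent convergent_def by blast
  have lim_ineq: "norm (g s - L) \<le> c" if "s \<ge> 0" "\<And>t. t \<ge> s \<Longrightarrow> norm (g t - g s) \<le> c" for s c
  proof (rule tendsto_upperbound)
    show "(\<lambda>m. norm (g s - g (real m))) \<longlonglongrightarrow> norm (g s - L)"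
      by (intro tendsto_intros L)
    show "\<forall>\<^sub>F m in sequentially. norm (g s - g (real m)) \<le> c"
      using eventually_ge_at_top[of "nat \<lceil>s\<rceil>"]
      by eventually_elim (metis norm_minus_commute that(2) real_nat_ceiling_ge of_nat_mono order_trans)
  qed simp
  have "((\<lambda>s. g s - L) \<longlongrightarrow> 0) at_top"
  proof (rule Lim_null_comparison[OF _ tend0[of "K * M0"]])
    show "\<forall>\<^sub>F s in at_top. norm (g s - L) \<le> K * M0 / (r + s)"
      using eventually_ge_at_top[of 0] by eventually_elim (use lim_ineq step in auto)
  qed
  hence lim: "(g \<longlongrightarrow> L) at_top" using LIM_zero_iff by blast
  have gL: "norm (g s) \<le> exp K * norm L" if "s \<ge> 0" for s
  proof (rule tendsto_lowerbound)
    show "(\<lambda>m. exp K * norm (g (real m))) \<longlonglongrightarrow> exp K * norm L"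
      by (intro tendsto_intros L)
    show "\<forall>\<^sub>F m in sequentially. norm (g s) \<le> exp K * norm (g (real m))"
      using eventually_ge_at_top[of "nat \<lceil>s\<rceil>"]
      by eventually_elim (use le2[OF that] in \<open>auto\<close>)
  qed simp
  have final: "norm (g s - L) \<le> K * exp K * norm L / (r + s)" if s: "s \<ge> 0" for s
  proof (rule lim_ineq[OF s])
    fix t assume t: "t \<ge> s"
    have "norm (g t - g s) \<le> K * (exp K * norm L) / (r + s) - K * (exp K * norm L) / (r + t)"
      using gL s by (intro diff[OF s t]) auto
    moreover have "K * (exp K * norm L) / (r + t) \<ge> 0" using s t r K by simp
    ultimately show "norm (g t - g s) \<le> K * exp K * norm L / (r + s)"
      by (simp add: mult.assoc)
  qed
  show ?thesis using that[OF lim final gL le1[of 0]] by blast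
qed

text \<open>\<open>X\<close> and \<open>Y\<close> arise by integrating the oscillating coefficient \<open>\<alpha>/z\<close> by parts once; what is left in
  their derivatives is of order \<open>z\<^sup>-\<^sup>2\<close>.\<close>

lemma dirac_line:
  fixes P Q :: "complex \<Rightarrow> complex" and \<alpha> :: complex
  defines "X \<equiv> \<lambda>z. exp (- z) * (P z - \<alpha> / (2 * z) * Q z)"
    and "Y \<equiv> \<lambda>z. exp z * (Q z + \<alpha> / (2 * z) * P z)"
    and "X' \<equiv> \<lambda>z. exp (- z) * (\<alpha> / (2 * z\<^sup>2) * (Q z + \<alpha> * P z))"
    and "Y' \<equiv> \<lambda>z. - exp z * (\<alpha> / (2 * z\<^sup>2) * (P z + \<alpha> * Q z))"
  assumes dP: "(P has_field_derivative P z - \<alpha> / z * Q z) (at z)"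
    and dQ: "(Q has_field_derivative - Q z - \<alpha> / z * P z) (at z)"
    and z: "z \<noteq> 0"
  shows "(X has_field_derivative X' z) (at z)" "(Y has_field_derivative Y' z) (at z)"
proof -
  have dc: "((\<lambda>z. \<alpha> / (2 * z)) has_field_derivative - \<alpha> / (2 * z\<^sup>2)) (at z)"
    using z by (auto intro!: derivative_eq_intros simp: power2_eq_square)
  have de: "((\<lambda>z. exp (- z)) has_field_derivative - exp (- z)) (at z)"
    by (auto intro!: derivative_eq_intros)
  show "(X has_field_derivative X' z) (at z)"
    unfolding X_def
    by (rule DERIV_cong[OF DERIV_mult[OF de DERIV_diff[OF dP DERIV_mult[OF dc dQ]]]])
      (use z in \<open>simp add: X'_def field_simps power2_eq_square\<close>)
  show "(Y has_field_derivative Y' z) (at z)"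
    unfolding Y_def
    by (rule DERIV_cong[OF DERIV_mult[OF DERIV_exp DERIV_add[OF dQ DERIV_mult[OF dc dP]]]])
      (use z in \<open>simp add: Y'_def field_simps power2_eq_square\<close>)
qed

text \<open>The substitution (P, Q) -> (P - c Q, Q + c P) has determinant 1 + c^2, which is at least
  3/4 in modulus. It is the correction produced by the integration by parts, with c = \<alpha> / (2
  z); the condition on c then reads |z| \<ge> |\<alpha>|.\<close>

lemma unitary_invert_bound:
  fixes P Q x y c :: complex
  assumes x: "x = P - c * Q" and y: "y = Q + c * P" and c: "norm c \<le> 1 / 2"
  shows "norm (1 + c\<^sup>2) \<ge> 3 / 4" "(1 + c\<^sup>2) * P = x + c * y" "(1 + c\<^sup>2) * Q = y - c * x"
    "norm P \<le> 2 * (norm x + norm y)" "norm Q \<le> 2 * (norm x + norm y)"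
proof -
  have "norm (c\<^sup>2) \<le> (1 / 2)\<^sup>2"
    unfolding norm_power using c by (intro power_mono) auto
  moreover have "norm (1 :: complex) - norm (- c\<^sup>2) \<le> norm (1 - (- c\<^sup>2))"
    by (rule norm_triangle_ineq2)
  ultimately show *: "norm (1 + c\<^sup>2) \<ge> 3 / 4" by (simp add: power2_eq_square)
  have weaken: "a \<le> 2 * (b + d)" if "3 / 4 * a \<le> b + d" "0 \<le> b" "0 \<le> d" for a b d :: real
    using that by argo
  show P: "(1 + c\<^sup>2) * P = x + c * y" and Q: "(1 + c\<^sup>2) * Q = y - c * x"
    by (simp_all add: x y algebra_simps power2_eq_square)
  have mc: "norm (c * w) \<le> 1 / 2 * norm w" for w
    unfolding norm_mult using c by (intro mult_right_mono) auto
  have "3 / 4 * norm P \<le> norm ((1 + c\<^sup>2) * P)"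
    unfolding norm_mult using * by (intro mult_right_mono) auto
  also have "\<dots> \<le> norm x + norm (c * y)" unfolding P by (rule norm_triangle_ineq)
  also have "\<dots> \<le> norm x + norm y" using mc[of y] by (simp; smt (verit) norm_ge_zero)
  finally show "norm P \<le> 2 * (norm x + norm y)" by (rule weaken) simp_all
  have "3 / 4 * norm Q \<le> norm ((1 + c\<^sup>2) * Q)"
    unfolding norm_mult using * by (intro mult_right_mono) auto
  also have "\<dots> \<le> norm y + norm (c * x)" unfolding Q by (rule norm_triangle_ineq4)
  also have "\<dots> \<le> norm x + norm y" using mc[of x] by (simp; smt (verit) norm_ge_zero)
  finally show "norm Q \<le> 2 * (norm x + norm y)" by (rule weaken) simp_all
qed

text \<open>With kappa = exp (-2 Re z), constant on a vertical line, the pair (X, kappa Y) satisfies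
  the hypotheses of \<open>integrable_coefficient_limit\<close>. Limits on different lines agree
  because the derivatives on horizontal segments vanish as the height grows. Undoing the
  substitution costs another O(1/z).\<close>

lemma dirac_asymptotics:
  fixes P Q :: "complex \<Rightarrow> complex" and \<alpha> :: complex
  assumes dP: "\<And>z. Im z \<ge> 0 \<Longrightarrow> z \<noteq> 0 \<Longrightarrow> (P has_field_derivative P z - \<alpha> / z * Q z) (at z)"
    and dQ: "\<And>z. Im z \<ge> 0 \<Longrightarrow> z \<noteq> 0 \<Longrightarrow> (Q has_field_derivative - Q z - \<alpha> / z * P z) (at z)"
  obtains A B C where "C \<ge> 0"
    "\<And>z. Im z \<ge> 0 \<Longrightarrow> norm z \<ge> 1 + norm \<alpha> \<Longrightarrow>
       norm (exp (- z) * P z - A) \<le> C / norm z * (norm A + exp (- 2 * Re z) * norm B)"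
    "\<And>z. Im z \<ge> 0 \<Longrightarrow> norm z \<ge> 1 + norm \<alpha> \<Longrightarrow>
       exp (- 2 * Re z) * norm (exp z * Q z - B)
         \<le> C / norm z * (norm A + exp (- 2 * Re z) * norm B)"
proof -
  define R where "R = 1 + norm \<alpha>"
  have R: "R \<ge> 1" by (simp add: R_def)
  define X where "X = (\<lambda>z. exp (- z) * (P z - \<alpha> / (2 * z) * Q z))"
  define Y where "Y = (\<lambda>z. exp z * (Q z + \<alpha> / (2 * z) * P z))"
  define X' where "X' = (\<lambda>z. exp (- z) * (\<alpha> / (2 * z\<^sup>2) * (Q z + \<alpha> * P z)))"
  define Y' where "Y' = (\<lambda>z. - exp z * (\<alpha> / (2 * z\<^sup>2) * (P z + \<alpha> * Q z)))"
  \<comment> \<open>\<open>K / 8\<close> bounds the coefficient in \<open>X'\<close> and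
    \<open>Y'\<close>. The factor 8 is consumed later by adding two components, by S \<le> 2 |g|,
    and by (r + s)^2 \<le> 2 |z + i s|^2.\<close>
  define K where "K = 16 * norm \<alpha> * (1 + norm \<alpha>)"
  define S where "S = (\<lambda>z. norm (X z) + exp (- 2 * Re z) * norm (Y z))"
  have K: "K \<ge> 0" by (simp add: K_def)
  have dX: "(X has_field_derivative X' z) (at z)" and dY: "(Y has_field_derivative Y' z) (at z)"
    if "Im z \<ge> 0" "norm z \<ge> R" for z
  proof -
    have "z \<noteq> 0" using that R by auto
    from dirac_line[OF dP[OF that(1) this] dQ[OF that(1) this] this]
    show "(X has_field_derivative X' z) (at z)" "(Y has_field_derivative Y' z) (at z)"
      unfolding X_def Y_def X'_def Y'_def by auto
  qed
  have inv: "norm (exp (- z) * P z) \<le> 2 * S z" "exp (- 2 * Re z) * norm (exp z * Q z) \<le> 2 * S z"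
    and small: "norm (\<alpha> / (2 * z)) \<le> 1 / 2"
    and eqP: "exp (- z) * P z = X z + \<alpha> / (2 * z) * (exp (- 2 * z) * Y z) - (\<alpha> / (2 * z))\<^sup>2 * (exp (- z) * P z)"
    and eqQ: "exp z * Q z = Y z - \<alpha> / (2 * z) * (exp (2 * z) * X z) - (\<alpha> / (2 * z))\<^sup>2 * (exp z * Q z)"
    if z: "norm z \<ge> R" for z
  proof -
    have z0: "norm z > 0" using z R by linarith
    show c: "norm (\<alpha> / (2 * z)) \<le> 1 / 2"
      using z z0 by (simp add: norm_divide norm_mult R_def divide_simps)
    have x: "exp z * X z = P z - \<alpha> / (2 * z) * Q z" and y: "exp (- z) * Y z = Q z + \<alpha> / (2 * z) * P z"
      unfolding X_def Y_def by (simp_all add: mult.assoc[symmetric] exp_minus)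
    note u = unitary_invert_bound[OF x y c]
    have e1: "exp (- Re z) * exp (- Re z) = exp (- 2 * Re z)" and e2: "exp (- Re z) * exp (Re z) = 1"
      and e3: "exp (- 2 * Re z) * exp (Re z) = exp (- Re z)"
      by (simp_all flip: exp_add)
    have "exp (- Re z) * norm (P z) \<le> exp (- Re z) * (2 * (norm (exp z * X z) + norm (exp (- z) * Y z)))"
      using u(4) by (intro mult_left_mono) auto
    also have "\<dots> = 2 * S z"
      using e1 e2 by (simp add: S_def norm_mult algebra_simps)
    finally show "norm (exp (- z) * P z) \<le> 2 * S z" by (simp add: norm_mult)
    have "exp (- Re z) * norm (Q z) \<le> exp (- Re z) * (2 * (norm (exp z * X z) + norm (exp (- z) * Y z)))"
      using u(5) by (intro mult_left_mono) auto
    also have "\<dots> = 2 * S z"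
      using e1 e2 by (simp add: S_def norm_mult algebra_simps)
    finally show "exp (- 2 * Re z) * norm (exp z * Q z) \<le> 2 * S z"
      using e3 by (simp add: norm_mult mult.assoc[symmetric])
    have e4: "exp (- z) * exp z = 1" "exp (- z) * exp (- z) = exp (- 2 * z)"
      "exp z * exp z = exp (2 * z)" by (simp_all flip: exp_add)
    have "exp (- z) * ((1 + (\<alpha> / (2 * z))\<^sup>2) * P z) = (exp (- z) * exp z) * X z + \<alpha> / (2 * z) * ((exp (- z) * exp (- z)) * Y z)"
      unfolding u(2) by (simp only: algebra_simps)
    thus "exp (- z) * P z = X z + \<alpha> / (2 * z) * (exp (- 2 * z) * Y z) - (\<alpha> / (2 * z))\<^sup>2 * (exp (- z) * P z)"
      unfolding e4 by (simp only: algebra_simps mult_1_left)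
    have "exp z * ((1 + (\<alpha> / (2 * z))\<^sup>2) * Q z) = (exp (- z) * exp z) * Y z - \<alpha> / (2 * z) * ((exp z * exp z) * X z)"
      unfolding u(3) by (simp only: algebra_simps)
    thus "exp z * Q z = Y z - \<alpha> / (2 * z) * (exp (2 * z) * X z) - (\<alpha> / (2 * z))\<^sup>2 * (exp z * Q z)"
      unfolding e4 by (simp only: algebra_simps mult_1_left)
  qed
  have bX: "norm (X' z) \<le> K / 8 / (norm z)\<^sup>2 * S z"
    and bY: "exp (- 2 * Re z) * norm (Y' z) \<le> K / 8 / (norm z)\<^sup>2 * S z" if z: "norm z \<ge> R" for z
  proof -
    have z0: "norm z > 0" using z R by linarith
    have e3: "exp (- 2 * Re z) * exp (Re z) = exp (- Re z)" by (simp flip: exp_add)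
    define p where "p = exp (- Re z) * norm (P z)"
    define q where "q = exp (- Re z) * norm (Q z)"
    have p: "p \<le> 2 * S z" "q \<le> 2 * S z" "p \<ge> 0" "q \<ge> 0" "S z \<ge> 0"
      using inv[OF z] e3 by (simp_all add: p_def q_def S_def norm_mult mult.assoc[symmetric])
    have "norm (X' z) \<le> exp (- Re z) * (norm \<alpha> / (2 * (norm z)\<^sup>2) * (norm (Q z) + norm \<alpha> * norm (P z)))"
      unfolding X'_def norm_mult norm_divide norm_power norm_exp_eq_Re
      by (intro mult_mono order.refl norm_triangle_le) (auto simp: norm_mult)
    also have "\<dots> = norm \<alpha> / (2 * (norm z)\<^sup>2) * (q + norm \<alpha> * p)"
      by (simp add: p_def q_def algebra_simps add_divide_distrib)
    also have "\<dots> \<le> norm \<alpha> / (2 * (norm z)\<^sup>2) * (2 * S z + norm \<alpha> * (2 * S z))"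
      using p by (intro mult_left_mono add_mono) auto
    also have "\<dots> = norm \<alpha> * (1 + norm \<alpha>) / (norm z)\<^sup>2 * S z"
      using z0 by (simp add: field_simps)
    also have "\<dots> \<le> K / 8 / (norm z)\<^sup>2 * S z"
      using p by (intro mult_right_mono divide_right_mono) (auto simp: K_def)
    finally show "norm (X' z) \<le> K / 8 / (norm z)\<^sup>2 * S z" .
    have "exp (- 2 * Re z) * norm (Y' z) \<le> exp (- 2 * Re z) * (exp (Re z) * (norm \<alpha> / (2 * (norm z)\<^sup>2) * (norm (P z) + norm \<alpha> * norm (Q z))))"
      unfolding Y'_def norm_mult norm_divide norm_power norm_exp_eq_Re norm_minus_cancel
      by (intro mult_mono order.refl norm_triangle_le) (auto simp: norm_mult)
    also have "\<dots> = norm \<alpha> / (2 * (norm z)\<^sup>2) * (p + norm \<alpha> * q)"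
      unfolding mult.assoc[symmetric] e3 by (simp add: p_def q_def algebra_simps add_divide_distrib)
    also have "\<dots> \<le> norm \<alpha> / (2 * (norm z)\<^sup>2) * (2 * S z + norm \<alpha> * (2 * S z))"
      using p by (intro mult_left_mono add_mono) auto
    also have "\<dots> = norm \<alpha> * (1 + norm \<alpha>) / (norm z)\<^sup>2 * S z"
      using z0 by (simp add: field_simps)
    also have "\<dots> \<le> K / 8 / (norm z)\<^sup>2 * S z"
      using p by (intro mult_right_mono divide_right_mono) (auto simp: K_def)
    finally show "exp (- 2 * Re z) * norm (Y' z) \<le> K / 8 / (norm z)\<^sup>2 * S z" .
  qed
  have line: "\<exists>A B. ((\<lambda>s. X (z + \<i> * of_real s)) \<longlongrightarrow> A) at_top \<and> ((\<lambda>s. Y (z + \<i> * of_real s)) \<longlongrightarrow> B) at_top \<and>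
      norm (X z - A) \<le> K * exp K * (norm A + exp (- 2 * Re z) * norm B) / norm z \<and>
      exp (- 2 * Re z) * norm (Y z - B) \<le> K * exp K * (norm A + exp (- 2 * Re z) * norm B) / norm z \<and>
      S z \<le> 2 * (exp K * (norm A + exp (- 2 * Re z) * norm B)) \<and>
      (\<forall>s\<ge>0. S (z + \<i> * of_real s) \<le> 2 * (exp K * S z))"
    if z: "Im z \<ge> 0" "norm z \<ge> R" for z
  proof -
    define \<kappa> where "\<kappa> = exp (- 2 * Re z)"
    \<comment> \<open>The abstract lemma wants a weight linear in s. The sum |Re z| + Im z + s lies
      between |z + i s| and sqrt 2 times that modulus.\<close>
    define r where "r = \<bar>Re z\<bar> + Im z"
    define g where "g = (\<lambda>s. (X (z + \<i> * of_real s), of_real \<kappa> * Y (z + \<i> * of_real s)))"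
    define g' where "g' = (\<lambda>s. (\<i> * X' (z + \<i> * of_real s), of_real \<kappa> * (\<i> * Y' (z + \<i> * of_real s))))"
    have \<kappa>: "\<kappa> > 0" by (simp add: \<kappa>_def)
    have rz: "norm z \<le> r" unfolding r_def using cmod_le[of z] z by simp
    have big: "norm (z + \<i> * of_real s) \<ge> R" if "s \<ge> 0" for s
    proof -
      have "norm z \<le> norm (z + \<i> * of_real s)"
        unfolding cmod_def using that z by (simp add: power_mono)
      thus ?thesis using z by simp
    qed
    have sq: "(r + s)\<^sup>2 \<le> 2 * (norm (z + \<i> * of_real s))\<^sup>2" if "s \<ge> 0" for s
    proof -
      have "(norm (z + \<i> * of_real s))\<^sup>2 = \<bar>Re z\<bar>\<^sup>2 + (Im z + s)\<^sup>2" by (simp add: cmod_power2)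
      moreover have "2 * (\<bar>Re z\<bar>\<^sup>2 + (Im z + s)\<^sup>2) - (r + s)\<^sup>2 = (\<bar>Re z\<bar> - (Im z + s))\<^sup>2"
        by (simp add: r_def power2_eq_square algebra_simps)
      ultimately show ?thesis using zero_le_power2[of "\<bar>Re z\<bar> - (Im z + s)"] by argo
    qed
    have Sg: "S (z + \<i> * of_real s) \<le> 2 * norm (g s)" for s
    proof -
      have "norm (X (z + \<i> * of_real s)) \<le> norm (g s)" "norm (of_real \<kappa> * Y (z + \<i> * of_real s)) \<le> norm (g s)"
        unfolding g_def using norm_fst_le norm_snd_le by blast+
      thus ?thesis using \<kappa> by (simp add: S_def \<kappa>_def norm_mult)
    qed
    have gS: "norm (g s) \<le> S (z + \<i> * of_real s)" for s
      using norm_Pair_le[of "X (z + \<i> * of_real s)" "of_real \<kappa> * Y (z + \<i> * of_real s)"] \<kappa>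
      by (simp add: g_def S_def \<kappa>_def norm_mult)
    have gd: "(g has_vector_derivative g' s) (at s)" if "s \<ge> 0" for s
    proof -
      have l: "((\<lambda>s. z + \<i> * of_real s) has_vector_derivative \<i>) (at s)"
        by (auto intro!: derivative_eq_intros)
      have "((X \<circ> (\<lambda>s. z + \<i> * of_real s)) has_vector_derivative \<i> * X' (z + \<i> * of_real s)) (at s)"
        by (rule field_vector_diff_chain_at[OF l dX]) (use z that big in auto)
      moreover have "((Y \<circ> (\<lambda>s. z + \<i> * of_real s)) has_vector_derivative \<i> * Y' (z + \<i> * of_real s)) (at s)"
        by (rule field_vector_diff_chain_at[OF l dY]) (use z that big in auto)
      ultimately show ?thesis unfolding g_def g'_def o_def
        by (intro has_vector_derivative_Pair has_vector_derivative_mult_right)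
    qed
    have gb: "norm (g' s) \<le> K / (r + s)\<^sup>2 * norm (g s)" if s: "s \<ge> 0" for s
    proof -
      let ?z = "z + \<i> * of_real s"
      have pos: "norm ?z > 0" using big[OF s] R by linarith
      have rp: "r + s > 0" using rz z R s by linarith
      have "norm (g' s) \<le> norm (X' ?z) + exp (- 2 * Re ?z) * norm (Y' ?z)"
        using norm_Pair_le[of "\<i> * X' ?z" "of_real \<kappa> * (\<i> * Y' ?z)"] \<kappa>
        by (simp add: g'_def norm_mult \<kappa>_def)
      also have "\<dots> \<le> K / 8 / (norm ?z)\<^sup>2 * S ?z + K / 8 / (norm ?z)\<^sup>2 * S ?z"
        by (intro add_mono bX bY big s)
      also have "\<dots> = K / (norm ?z)\<^sup>2 * (S ?z / 4)" by simp
      also have "\<dots> \<le> K / (norm ?z)\<^sup>2 * (norm (g s) / 2)"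
        using Sg[of s] K by (intro mult_left_mono) auto
      also have "\<dots> = K / (2 * (norm ?z)\<^sup>2) * norm (g s)" by simp
      also have "\<dots> \<le> K / (r + s)\<^sup>2 * norm (g s)"
        using sq[OF s] rp K pos by (intro mult_right_mono divide_left_mono) auto
      finally show ?thesis .
    qed
    have r1: "r \<ge> 1" using rz z R by linarith
    obtain L where L: "(g \<longlongrightarrow> L) at_top"
      "\<And>s. s \<ge> 0 \<Longrightarrow> norm (g s - L) \<le> K * exp K * norm L / (r + s)"
      "\<And>s. s \<ge> 0 \<Longrightarrow> norm (g s) \<le> exp K * norm L"
      "\<And>s. s \<ge> 0 \<Longrightarrow> norm (g s) \<le> exp K * norm (g 0)"
      using integrable_coefficient_limit[OF gd gb r1 K] by metis
    define A where "A = fst L"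
    define B where "B = snd L / of_real \<kappa>"
    have LA: "L = (A, of_real \<kappa> * B)" using \<kappa> by (simp add: A_def B_def)
    have nL: "norm L \<le> norm A + \<kappa> * norm B"
      using norm_Pair_le[of A "of_real \<kappa> * B"] \<kappa> by (simp add: LA norm_mult)
    have "((\<lambda>s. fst (g s)) \<longlongrightarrow> A) at_top" "((\<lambda>s. snd (g s) / of_real \<kappa>) \<longlongrightarrow> B) at_top"
      unfolding A_def B_def using \<kappa> by (intro tendsto_intros L; simp)+
    hence lims: "((\<lambda>s. X (z + \<i> * of_real s)) \<longlongrightarrow> A) at_top" "((\<lambda>s. Y (z + \<i> * of_real s)) \<longlongrightarrow> B) at_top"
      using \<kappa> by (simp_all add: g_def)
    have "norm (g 0 - L) \<le> K * exp K * norm L / r" using L(2)[of 0] by simp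
    also have "\<dots> \<le> K * exp K * (norm A + \<kappa> * norm B) / norm z"
    proof (intro frac_le mult_left_mono nL rz)
      show "0 < norm z" using z R by linarith
    qed (use K \<kappa> in auto)
    finally have d: "norm (g 0 - L) \<le> K * exp K * (norm A + \<kappa> * norm B) / norm z" .
    have "norm (X z - A) \<le> norm (g 0 - L)"
      using norm_fst_le[of "X z - A" "of_real \<kappa> * Y z - of_real \<kappa> * B"] by (simp add: g_def LA)
    moreover have "\<kappa> * norm (Y z - B) \<le> norm (g 0 - L)"
    proof -
      have "\<kappa> * norm (Y z - B) = norm (of_real \<kappa> * Y z - of_real \<kappa> * B)"
        using \<kappa> by (simp add: norm_mult flip: right_diff_distrib)
      thus ?thesis using norm_snd_le[of "of_real \<kappa> * Y z - of_real \<kappa> * B" "X z - A"] by (simp add: g_def LA)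
    qed
    moreover have "S z \<le> 2 * (exp K * (norm A + \<kappa> * norm B))"
    proof -
      have "S z \<le> 2 * norm (g 0)" using Sg[of 0] by simp
      also have "\<dots> \<le> 2 * (exp K * norm L)" using L(3)[of 0] by simp
      also have "\<dots> \<le> 2 * (exp K * (norm A + \<kappa> * norm B))" using nL by simp
      finally show ?thesis .
    qed
    moreover have "S (z + \<i> * of_real s) \<le> 2 * (exp K * S z)" if "s \<ge> 0" for s
    proof -
      have "S (z + \<i> * of_real s) \<le> 2 * norm (g s)" by (rule Sg)
      also have "\<dots> \<le> 2 * (exp K * norm (g 0))" using L(4)[OF that] by simp
      also have "\<dots> \<le> 2 * (exp K * S z)" using gS[of 0] by simp
      finally show ?thesis .
    qed
    ultimately show ?thesis using lims d unfolding \<kappa>_def by (meson order_trans)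
  qed
  \<comment> \<open>Two vertical lines are joined by horizontal segments of fixed length. The last
    clause of \<open>line\<close> carries the bound on the compact base segment at height R upwards,
    so \<open>X'\<close> and \<open>Y'\<close> are O((R + s)^-2) on the segment at height R +
    s.\<close>
  have const: "((\<lambda>s. X (of_real b + \<i> * of_real (R + s)) - X (of_real a + \<i> * of_real (R + s))) \<longlongrightarrow> 0) at_top \<and>
     ((\<lambda>s. Y (of_real b + \<i> * of_real (R + s)) - Y (of_real a + \<i> * of_real (R + s))) \<longlongrightarrow> 0) at_top"
    if ab: "a \<le> b" for a b :: real
  proof -
    have base: "Im (of_real x + \<i> * of_real R) \<ge> 0" "norm (of_real x + \<i> * of_real R) \<ge> R" for x
      using R abs_Im_le_cmod[of "of_real x + \<i> * of_real R"] by simp_all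
    have "continuous_on {a..b} (\<lambda>x. S (of_real x + \<i> * of_real R))"
    proof -
      have "isCont X (of_real x + \<i> * of_real R)" "isCont Y (of_real x + \<i> * of_real R)" for x
        using DERIV_isCont dX dY base by blast+
      hence "isCont (\<lambda>x. X (of_real x + \<i> * of_real R)) x" "isCont (\<lambda>x. Y (of_real x + \<i> * of_real R)) x" for x
        by (auto intro!: isCont_o2[where f = "\<lambda>x. of_real x + \<i> * of_real R" and g = X]
            isCont_o2[where f = "\<lambda>x. of_real x + \<i> * of_real R" and g = Y] continuous_intros)
      hence "isCont (\<lambda>x. norm (X (of_real x + \<i> * of_real R)) + exp (- 2 * x) * norm (Y (of_real x + \<i> * of_real R))) x" for x
        by (intro continuous_intros)
      thus ?thesis unfolding S_def by (intro continuous_at_imp_continuous_on) simp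
    qed
    from compact_continuous_image[OF this] obtain M where
      M: "\<And>x. x \<in> {a..b} \<Longrightarrow> norm (S (of_real x + \<i> * of_real R)) \<le> M"
      by (meson compact_Icc compact_imp_bounded bounded_iff imageI)
    have M0: "M \<ge> 0" using M[of a] ab by (smt (verit) atLeastAtMost_iff norm_ge_zero)
    define e where "e = (\<lambda>s::real. K / 8 / (R + s)\<^sup>2 * (2 * (exp K * M)))"
    have e: "norm (X' (of_real x + \<i> * of_real (R + s))) \<le> e s"
      "norm (Y' (of_real x + \<i> * of_real (R + s))) \<le> exp (2 * (\<bar>a\<bar> + \<bar>b\<bar>)) * e s"
      if s: "s \<ge> 0" and x: "x \<in> {a..b}" for s x
    proof -
      let ?z = "of_real x + \<i> * of_real (R + s)"
      have zb: "norm ?z \<ge> R + s"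
        using abs_Im_le_cmod[of ?z] s R by simp
      have "S ?z \<le> 2 * (exp K * S (of_real x + \<i> * of_real R))"
      proof -
        have "of_real x + \<i> * of_real R + \<i> * of_real s = ?z" by (simp add: algebra_simps)
        thus ?thesis using line[OF base[of x]] s by metis
      qed
      also have "\<dots> \<le> 2 * (exp K * M)" using M[OF x] by simp
      finally have Sz: "S ?z \<le> 2 * (exp K * M)" .
      have 1: "K / 8 / (norm ?z)\<^sup>2 * S ?z \<le> e s"
        unfolding e_def
      proof (intro mult_mono Sz divide_left_mono power_mono zb)
        show "0 \<le> S ?z" by (simp add: S_def)
        show "0 < (cmod ?z)\<^sup>2 * (R + s)\<^sup>2" using zb s R by (intro mult_pos_pos zero_less_power) linarith+
      qed (use K R s M0 in auto)
      thus "norm (X' ?z) \<le> e s" using bX[of ?z] zb s by simp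
      have "exp (- 2 * x) * norm (Y' ?z) \<le> e s" using bY[of ?z] 1 zb s by simp
      hence "norm (Y' ?z) \<le> exp (2 * x) * e s"
        by (simp add: exp_minus field_simps)
      also have "\<dots> \<le> exp (2 * (\<bar>a\<bar> + \<bar>b\<bar>)) * e s"
      proof (intro mult_right_mono)
        show "exp (2 * x) \<le> exp (2 * (\<bar>a\<bar> + \<bar>b\<bar>))" using x by auto
      qed (use K M0 in \<open>auto simp: e_def\<close>)
      finally show "norm (Y' ?z) \<le> exp (2 * (\<bar>a\<bar> + \<bar>b\<bar>)) * e s" .
    qed
    have e0: "(e \<longlongrightarrow> 0) at_top"
    proof -
      have "filterlim (\<lambda>s. (R + s)\<^sup>2) at_top at_top"
        by (intro filterlim_pow_at_top filterlim_tendsto_add_at_top tendsto_const filterlim_ident) auto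
      thus ?thesis unfolding e_def divide_divide_eq_left
        by (intro tendsto_mult_left_zero real_tendsto_divide_at_top[OF tendsto_const])
          (auto intro!: filterlim_tendsto_pos_mult_at_top[OF tendsto_const])
    qed
    have mv: "norm (F (of_real b + \<i> * of_real (R + s)) - F (of_real a + \<i> * of_real (R + s))) \<le> c * (b - a)"
      if "s \<ge> 0" and F: "\<And>z. Im z \<ge> 0 \<Longrightarrow> norm z \<ge> R \<Longrightarrow> (F has_field_derivative F' z) (at z)"
        and c: "\<And>x. x \<in> {a..b} \<Longrightarrow> norm (F' (of_real x + \<i> * of_real (R + s))) \<le> c" for s F F' c
    proof -
      let ?p = "of_real a + \<i> * of_real (R + s)" and ?q = "of_real b + \<i> * of_real (R + s)"
      have seg: "\<exists>x\<in>{a..b}. z = of_real x + \<i> * of_real (R + s)" if "z \<in> closed_segment ?p ?q" for z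
      proof -
        from that obtain u where u: "0 \<le> u" "u \<le> 1" "z = (1 - u) *\<^sub>R ?p + u *\<^sub>R ?q"
          by (auto simp: in_segment)
        have "z = of_real ((1 - u) * a + u * b) + \<i> * of_real (R + s)"
          unfolding u(3) by (simp add: complex_eq_iff algebra_simps)
        moreover have "(1 - u) * a + u * b \<in> {a..b}"
        proof -
          have "u * (b - a) \<ge> 0" "(1 - u) * (b - a) \<ge> 0" using u ab by auto
          thus ?thesis by (auto simp: algebra_simps)
        qed
        ultimately show ?thesis by blast
      qed
      have "norm (F ?q - F ?p) \<le> c * norm (?q - ?p)"
      proof (rule field_differentiable_bound[of "closed_segment ?p ?q" F F' c ?q ?p])
        fix z assume "z \<in> closed_segment ?p ?q"
        then obtain x where x: "x \<in> {a..b}" "z = of_real x + \<i> * of_real (R + s)" using seg by blast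
        have "Im z \<ge> 0" "norm z \<ge> R"
          using abs_Im_le_cmod[of z] \<open>s \<ge> 0\<close> R unfolding x by simp_all
        thus "(F has_field_derivative F' z) (at z within closed_segment ?p ?q)"
          using F has_field_derivative_at_within by blast
        show "norm (F' z) \<le> c" using c x by simp
      qed auto
      also have "norm (?q - ?p) = b - a"
      proof -
        have "?q - ?p = of_real (b - a)" by simp
        thus ?thesis using ab by (simp only: norm_of_real)
      qed
      finally show ?thesis .
    qed
    have z1: "((\<lambda>s. e s * (b - a)) \<longlongrightarrow> 0) at_top" "((\<lambda>s. (exp (2 * (\<bar>a\<bar> + \<bar>b\<bar>)) * e s) * (b - a)) \<longlongrightarrow> 0) at_top"
      using e0 by (auto intro!: tendsto_mult_left_zero tendsto_mult_right_zero)
    show ?thesis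
    proof
      show "((\<lambda>s. X (of_real b + \<i> * of_real (R + s)) - X (of_real a + \<i> * of_real (R + s))) \<longlongrightarrow> 0) at_top"
        by (rule Lim_null_comparison[OF _ z1(1)], rule eventually_mono[OF eventually_ge_at_top[of 0]])
          (rule mv[OF _ dX e(1)], auto)
      show "((\<lambda>s. Y (of_real b + \<i> * of_real (R + s)) - Y (of_real a + \<i> * of_real (R + s))) \<longlongrightarrow> 0) at_top"
        by (rule Lim_null_comparison[OF _ z1(2)], rule eventually_mono[OF eventually_ge_at_top[of 0]])
          (rule mv[OF _ dY e(2)], auto)
    qed
  qed
  have base0: "Im (\<i> * of_real R) \<ge> 0" "norm (\<i> * of_real R) \<ge> R" using R by (simp_all add: norm_mult)
  from line[OF base0] obtain A B where
    A: "((\<lambda>s. X (\<i> * of_real R + \<i> * of_real s)) \<longlongrightarrow> A) at_top" and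
    B: "((\<lambda>s. Y (\<i> * of_real R + \<i> * of_real s)) \<longlongrightarrow> B) at_top" by blast
  have allx: "((\<lambda>s. X (of_real x + \<i> * of_real (R + s))) \<longlongrightarrow> A) at_top \<and>
      ((\<lambda>s. Y (of_real x + \<i> * of_real (R + s))) \<longlongrightarrow> B) at_top" for x
  proof (cases "x \<ge> 0")
    case True
    from const[OF this] A B show ?thesis
      by (auto simp: distrib_left dest: Lim_transform)
  next
    case False
    hence "x \<le> 0" by simp
    from const[OF this] A B show ?thesis
      by (auto simp: distrib_left dest: Lim_transform2)
  qed
  have allz: "((\<lambda>s. X (z + \<i> * of_real s)) \<longlongrightarrow> A) at_top \<and> ((\<lambda>s. Y (z + \<i> * of_real s)) \<longlongrightarrow> B) at_top" for z
  proof -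
    \<comment> \<open>Each vertical line is a reparametrisation of the one started at height R; Im z
      - R may be negative, which does not affect the limit.\<close>
    have shift: "filterlim (\<lambda>s. (Im z - R) + s) at_top at_top"
      by (rule filterlim_tendsto_add_at_top[OF tendsto_const filterlim_ident])
    have eq: "of_real (Re z) + \<i> * of_real (R + ((Im z - R) + s)) = z + \<i> * of_real s" for s
      by (simp add: complex_eq_iff)
    show ?thesis
      using filterlim_compose[OF conjunct1[OF allx[of "Re z"]] shift]
        filterlim_compose[OF conjunct2[OF allx[of "Re z"]] shift] unfolding eq by blast
  qed
  \<comment> \<open>The summand K stems from the error of \<open>X\<close> and \<open>Y\<close>, the
    multiple of |\<alpha>| from the two correction terms containing c = \<alpha> / (2 z); exp K is
    the loss in bounding \<open>S\<close> by the limits.\<close>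
  define C where "C = exp K * (K + 3 * norm \<alpha>)"
  have C: "C \<ge> 0" using K by (simp add: C_def)
  have main: "norm (exp (- z) * P z - A) \<le> C / norm z * (norm A + exp (- 2 * Re z) * norm B) \<and>
     exp (- 2 * Re z) * norm (exp z * Q z - B) \<le> C / norm z * (norm A + exp (- 2 * Re z) * norm B)"
    if z: "Im z \<ge> 0" "norm z \<ge> R" for z
  proof -
    define \<kappa> where "\<kappa> = exp (- 2 * Re z)"
    define T where "T = norm A + \<kappa> * norm B"
    define c where "c = \<alpha> / (2 * z)"
    have z0: "norm z > 0" using z R by linarith
    have \<kappa>: "\<kappa> > 0" by (simp add: \<kappa>_def)
    have T: "T \<ge> 0" using \<kappa> by (simp add: T_def)
    obtain A1 B1 where
      lims: "((\<lambda>s. X (z + \<i> * of_real s)) \<longlongrightarrow> A1) at_top" "((\<lambda>s. Y (z + \<i> * of_real s)) \<longlongrightarrow> B1) at_top"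
      and est: "norm (X z - A1) \<le> K * exp K * (norm A1 + exp (- 2 * Re z) * norm B1) / norm z"
      "exp (- 2 * Re z) * norm (Y z - B1) \<le> K * exp K * (norm A1 + exp (- 2 * Re z) * norm B1) / norm z"
      "S z \<le> 2 * (exp K * (norm A1 + exp (- 2 * Re z) * norm B1))"
      using line[OF z] by (elim exE conjE) (rule that)
    have "A1 = A"
      by (rule tendsto_unique[OF trivial_limit_at_top_linorder lims(1) conjunct1[OF allz[of z]]])
    moreover have "B1 = B"
      by (rule tendsto_unique[OF trivial_limit_at_top_linorder lims(2) conjunct2[OF allz[of z]]])
    ultimately have AB: "A1 = A" "B1 = B" by simp_all
    have est: "norm (X z - A) \<le> K * exp K * T / norm z" "\<kappa> * norm (Y z - B) \<le> K * exp K * T / norm z"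
      "S z \<le> 2 * (exp K * T)" using est unfolding AB T_def \<kappa>_def .
    have Xs: "norm (X z) \<le> S z" "\<kappa> * norm (Y z) \<le> S z" by (simp_all add: S_def \<kappa>_def)
    have c: "norm c \<le> 1 / 2" "norm c = norm \<alpha> / 2 / norm z"
      using small[OF z(2)] by (simp_all add: c_def norm_divide norm_mult)
    have cc: "norm (c\<^sup>2) \<le> norm c * (1 / 2)"
      unfolding power2_eq_square norm_mult using c(1) by (intro mult_left_mono) auto
    have tot: "K * exp K * T / norm z + norm c * S z + norm (c\<^sup>2) * (2 * S z) \<le> C / norm z * T"
    proof -
      have half: "p * (2 * q) \<le> b * q" if "p \<le> b * (1 / 2)" "q \<ge> 0" for p q b :: real
        using mult_right_mono[OF that] by simp
      have dbl: "a + b * q + x \<le> a + b * (2 * q)" if "x \<le> b * q" for a b q x :: real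
        using that by simp
      have "S z \<ge> 0" by (simp add: S_def)
      from dbl[OF half[OF cc this]]
      have "K * exp K * T / norm z + norm c * S z + norm (c\<^sup>2) * (2 * S z) \<le> K * exp K * T / norm z + norm c * (2 * S z)" .
      also have "\<dots> \<le> K * exp K * T / norm z + norm c * (2 * (2 * (exp K * T)))"
        using est(3) by (intro add_left_mono mult_left_mono) auto
      also have "\<dots> = exp K * (K + 2 * norm \<alpha>) / norm z * T"
      proof -
        have "k * e * T / n + a / 2 / n * (2 * (2 * (e * T))) = e * (k + 2 * a) / n * T" for k e a n :: real
          by (simp add: add_divide_distrib algebra_simps)
        thus ?thesis unfolding c(2) .
      qed
      also have "\<dots> \<le> C / norm z * T"
        unfolding C_def using z0 T by (intro mult_right_mono divide_right_mono mult_left_mono) auto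
      finally show ?thesis .
    qed
    have tri: "norm (a + b - d) \<le> norm a + norm b + norm d" for a b d :: complex
      by (rule order_trans[OF norm_triangle_ineq4 add_right_mono[OF norm_triangle_ineq]])
    have tri': "norm (a - b - d) \<le> norm a + norm b + norm d" for a b d :: complex
      by (rule order_trans[OF norm_triangle_ineq4 add_right_mono[OF norm_triangle_ineq4]])
    \<comment> \<open>The relation \<open>eqP\<close> keeps the term with c^2 on the right instead
      of dividing by 1 + c^2. The crude bound \<open>inv\<close> on P suffices for it, since c^2 is
      of higher order.\<close>
    have "exp (- z) * P z - A = (X z - A) + c * (exp (- 2 * z) * Y z) - c\<^sup>2 * (exp (- z) * P z)"
      by (subst eqP[OF z(2)]) (simp add: c_def)
    hence "norm (exp (- z) * P z - A) \<le> norm (X z - A) + norm (c * (exp (- 2 * z) * Y z)) + norm (c\<^sup>2 * (exp (- z) * P z))"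
      by (simp only: tri)
    also have "\<dots> \<le> K * exp K * T / norm z + norm c * S z + norm (c\<^sup>2) * (2 * S z)"
    proof (intro add_mono est)
      show "norm (c * (exp (- 2 * z) * Y z)) \<le> norm c * S z"
        unfolding norm_mult using Xs(2) by (intro mult_left_mono) (auto simp: \<kappa>_def)
      show "norm (c\<^sup>2 * (exp (- z) * P z)) \<le> norm (c\<^sup>2) * (2 * S z)"
        unfolding norm_mult[of "c\<^sup>2"] using inv(1)[OF z(2)] by (intro mult_left_mono) auto
    qed
    also note tot
    finally have 1: "norm (exp (- z) * P z - A) \<le> C / norm z * T" .
    have "exp z * Q z - B = (Y z - B) - c * (exp (2 * z) * X z) - c\<^sup>2 * (exp z * Q z)"
      by (subst eqQ[OF z(2)]) (simp add: c_def)
    hence "norm (exp z * Q z - B) \<le> norm (Y z - B) + norm (c * (exp (2 * z) * X z)) + norm (c\<^sup>2 * (exp z * Q z))"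
      by (simp only: tri')
    hence "\<kappa> * norm (exp z * Q z - B) \<le> \<kappa> * (norm (Y z - B) + norm (c * (exp (2 * z) * X z)) + norm (c\<^sup>2 * (exp z * Q z)))"
      using \<kappa> by simp
    also have "\<dots> = \<kappa> * norm (Y z - B) + norm c * (\<kappa> * norm (exp (2 * z) * X z)) + norm (c\<^sup>2) * (\<kappa> * norm (exp z * Q z))"
      by (simp add: norm_mult algebra_simps)
    also have "\<dots> \<le> K * exp K * T / norm z + norm c * S z + norm (c\<^sup>2) * (2 * S z)"
    proof (intro add_mono mult_left_mono est)
      have "\<kappa> * norm (exp (2 * z) * X z) = norm (X z)"
        by (simp add: \<kappa>_def norm_mult mult.assoc[symmetric] flip: exp_add)
      thus "\<kappa> * norm (exp (2 * z) * X z) \<le> S z" using Xs by simp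
      show "\<kappa> * norm (exp z * Q z) \<le> 2 * S z" using inv(2)[OF z(2)] by (simp add: \<kappa>_def)
    qed auto
    also note tot
    finally have 2: "\<kappa> * norm (exp z * Q z - B) \<le> C / norm z * T" .
    show ?thesis using 1 2 by (simp add: T_def \<kappa>_def)
  qed
  show ?thesis
    by (rule that[OF C conjunct1[OF main] conjunct2[OF main]]) (simp_all only: R_def)
qed

section \<open>The Bessel series\<close>

text \<open>This is the hypergeometric function 0F1(; c; y/4). Taken at y = z^2 it is the entire
  part of a Bessel function, separated from the multivalued power of z.\<close>

definition bessel_series :: "complex \<Rightarrow> complex \<Rightarrow> complex" where
  "bessel_series c y = (\<Sum>n. 1 / (4 ^ n * fact n * pochhammer c n) * y ^ n)"

lemma pochhammer_nonzero:
  assumes "Re c > 0"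
  shows "pochhammer c n \<noteq> (0 :: complex)"
proof
  assume "pochhammer c n = 0"
  then obtain k where "c = - of_nat k" by (auto simp: pochhammer_eq_0_iff)
  thus False using assms by simp
qed

lemma not_nonpos_Int: "Re c > 0 \<Longrightarrow> c \<notin> \<int>\<^sub>\<le>\<^sub>0"
  by (auto simp: complex_nonpos_Reals_iff dest!: nonpos_Ints_subset_nonpos_Reals[THEN subsetD])

lemma norm_add_of_nat_ge: "Re c + real n \<le> norm (c + of_nat n)"
  using complex_Re_le_cmod[of "c + of_nat n"] by simp

lemma summable_bessel_series:
  assumes c: "Re c > 0"
  shows "summable (\<lambda>n. 1 / (4 ^ n * fact n * pochhammer c n) * y ^ n)"
proof -
  define M where "M = nat \<lceil>norm y / Re c\<rceil>"
  have M: "norm y / Re c \<le> real M" unfolding M_def by (rule real_nat_ceiling_ge)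
  show ?thesis
  proof (rule summable_ratio_test[of "1/2" M])
    fix n assume n: "n \<ge> M"
    have "norm y \<le> real M * Re c" using M c by (simp add: field_simps)
    also have "\<dots> \<le> 2 * (1 + real n) * Re c" using n c by (intro mult_right_mono) auto
    also have "\<dots> \<le> 2 * (1 + real n) * norm (c + of_nat n)"
      using norm_add_of_nat_ge[of c n] by (intro mult_left_mono) auto
    finally have "norm y \<le> 2 * (1 + real n) * norm (c + of_nat n)" .
    moreover have "norm (c + of_nat n) > 0" using norm_add_of_nat_ge[of c n] c by linarith
    moreover have q: "a / (4 * b * d) \<le> 1 / 2" if "a \<le> 2 * b * d" "b > 0" "d > 0" for a b d :: real
    proof -
      have "b * d > 0" using that by simp
      thus ?thesis using that by (simp add: field_simps)
    qed
    ultimately have "norm y / (4 * (1 + real n) * norm (c + of_nat n)) \<le> 1 / 2"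
      by (intro q) simp_all
    hence "norm y / (4 * (1 + real n) * norm (c + of_nat n)) * norm (1 / (4 ^ n * fact n * pochhammer c n) * y ^ n)
        \<le> 1 / 2 * norm (1 / (4 ^ n * fact n * pochhammer c n) * y ^ n)"
      by (intro mult_right_mono) auto
    also have "norm y / (4 * (1 + real n) * norm (c + of_nat n)) * norm (1 / (4 ^ n * fact n * pochhammer c n) * y ^ n)
      = norm (1 / (4 ^ Suc n * fact (Suc n) * pochhammer c (Suc n)) * y ^ Suc n)"
    proof -
      have "norm (1 + of_nat n :: complex) = 1 + real n"
        by (metis of_nat_Suc norm_of_nat add.commute)
      thus ?thesis by (simp add: norm_mult norm_divide norm_power pochhammer_Suc)
    qed
    finally show "norm (1 / (4 ^ Suc n * fact (Suc n) * pochhammer c (Suc n)) * y ^ Suc n)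
        \<le> 1 / 2 * norm (1 / (4 ^ n * fact n * pochhammer c n) * y ^ n)" .
  qed simp
qed

lemma bessel_series_sums:
  assumes "Re c > 0"
  shows "(\<lambda>n. 1 / (4 ^ n * fact n * pochhammer c n) * y ^ n) sums bessel_series c y"
  unfolding bessel_series_def by (rule summable_sums[OF summable_bessel_series[OF assms]])

lemma bessel_series_deriv:
  assumes c: "Re c > 0"
  shows "(bessel_series c has_field_derivative bessel_series (c + 1) y / (4 * c)) (at y)"
proof -
  let ?a = "\<lambda>n. 1 / (4 ^ n * fact n * pochhammer c n)"
  have c0: "c \<noteq> 0" using c by auto
  have "(bessel_series c has_field_derivative (\<Sum>n. diffs ?a n * y ^ n)) (at y)"
    unfolding bessel_series_def[abs_def]
    by (rule termdiffs_strong_converges_everywhere) (rule summable_bessel_series[OF c])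
  also have "(\<lambda>n. diffs ?a n * y ^ n) sums (1 / (4 * c) * bessel_series (c + 1) y)"
  proof -
    have "diffs ?a n * y ^ n = 1 / (4 * c) * (1 / (4 ^ n * fact n * pochhammer (c + 1) n) * y ^ n)" for n
    proof -
      have "(of_nat (Suc n) :: complex) \<noteq> 0" by (simp del: of_nat_Suc)
      thus ?thesis using c0 pochhammer_nonzero[of "c + 1" n] c
        by (simp add: diffs_def pochhammer_rec fact_Suc divide_simps del: of_nat_Suc)
    qed
    moreover have "Re (c + 1) > 0" using c by simp
    ultimately show ?thesis
      using sums_mult[OF bessel_series_sums[of "c + 1" y], of "1 / (4 * c)"] by (simp only:)
  qed
  hence "(\<Sum>n. diffs ?a n * y ^ n) = bessel_series (c + 1) y / (4 * c)"
    by (simp add: sums_iff)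
  finally show ?thesis .
qed

text \<open>The coefficients obey 1 / (c)_(n+1) - 1 / (c+1)_(n+1) = (n+1) / (c (c+1) (c+2)_n), and
  the factor n+1 is absorbed by the factorial. The relation lets the derivatives of two neighbouring
  series close up into a first-order system, without the second-order Bessel equation.\<close>

lemma bessel_series_contiguous:
  assumes c: "Re c > 0"
  shows "y * bessel_series (c + 2) y / (4 * (c + 1)) = c * (bessel_series c y - bessel_series (c + 1) y)"
proof -
  let ?a = "\<lambda>c n. 1 / (4 ^ n * fact n * pochhammer c n) :: complex"
  have c0: "c \<noteq> 0" "c + 1 \<noteq> 0" using c by (auto simp: complex_eq_iff)
  have "(\<lambda>n. ?a c n * y ^ n - ?a (c + 1) n * y ^ n) sums (bessel_series c y - bessel_series (c + 1) y)"
    by (intro sums_diff bessel_series_sums) (use c in auto)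
  \<comment> \<open>Both series start with 1, so their difference starts at index 1; the shift is
    the origin of the factor y.\<close>
  hence "(\<lambda>n. ?a c (Suc n) * y ^ Suc n - ?a (c + 1) (Suc n) * y ^ Suc n) sums (bessel_series c y - bessel_series (c + 1) y)"
    by (subst sums_Suc_iff) simp
  hence "(\<lambda>n. c * (?a c (Suc n) * y ^ Suc n - ?a (c + 1) (Suc n) * y ^ Suc n)) sums (c * (bessel_series c y - bessel_series (c + 1) y))"
    by (rule sums_mult)
  moreover have "c * (?a c (Suc n) * y ^ Suc n - ?a (c + 1) (Suc n) * y ^ Suc n)
      = y / (4 * (c + 1)) * (?a (c + 2) n * y ^ n)" for n
  proof -
    have p: "pochhammer c (Suc n) = c * pochhammer (c + 1) n"
      "pochhammer (c + 1) (Suc n) = (c + 1) * pochhammer (c + 2) n"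
      "(c + 1) * pochhammer (c + 2) n = pochhammer (c + 1) n * (c + 1 + of_nat n)"
      using pochhammer_rec[of "c + 1" n] pochhammer_Suc[of "c + 1" n] by (simp_all add: pochhammer_rec add.assoc)
    have nz: "pochhammer (c + 1) n \<noteq> 0" "pochhammer (c + 2) n \<noteq> 0" "c + 1 + of_nat n \<noteq> 0"
      "(1 + of_nat n :: complex) \<noteq> 0"
      using pochhammer_nonzero c norm_add_of_nat_ge[of "c + 1" n]
      by (auto simp: complex_eq_iff)
    have "1 / pochhammer c (Suc n) - 1 / pochhammer (c + 1) (Suc n) =
        (c + 1 + of_nat n - c) / (c * (pochhammer (c + 1) n * (c + 1 + of_nat n)))"
      unfolding p using nz c0 by (simp add: divide_simps)
    also have "\<dots> = (1 + of_nat n) / (c * ((c + 1) * pochhammer (c + 2) n))"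
      unfolding p(3)[symmetric] by simp
    finally have key: "1 / pochhammer c (Suc n) - 1 / pochhammer (c + 1) (Suc n) =
        (1 + of_nat n) / (c * ((c + 1) * pochhammer (c + 2) n))" .
    have "c * (?a c (Suc n) * y ^ Suc n - ?a (c + 1) (Suc n) * y ^ Suc n)
      = c * y ^ Suc n / (4 ^ Suc n * fact (Suc n)) * (1 / pochhammer c (Suc n) - 1 / pochhammer (c + 1) (Suc n))"
    proof -
      have "c * (1 / (F * G * A) * Y - 1 / (F * G * B) * Y) = c * Y / (F * G) * (1 / A - 1 / B)"
        for A B F G Y :: complex by (simp add: algebra_simps diff_divide_distrib)
      thus ?thesis .
    qed
    also have "\<dots> = y / (4 * (c + 1)) * (?a (c + 2) n * y ^ n)"
      unfolding key using nz c0 by simp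
    finally show ?thesis .
  qed
  ultimately have "(\<lambda>n. y / (4 * (c + 1)) * (?a (c + 2) n * y ^ n)) sums (c * (bessel_series c y - bessel_series (c + 1) y))"
    by (simp only:)
  moreover have "(\<lambda>n. y / (4 * (c + 1)) * (?a (c + 2) n * y ^ n)) sums (y / (4 * (c + 1)) * bessel_series (c + 2) y)"
    by (intro sums_mult bessel_series_sums) (use c in auto)
  ultimately show ?thesis using sums_unique2 by force
qed

text \<open>With z = exp w this is Gamma (\<alpha> + 1/2) 2^(\<alpha> - 1/2) sqrt z I_(\<alpha> -
  1/2)(z), and \<open>bessel_r\<close> is the same multiple of sqrt z I_(\<alpha> + 1/2)(z). Because
  of the common factor the pair closes under d/dz: p' = (\<alpha>/z) p + r and r' = p - (\<alpha>/z)
  r. Hence P = p + r and Q = r - p solve the Dirac system.\<close>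

definition bessel_p :: "complex \<Rightarrow> complex \<Rightarrow> complex" where
  "bessel_p \<alpha> w = exp (\<alpha> * w) * bessel_series (\<alpha> + 1 / 2) (exp (2 * w))"

definition bessel_r :: "complex \<Rightarrow> complex \<Rightarrow> complex" where
  "bessel_r \<alpha> w = exp ((1 + \<alpha>) * w) * bessel_series (\<alpha> + 3 / 2) (exp (2 * w)) / (1 + 2 * \<alpha>)"

lemma bessel_p_deriv:
  assumes "\<bar>Re \<alpha>\<bar> < 1 / 2"
  shows "(bessel_p \<alpha> has_field_derivative \<alpha> * bessel_p \<alpha> w + exp w * bessel_r \<alpha> w) (at w)"
proof -
  have nz: "1 + 2 * \<alpha> \<noteq> 0" using assms by (auto simp: complex_eq_iff)
  have d2: "((\<lambda>w. bessel_series (\<alpha> + 1 / 2) (exp (2 * w))) has_field_derivative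
      bessel_series (\<alpha> + 1 / 2 + 1) (exp (2 * w)) / (4 * (\<alpha> + 1 / 2)) * (exp (2 * w) * 2)) (at w)"
    by (rule DERIV_chain2[OF bessel_series_deriv]) (use assms in \<open>auto intro!: derivative_eq_intros\<close>)
  have d1: "((\<lambda>w. exp (\<alpha> * w)) has_field_derivative exp (\<alpha> * w) * \<alpha>) (at w)"
    by (auto intro!: derivative_eq_intros)
  have e: "exp w * exp ((1 + \<alpha>) * w) = exp (\<alpha> * w) * exp (2 * w)"
    by (simp add: algebra_simps flip: exp_add)
  have "exp w * bessel_r \<alpha> w = (exp w * exp ((1 + \<alpha>) * w)) * bessel_series (\<alpha> + 3 / 2) (exp (2 * w)) / (1 + 2 * \<alpha>)"
    by (simp add: bessel_r_def)
  also have "\<dots> = exp (\<alpha> * w) * (bessel_series (\<alpha> + 1 / 2 + 1) (exp (2 * w)) / (4 * (\<alpha> + 1 / 2)) * (exp (2 * w) * 2))"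
  proof -
    have "4 * (\<alpha> + 1 / 2) = 2 * (1 + 2 * \<alpha>)" by (simp add: algebra_simps)
    hence "b / (4 * (\<alpha> + 1 / 2)) * (y * 2) = b * y / (1 + 2 * \<alpha>)" for b y :: complex
      using nz by (simp del: distrib_left_numeral)
    thus ?thesis unfolding e by (simp add: add.assoc)
  qed
  finally show ?thesis
    unfolding bessel_p_def[abs_def] by (intro DERIV_cong[OF DERIV_mult[OF d1 d2]]) simp
qed

text \<open>Differentiation raises the parameter of the series to \<alpha> + 5/2;
  \<open>bessel_series_contiguous\<close> brings it back to \<alpha> + 1/2 and \<alpha> + 3/2, the
  two already present.\<close>

lemma bessel_r_deriv:
  assumes "\<bar>Re \<alpha>\<bar> < 1 / 2"
  shows "(bessel_r \<alpha> has_field_derivative exp w * bessel_p \<alpha> w - \<alpha> * bessel_r \<alpha> w) (at w)"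
proof -
  have nz: "1 + 2 * \<alpha> \<noteq> 0" using assms by (auto simp: complex_eq_iff)
  have nz3: "\<alpha> + 3 / 2 \<noteq> 0" using assms by (auto simp: complex_eq_iff)
  let ?y = "exp (2 * w)"
  have d2: "((\<lambda>w. bessel_series (\<alpha> + 3 / 2) (exp (2 * w))) has_field_derivative
      bessel_series (\<alpha> + 3 / 2 + 1) ?y / (4 * (\<alpha> + 3 / 2)) * (exp (2 * w) * 2)) (at w)"
    by (rule DERIV_chain2[OF bessel_series_deriv]) (use assms in \<open>auto intro!: derivative_eq_intros\<close>)
  have d1: "((\<lambda>w. exp ((1 + \<alpha>) * w)) has_field_derivative exp ((1 + \<alpha>) * w) * (1 + \<alpha>)) (at w)"
    by (auto intro!: derivative_eq_intros)
  have step: "?y * bessel_series (\<alpha> + 1 / 2 + 2) ?y / (4 * (\<alpha> + 1 / 2 + 1)) =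
      (\<alpha> + 1 / 2) * (bessel_series (\<alpha> + 1 / 2) ?y - bessel_series (\<alpha> + 1 / 2 + 1) ?y)"
    by (rule bessel_series_contiguous) (use assms in auto)
  have cont: "bessel_series (\<alpha> + 3 / 2 + 1) ?y / (4 * (\<alpha> + 3 / 2)) * (?y * 2) =
      (1 + 2 * \<alpha>) * (bessel_series (\<alpha> + 1 / 2) ?y - bessel_series (\<alpha> + 3 / 2) ?y)"
  proof -
    have e: "\<alpha> + 1 / 2 + 2 = \<alpha> + 3 / 2 + 1" "\<alpha> + 1 / 2 + 1 = \<alpha> + 3 / 2" by simp_all
    have gen: "b / d * (y * 2) = (1 + 2 * \<alpha>) * x" if "y * b / d = (\<alpha> + 1 / 2) * x" for b d x y :: complex
    proof -
      have "b / d * (y * 2) = 2 * (y * b / d)" by simp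
      thus ?thesis unfolding that by (simp add: algebra_simps)
    qed
    show ?thesis by (rule gen[OF step[unfolded e]])
  qed
  have e: "exp w * exp (\<alpha> * w) = exp ((1 + \<alpha>) * w)"
    by (simp add: algebra_simps flip: exp_add)
  have "exp w * bessel_p \<alpha> w = exp ((1 + \<alpha>) * w) * bessel_series (\<alpha> + 1 / 2) ?y"
    unfolding e[symmetric] bessel_p_def by simp
  hence eq: "(exp ((1 + \<alpha>) * w) * (1 + \<alpha>) * bessel_series (\<alpha> + 3 / 2) ?y +
      (bessel_series (\<alpha> + 3 / 2 + 1) ?y / (4 * (\<alpha> + 3 / 2)) * (?y * 2)) * exp ((1 + \<alpha>) * w)) / (1 + 2 * \<alpha>)
      = exp w * bessel_p \<alpha> w - \<alpha> * bessel_r \<alpha> w"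
    unfolding cont using nz by (simp add: bessel_r_def field_simps)
  show ?thesis
    unfolding bessel_r_def[abs_def] by (rule DERIV_cong[OF DERIV_cdivide[OF DERIV_mult[OF d1 d2]] eq[unfolded bessel_r_def]])
qed

lemma v1_eq_bessel_p:
  assumes "\<bar>Re \<alpha>\<bar> < 1 / 2"
  shows "v1 \<alpha> w = bessel_p \<alpha> w"
proof -
  have c: "Re (\<alpha> + 1 / 2) > 0" using assms by auto
  hence "\<alpha> + 1 / 2 \<notin> \<int>\<^sub>\<le>\<^sub>0" by (rule not_nonpos_Int)
  hence G: "Gamma (\<alpha> + 1 / 2) \<noteq> 0" "\<And>n. pochhammer (\<alpha> + 1 / 2) n = Gamma (\<alpha> + 1 / 2 + of_nat n) / Gamma (\<alpha> + 1 / 2)"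
    by (auto simp: Gamma_eq_zero_iff pochhammer_Gamma)
  have "Gamma (\<alpha> + 1 / 2) * exp ((\<alpha> + 2 * of_nat n) * w) / (4 ^ n * fact n * Gamma (\<alpha> + 1 / 2 + of_nat n))
      = exp (\<alpha> * w) * (1 / (4 ^ n * fact n * pochhammer (\<alpha> + 1 / 2) n) * exp (2 * w) ^ n)" for n
  proof -
    have "exp (2 * w) ^ n = exp (of_nat n * (2 * w))" by (rule exp_of_nat_mult[symmetric])
    hence "exp (A * w) * exp (2 * w) ^ n = exp ((A + 2 * of_nat n) * w)" for A
      by (simp add: algebra_simps flip: exp_add)
    from this[symmetric] show ?thesis unfolding G(2) by (simp add: mult.assoc)
  qed
  thus ?thesis
    unfolding v1_def bessel_p_def bessel_series_def
    by (simp only: suminf_mult[OF summable_bessel_series[OF c]])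
qed

text \<open>The exponent 1 - \<alpha> is 1 + \<alpha> with \<alpha> replaced by its negative, so the
  second solution is the companion function at -\<alpha>. The hypothesis on Re \<alpha> is symmetric
  and serves both.\<close>

lemma v2_eq_bessel_r:
  assumes "\<bar>Re \<alpha>\<bar> < 1 / 2"
  shows "v2 \<alpha> w = (1 - 2 * \<alpha>) * bessel_r (- \<alpha>) w"
proof -
  have c: "Re (3 / 2 - \<alpha>) > 0" using assms by auto
  have nz: "1 - 2 * \<alpha> \<noteq> 0" using assms by (auto simp: complex_eq_iff)
  have "3 / 2 - \<alpha> \<notin> \<int>\<^sub>\<le>\<^sub>0" using c by (rule not_nonpos_Int)
  hence G: "Gamma (3 / 2 - \<alpha>) \<noteq> 0" "\<And>n. pochhammer (3 / 2 - \<alpha>) n = Gamma (3 / 2 - \<alpha> + of_nat n) / Gamma (3 / 2 - \<alpha>)"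
    by (auto simp: Gamma_eq_zero_iff pochhammer_Gamma)
  have "Gamma (3 / 2 - \<alpha>) * exp ((1 - \<alpha> + 2 * of_nat n) * w) / (4 ^ n * fact n * Gamma (3 / 2 - \<alpha> + of_nat n))
      = exp ((1 - \<alpha>) * w) * (1 / (4 ^ n * fact n * pochhammer (3 / 2 - \<alpha>) n) * exp (2 * w) ^ n)" for n
  proof -
    have "exp (2 * w) ^ n = exp (of_nat n * (2 * w))" by (rule exp_of_nat_mult[symmetric])
    hence "exp (A * w) * exp (2 * w) ^ n = exp ((A + 2 * of_nat n) * w)" for A
      by (simp add: algebra_simps flip: exp_add)
    from this[symmetric] show ?thesis unfolding G(2) by (simp add: mult.assoc)
  qed
  hence "v2 \<alpha> w = exp ((1 - \<alpha>) * w) * bessel_series (3 / 2 - \<alpha>) (exp (2 * w))"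
    unfolding v2_def bessel_series_def
    by (simp only: suminf_mult[OF summable_bessel_series[OF c]])
  thus ?thesis using nz by (simp add: bessel_r_def)
qed

section \<open>The leading coefficient at infinity\<close>

text \<open>Euler's integral, rescaled by x -> l x. All powers are exponentials of real logarithms,
  so no branch has to be chosen, and \<open>has_bochner_integral\<close> delivers integrability
  together with the value, as termwise integration requires.\<close>

lemma Gamma_kernel:
  fixes z :: complex
  assumes z: "Re z > 0" and l: "l > 0"
  shows "has_bochner_integral lborel
    (\<lambda>x. indicator {0<..} x *\<^sub>R exp ((z - 1) * of_real (ln x) - of_real (l * x)))
    (Gamma z * exp (- z * of_real (ln l)))"
proof -
  define f where "f = (\<lambda>x::real. indicator {0<..} x *\<^sub>R exp ((z - 1) * of_real (ln x) - of_real x))"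
  have f: "f = (\<lambda>x. indicator {0<..} x *\<^sub>R (of_real x powr (z - 1) / of_real (exp x)))"
    by (rule ext) (auto simp: f_def indicator_def powr_def exp_diff Ln_of_real simp flip: exp_of_real)
  have meas: "f \<in> borel_measurable lborel" unfolding f_def by measurable
  have "integrable lebesgue f"
    using absolutely_integrable_Gamma_integral'[OF z] unfolding set_integrable_def f .
  hence int: "integrable lborel f" using integrable_completion[OF meas] by simp
  have "(f has_integral Gamma z) UNIV"
  proof -
    have "f = (\<lambda>x. if x \<in> {0<..} then of_real x powr (z - 1) / of_real (exp x) else 0)"
      unfolding f by (auto simp: indicator_def)
    thus ?thesis using Gamma_integral_complex'[OF z] by (simp only: has_integral_restrict_UNIV)
  qed
  hence "integral\<^sup>L lborel f = Gamma z"
    using has_integral_integral_lborel[OF int] has_integral_unique by blast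
  hence "has_bochner_integral lborel f (Gamma z)"
    using int by (simp add: has_bochner_integral_iff)
  hence "has_bochner_integral lborel (\<lambda>x. f (0 + l * x)) (Gamma z /\<^sub>R \<bar>l\<bar>)"
    using lborel_has_bochner_integral_real_affine_iff[of l f "Gamma z" 0] l by simp
  hence "has_bochner_integral lborel (\<lambda>x. exp (- (z - 1) * of_real (ln l)) * f (0 + l * x))
      (exp (- (z - 1) * of_real (ln l)) * (Gamma z /\<^sub>R \<bar>l\<bar>))"
    by (rule has_bochner_integral_mult_right[rotated])
  also have "(\<lambda>x. exp (- (z - 1) * of_real (ln l)) * f (0 + l * x)) =
      (\<lambda>x. indicator {0<..} x *\<^sub>R exp ((z - 1) * of_real (ln x) - of_real (l * x)))"
  proof
    fix x :: real
    show "exp (- (z - 1) * of_real (ln l)) * f (0 + l * x) = indicator {0<..} x *\<^sub>R exp ((z - 1) * of_real (ln x) - of_real (l * x))"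
    proof (cases "x > 0")
      case True
      thus ?thesis using l by (simp add: f_def ln_mult algebra_simps flip: exp_add)
    next
      case False
      hence "\<not> l * x > 0" using l by (simp add: zero_less_mult_iff)
      thus ?thesis using False by (simp add: f_def)
    qed
  qed
  also have "exp (- (z - 1) * of_real (ln l)) * (Gamma z /\<^sub>R \<bar>l\<bar>) = Gamma z * exp (- z * of_real (ln l))"
  proof -
    have "exp (- (z - 1) * of_real (ln l)) = exp (- z * of_real (ln l)) * of_real l"
    proof -
      have "- (z - 1) * of_real (ln l) = - z * of_real (ln l) + complex_of_real (ln l)"
        by (simp add: algebra_simps)
      also have "exp \<dots> = exp (- z * of_real (ln l)) * exp (complex_of_real (ln l))" by (rule exp_add)
      finally show ?thesis using l by (simp add: exp_of_real)
    qed
    thus ?thesis using l by (simp add: scaleR_conv_of_real)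
  qed
  finally show ?thesis .
qed

text \<open>The case of a real exponent, by taking real parts. It supplies the integrals of the
  absolute values, hence the majorants for both exchanges of a limit with an integral.\<close>

lemma Gamma_kernel_real:
  fixes s l :: real
  assumes "s > 0" and l: "l > 0"
  shows "has_bochner_integral lborel
    (\<lambda>x. indicator {0<..} x * exp ((s - 1) * ln x - l * x)) (Gamma s * exp (- s * ln l))"
proof -
  have "has_bochner_integral lborel
    (\<lambda>x. Re (indicator {0<..} x *\<^sub>R exp ((of_real s - 1) * of_real (ln x) - of_real (l * x))))
    (Re (Gamma (of_real s) * exp (- of_real s * of_real (ln l))))"
    by (intro has_bochner_integral_bounded_linear[OF bounded_linear_Re] Gamma_kernel) (use assms in auto)
  also have "Gamma (of_real s) * exp (- of_real s * of_real (ln l)) = complex_of_real (Gamma s * exp (- s * ln l))"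
    by (simp add: Gamma_complex_of_real flip: exp_of_real)
  also have "(\<lambda>x. Re (indicator {0<..} x *\<^sub>R exp ((of_real s - 1) * of_real (ln x) - of_real (l * x)))) =
      (\<lambda>x. indicator {0<..} x * exp ((s - 1) * ln x - l * x))"
  proof
    fix x
    have "exp ((of_real s - 1) * of_real (ln x) - of_real (l * x)) = complex_of_real (exp ((s - 1) * ln x - l * x))"
      by (simp flip: exp_of_real)
    thus "Re (indicator {0<..} x *\<^sub>R exp ((of_real s - 1) * of_real (ln x) - of_real (l * x))) = indicator {0<..} x * exp ((s - 1) * ln x - l * x)"
      by (simp only: scaleR_complex.sel Re_complex_of_real)
  qed
  finally show ?thesis by (simp only: Re_complex_of_real)
qed

text \<open>Duplication makes the Laplace transform of the Bessel series a binomial series.\<close>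

lemma bessel_r_Laplace:
  assumes a: "\<bar>Re \<alpha>\<bar> < 1 / 2" and l: "l > 1"
  shows "has_bochner_integral lborel
    (\<lambda>x. indicator {0<..} x *\<^sub>R (exp (\<alpha> * of_real (ln x) - of_real (l * x)) * bessel_r \<alpha> (of_real (ln x))))
    (Gamma (\<alpha> + 1 / 2) * Gamma (1 + \<alpha>) * exp (2 * \<alpha> * of_real (ln 2)) / of_real (sqrt pi) *
      exp (- (1 + \<alpha>) * of_real (ln (l\<^sup>2 - 1))))"
proof -
  define c where "c = (\<lambda>n. 1 / (1 + 2 * \<alpha>) * (1 / (4 ^ n * fact n * pochhammer (\<alpha> + 3 / 2) n)))"
  \<comment> \<open>The weight x^\<alpha> times the n-th term of the series, a multiple of x^(1 +
    \<alpha> + 2 n), is a multiple of x^(z n - 1). The step 2 in the exponent is what opens Gamma (z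
    n) to the duplication formula.\<close>
  define z where "z = (\<lambda>n::nat. 2 + 2 * \<alpha> + 2 * of_nat n)"
  define f where "f = (\<lambda>n x. c n * (indicator {0<..} x *\<^sub>R exp ((z n - 1) * of_real (ln x) - of_real (l * x))))"
  define s where "s = 2 + 2 * Re \<alpha>"
  have s: "s > 1" "s < 3" using a by (auto simp: s_def)
  have nz: "1 + 2 * \<alpha> \<noteq> 0" using a by (auto simp: complex_eq_iff)
  have z: "Re (z n) > 0" "Re (z n) = s + 2 * real n" for n using a by (auto simp: z_def s_def)
  have hf: "has_bochner_integral lborel (f n) (c n * (Gamma (z n) * exp (- z n * of_real (ln l))))" for n
    unfolding f_def by (intro has_bochner_integral_mult_right Gamma_kernel z) (use l in auto)
  have norm_f: "norm (f n x) = norm (c n) * (indicator {0<..} x * exp ((Re (z n) - 1) * ln x - l * x))" for n x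
    by (simp add: f_def norm_mult indicator_def)
  have int_norm: "integral\<^sup>L lborel (\<lambda>x. norm (f n x)) = norm (c n) * (Gamma (s + 2 * real n) * exp (- (s + 2 * real n) * ln l))" for n
    unfolding norm_f using has_bochner_integral_integral_eq[OF has_bochner_integral_mult_right[OF Gamma_kernel_real[of "Re (z n)" l]]] z l
    by auto
  have sum_norm: "summable (\<lambda>n. integral\<^sup>L lborel (\<lambda>x. norm (f n x)))"
  \<comment> \<open>The ratio of consecutive integrals tends to 1 / l^2. Asking only for 1 / l
    leaves a factor l to spare, and from the given threshold on n + 3/2 \<le> l (n + 1)
    holds.\<close>
  proof (rule summable_ratio_test[of "1 / l" "nat \<lceil>1 / (2 * (l - 1))\<rceil>"])
    show "1 / l < 1" using l by simp
    fix n assume "nat \<lceil>1 / (2 * (l - 1))\<rceil> \<le> n"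
    hence "1 / (2 * (l - 1)) \<le> real n" by linarith
    hence "1 \<le> 2 * (l - 1) * real n" using l by (simp add: field_simps)
    also have "\<dots> \<le> 2 * (l - 1) * (real n + 1)" using l by (intro mult_left_mono) auto
    finally have n: "real n + 3 / 2 \<le> l * (real n + 1)" by (simp add: algebra_simps)
    define w where "w = \<alpha> + 3 / 2 + of_nat n"
    define g where "g = Gamma (s + 2 * real n)"
    define e where "e = exp (- (s + 2 * real n) * ln l)"
    have w: "norm w \<ge> (s + 2 * real n + 1) / 2"
      using complex_Re_le_cmod[of w] by (simp add: w_def s_def)
    hence w0: "norm w > 0" using s by (smt (verit) divide_pos_pos of_nat_0_le_iff)
    have G: "Gamma (s + 2 * real (Suc n)) = (s + 2 * real n + 1) * ((s + 2 * real n) * g)"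
    proof -
      have "Gamma ((s + 2 * real n + 1) + 1) = (s + 2 * real n + 1) * Gamma (s + 2 * real n + 1)"
        by (rule Gamma_plus1) (use s in \<open>auto elim!: nonpos_Ints_cases\<close>)
      also have "Gamma (s + 2 * real n + 1) = (s + 2 * real n) * g"
        unfolding g_def by (rule Gamma_plus1) (use s in \<open>auto elim!: nonpos_Ints_cases\<close>)
      finally show ?thesis by (simp add: add_ac)
    qed
    have ee: "exp (- (s + 2 * real (Suc n)) * ln l) = e / l\<^sup>2"
    proof -
      have "exp (- (s + 2 * real (Suc n)) * ln l) = e * exp (- (2 * ln l))"
        unfolding e_def by (simp add: algebra_simps flip: exp_add)
      also have "exp (- (2 * ln l)) = 1 / l\<^sup>2"
        using l by (simp add: exp_minus exp_double divide_inverse)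
      finally show ?thesis by simp
    qed
    have cc: "norm (c (Suc n)) = norm (c n) / (4 * (real n + 1) * norm w)"
    proof -
      have "norm (1 + of_nat n :: complex) = real n + 1"
        by (metis of_nat_Suc norm_of_nat add.commute)
      thus ?thesis by (simp add: c_def w_def norm_mult norm_divide pochhammer_Suc)
    qed
    have g0: "g > 0" unfolding g_def by (rule Gamma_real_pos) (use s in auto)
    have "norm (c (Suc n)) * (Gamma (s + 2 * real (Suc n)) * exp (- (s + 2 * real (Suc n)) * ln l))
       = (norm (c n) * (g * e)) * ((s + 2 * real n + 1) / (4 * norm w) * ((s + 2 * real n) / (real n + 1) / l\<^sup>2))"
      unfolding G ee cc by (simp add: mult_ac)
    also have "\<dots> \<le> (norm (c n) * (g * e)) * (1 / 2 * (2 * l / l\<^sup>2))"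
    proof (intro mult_left_mono mult_mono divide_right_mono)
      show "(s + 2 * real n + 1) / (4 * norm w) \<le> 1 / 2" using w w0 by (simp add: field_simps)
      show "(s + 2 * real n) / (real n + 1) \<le> 2 * l" using n s by (simp add: field_simps)
    qed (use s g0 in \<open>auto simp: e_def\<close>)
    also have "\<dots> = 1 / l * (norm (c n) * (g * e))" using l by (simp add: power2_eq_square)
    finally show "norm (integral\<^sup>L lborel (\<lambda>x. norm (f (Suc n) x))) \<le> 1 / l * norm (integral\<^sup>L lborel (\<lambda>x. norm (f n x)))"
      unfolding int_norm using g0 s Gamma_real_pos[of "s + 2 * real (Suc n)"] by (simp add: g_def e_def abs_mult)
  qed
  have sums_f: "(\<lambda>n. f n x) sums (indicator {0<..} x *\<^sub>R (exp (\<alpha> * of_real (ln x) - of_real (l * x)) * bessel_r \<alpha> (of_real (ln x))))" for x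
  proof (cases "x > 0")
    case True
    have "(\<lambda>n. (exp (\<alpha> * of_real (ln x) - of_real (l * x)) * exp ((1 + \<alpha>) * of_real (ln x)) / (1 + 2 * \<alpha>)) *
        (1 / (4 ^ n * fact n * pochhammer (\<alpha> + 3 / 2) n) * exp (2 * of_real (ln x)) ^ n)) sums
        ((exp (\<alpha> * of_real (ln x) - of_real (l * x)) * exp ((1 + \<alpha>) * of_real (ln x)) / (1 + 2 * \<alpha>)) *
          bessel_series (\<alpha> + 3 / 2) (exp (2 * of_real (ln x))))"
      by (intro sums_mult bessel_series_sums) (use a in auto)
    moreover have "(exp (\<alpha> * of_real (ln x) - of_real (l * x)) * exp ((1 + \<alpha>) * of_real (ln x)) / (1 + 2 * \<alpha>)) *
        (1 / (4 ^ n * fact n * pochhammer (\<alpha> + 3 / 2) n) * exp (2 * of_real (ln x)) ^ n) = f n x" for n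
    proof -
      have "exp (2 * complex_of_real (ln x)) ^ n = exp (of_nat n * (2 * of_real (ln x)))"
        by (rule exp_of_nat_mult[symmetric])
      moreover have "exp (\<alpha> * of_real (ln x) - of_real (l * x)) * exp ((1 + \<alpha>) * of_real (ln x)) * exp (of_nat n * (2 * of_real (ln x)))
        = exp ((z n - 1) * of_real (ln x) - of_real (l * x))"
        by (simp add: z_def algebra_simps flip: exp_add)
      ultimately show ?thesis using True by (simp add: f_def c_def mult_ac)
    qed
    ultimately show ?thesis using True by (simp add: bessel_r_def mult_ac)
  qed (simp add: f_def)
  have summ: "summable (\<lambda>n. norm (f n x))" for x
  proof (cases "x > 0")
    case True
    define R where "R = complex_of_real (norm (exp (2 * complex_of_real (ln x))) + 1)"
    have "summable (\<lambda>n. norm (1 / (4 ^ n * fact n * pochhammer (\<alpha> + 3 / 2) n) * exp (2 * complex_of_real (ln x)) ^ n))"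
      by (rule powser_insidea[of _ R], rule summable_bessel_series) (use a in \<open>auto simp: R_def\<close>)
    hence "summable (\<lambda>n. norm (exp (\<alpha> * of_real (ln x) - of_real (l * x)) * exp ((1 + \<alpha>) * of_real (ln x)) / (1 + 2 * \<alpha>)) *
       norm (1 / (4 ^ n * fact n * pochhammer (\<alpha> + 3 / 2) n) * exp (2 * complex_of_real (ln x)) ^ n))"
      by (rule summable_mult)
    moreover have "norm (exp (\<alpha> * of_real (ln x) - of_real (l * x)) * exp ((1 + \<alpha>) * of_real (ln x)) / (1 + 2 * \<alpha>)) *
       norm (1 / (4 ^ n * fact n * pochhammer (\<alpha> + 3 / 2) n) * exp (2 * complex_of_real (ln x)) ^ n) = norm (f n x)" for n
    proof -
      have "exp (2 * complex_of_real (ln x)) ^ n = exp (of_nat n * (2 * of_real (ln x)))"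
        by (rule exp_of_nat_mult[symmetric])
      moreover have "exp (\<alpha> * of_real (ln x) - of_real (l * x)) * exp ((1 + \<alpha>) * of_real (ln x)) * exp (of_nat n * (2 * of_real (ln x)))
        = exp ((z n - 1) * of_real (ln x) - of_real (l * x))"
        by (simp add: z_def algebra_simps flip: exp_add)
      ultimately show ?thesis using True unfolding norm_mult[symmetric] by (simp add: f_def c_def mult_ac)
    qed
    ultimately show ?thesis by (simp only:)
  qed (simp add: f_def)
  define G where "G = (\<lambda>x. indicator {0<..} x *\<^sub>R (exp (\<alpha> * of_real (ln x) - of_real (l * x)) * bessel_r \<alpha> (of_real (ln x))))"
  have sumG: "(\<Sum>n. f n x) = G x" for x using sums_f[of x] by (simp add: sums_iff G_def)
  have intf: "integrable lborel (f n)" for n using hf by (simp add: has_bochner_integral_iff)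
  have "integrable lborel (\<lambda>x. \<Sum>n. f n x)"
    by (rule integrable_suminf[OF intf _ sum_norm]) (simp add: summ)
  hence intG: "integrable lborel G" unfolding sumG .
  have "(\<lambda>n. integral\<^sup>L lborel (f n)) sums integral\<^sup>L lborel (\<lambda>x. \<Sum>n. f n x)"
    by (rule sums_integral[OF intf _ sum_norm]) (simp add: summ)
  hence S1: "(\<lambda>n. c n * (Gamma (z n) * exp (- z n * of_real (ln l)))) sums integral\<^sup>L lborel G"
    unfolding sumG using has_bochner_integral_integral_eq[OF hf] by simp
  define K where "K = Gamma (\<alpha> + 1 / 2) * Gamma (1 + \<alpha>) * exp (2 * \<alpha> * of_real (ln 2)) / of_real (sqrt pi)"
  have l2: "l\<^sup>2 > 1" using l by (simp add: one_less_power)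
  hence inv_l2: "1 / l\<^sup>2 < 1" by (subst divide_less_eq_1_pos) auto
  have "c n * (Gamma (z n) * exp (- z n * of_real (ln l))) =
      K * exp (- (1 + \<alpha>) * of_real (2 * ln l)) * ((- (1 + \<alpha>) gchoose n) * (- of_real (1 / l\<^sup>2)) ^ n)" for n
  proof -
    \<comment> \<open>With z n = 2 y, duplication splits Gamma (z n) into Gamma y and Gamma (y +
      1/2). The second factor cancels the Pochhammer symbol of the Bessel coefficient; the first
      leaves (1 + \<alpha>)_n / n!, up to sign a binomial coefficient with upper entry -(1 +
      \<alpha>). The power of 4 in the series cancels as well.\<close>
    define y where "y = 1 + \<alpha> + of_nat n"
    have ry: "Re y > 0" "Re (y + 1 / 2) > 0" using a by (auto simp: y_def)
    have dup: "Gamma y * Gamma (y + 1 / 2) = exp ((1 - 2 * y) * of_real (ln 2)) * of_real (sqrt pi) * Gamma (2 * y)"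
      by (rule Gamma_legendre_duplication; rule not_nonpos_Int; rule ry)
    have zy: "z n = 2 * y" by (simp add: z_def y_def)
    have e1: "exp ((2 * y - 1) * of_real (ln 2)) * exp ((1 - 2 * y) * of_real (ln 2)) = 1"
      by (simp add: algebra_simps flip: exp_add)
    have "of_real (sqrt pi) * Gamma (z n) = (exp ((2 * y - 1) * of_real (ln 2)) * exp ((1 - 2 * y) * of_real (ln 2))) * of_real (sqrt pi) * Gamma (2 * y)"
      unfolding e1 zy by simp
    also have "\<dots> = exp ((2 * y - 1) * of_real (ln 2)) * (Gamma y * Gamma (y + 1 / 2))"
      unfolding dup by (simp only: mult.assoc)
    also have "exp ((2 * y - 1) * of_real (ln 2)) = 2 * exp (2 * \<alpha> * of_real (ln 2)) * 4 ^ n"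
    proof -
      have "(2 * y - 1) * of_real (ln 2) = of_real (ln 2) + 2 * \<alpha> * of_real (ln 2) + of_nat n * of_real (ln 4)"
      proof -
        have "ln (4 :: real) = 2 * ln 2" using ln_realpow[of 2 2] by simp
        thus ?thesis by (simp add: y_def algebra_simps)
      qed
      also have "exp (\<dots>) = exp (of_real (ln 2)) * exp (2 * \<alpha> * of_real (ln 2)) * exp (of_real (ln 4)) ^ n"
        by (simp only: exp_add exp_of_nat_mult)
      also have "exp (complex_of_real (ln 2)) = 2" by (simp add: exp_of_real)
      also have "exp (complex_of_real (ln 4)) = 4" by (simp add: exp_of_real)
      finally show ?thesis .
    qed
    also have "Gamma y = Gamma (1 + \<alpha>) * pochhammer (1 + \<alpha>) n"
    proof -
      have "1 + \<alpha> \<notin> \<int>\<^sub>\<le>\<^sub>0" by (rule not_nonpos_Int) (use a in auto)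
      thus ?thesis by (simp add: pochhammer_Gamma y_def Gamma_eq_zero_iff)
    qed
    also have "Gamma (y + 1 / 2) = (\<alpha> + 1 / 2) * Gamma (\<alpha> + 1 / 2) * pochhammer (\<alpha> + 3 / 2) n"
    proof -
      have n: "\<alpha> + 3 / 2 \<notin> \<int>\<^sub>\<le>\<^sub>0" "\<alpha> + 1 / 2 \<notin> \<int>\<^sub>\<le>\<^sub>0"
        by (rule not_nonpos_Int; use a in auto)+
      have "Gamma (\<alpha> + 3 / 2) * pochhammer (\<alpha> + 3 / 2) n = Gamma (\<alpha> + 3 / 2 + of_nat n)"
        unfolding pochhammer_Gamma[OF n(1)] using n by (simp add: Gamma_eq_zero_iff)
      moreover have "Gamma (\<alpha> + 1 / 2 + 1) = (\<alpha> + 1 / 2) * Gamma (\<alpha> + 1 / 2)"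
        by (rule Gamma_plus1[OF n(2)])
      moreover have "\<alpha> + 3 / 2 + of_nat n = y + 1 / 2" "\<alpha> + 1 / 2 + 1 = \<alpha> + 3 / 2"
        by (simp_all add: y_def)
      ultimately show ?thesis by (simp only:)
    qed
    finally have Gz: "of_real (sqrt pi) * Gamma (z n) = 2 * exp (2 * \<alpha> * of_real (ln 2)) * 4 ^ n *
       (Gamma (1 + \<alpha>) * pochhammer (1 + \<alpha>) n * ((\<alpha> + 1 / 2) * Gamma (\<alpha> + 1 / 2) * pochhammer (\<alpha> + 3 / 2) n))" .
    have ph: "pochhammer (\<alpha> + 3 / 2) n \<noteq> 0" by (rule pochhammer_nonzero) (use a in auto)
    have "of_real (sqrt pi) * (c n * Gamma (z n)) = c n * (of_real (sqrt pi) * Gamma (z n))" by (simp only: mult_ac)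
    also have "\<dots> = of_real (sqrt pi) * (K * (pochhammer (1 + \<alpha>) n / fact n))"
    proof -
      have "2 * (\<alpha> + 1 / 2) = 1 + 2 * \<alpha>" by (simp add: algebra_simps)
      hence "1 / (1 + 2 * \<alpha>) * (1 / (F * f * p)) * (2 * E * F * (G1 * q * ((\<alpha> + 1 / 2) * G2 * p))) = E * G1 * G2 * q / f"
        if "F \<noteq> 0" "p \<noteq> 0" for F f p E G1 G2 q :: complex
      proof -
        have "1 / (1 + 2 * \<alpha>) * (1 / (F * f * p)) * (2 * E * F * (G1 * q * ((\<alpha> + 1 / 2) * G2 * p)))
          = 1 / (1 + 2 * \<alpha>) * (1 / (F * f * p)) * ((2 * (\<alpha> + 1 / 2)) * (E * F * G1 * q * G2 * p))"
          by (simp only: mult_ac)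
        also have "\<dots> = E * G1 * G2 * q / f" unfolding \<open>2 * (\<alpha> + 1 / 2) = 1 + 2 * \<alpha>\<close> using that nz by simp
        finally show ?thesis .
      qed
      from this[of "4 ^ n" "pochhammer (\<alpha> + 3 / 2) n"] ph show ?thesis
        unfolding Gz unfolding c_def K_def by simp
    qed
    finally have "of_real (sqrt pi) * (c n * Gamma (z n)) = of_real (sqrt pi) * (K * (pochhammer (1 + \<alpha>) n / fact n))" .
    moreover have "complex_of_real (sqrt pi) \<noteq> 0" by simp
    ultimately have cG: "c n * Gamma (z n) = K * (pochhammer (1 + \<alpha>) n / fact n)"
      using mult_left_cancel by blast
    have ez: "exp (- z n * of_real (ln l)) = exp (- (1 + \<alpha>) * of_real (2 * ln l)) * of_real (1 / l\<^sup>2) ^ n"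
    proof -
      have "- z n * of_real (ln l) = - (1 + \<alpha>) * of_real (2 * ln l) + of_nat n * of_real (- (2 * ln l))"
        by (simp add: z_def algebra_simps)
      hence "exp (- z n * of_real (ln l)) = exp (- (1 + \<alpha>) * of_real (2 * ln l)) * exp (of_real (- (2 * ln l))) ^ n"
        by (simp only: exp_add exp_of_nat_mult)
      also have "exp (complex_of_real (- (2 * ln l))) = of_real (exp (- (2 * ln l)))" by (rule exp_of_real)
      also have "exp (- (2 * ln l)) = 1 / l\<^sup>2"
        using l by (simp add: exp_minus exp_double divide_inverse)
      finally show ?thesis .
    qed
    have gb: "(- (1 + \<alpha>) gchoose n) * (- of_real (1 / l\<^sup>2)) ^ n = pochhammer (1 + \<alpha>) n / fact n * of_real (1 / l\<^sup>2) ^ n"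
    proof -
      have "(- 1) ^ n * p / f * (- x) ^ n = p / f * x ^ n" for p f x :: complex
      proof -
        have "(- 1) ^ n * p / f * (- x) ^ n = p / f * ((- 1) * (- x)) ^ n"
          by (simp only: power_mult_distrib) simp
        thus ?thesis by simp
      qed
      thus ?thesis unfolding gbinomial_pochhammer minus_minus .
    qed
    show ?thesis unfolding gb ez mult.assoc[symmetric] cG by (simp only: mult_ac)
  qed
  moreover have "(\<lambda>n. K * exp (- (1 + \<alpha>) * of_real (2 * ln l)) * ((- (1 + \<alpha>) gchoose n) * (- of_real (1 / l\<^sup>2)) ^ n)) sums
      (K * exp (- (1 + \<alpha>) * of_real (2 * ln l)) * ((1 + (- of_real (1 / l\<^sup>2))) powr (- (1 + \<alpha>))))"
  proof (intro sums_mult gen_binomial_complex)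
    have "norm (- complex_of_real (1 / l\<^sup>2)) = 1 / l\<^sup>2" unfolding norm_minus_cancel norm_of_real by simp
    thus "norm (- complex_of_real (1 / l\<^sup>2)) < 1" using inv_l2 by simp
  qed
  ultimately have "integral\<^sup>L lborel G = K * exp (- (1 + \<alpha>) * of_real (2 * ln l)) * ((1 + (- of_real (1 / l\<^sup>2))) powr (- (1 + \<alpha>)))"
    using S1 sums_unique2 by (simp only:) blast
  also have "(1 + (- of_real (1 / l\<^sup>2))) powr (- (1 + \<alpha>)) = exp (- (1 + \<alpha>) * of_real (ln (1 - 1 / l\<^sup>2)))"
  proof -
    have "1 + (- complex_of_real (1 / l\<^sup>2)) = of_real (1 - 1 / l\<^sup>2)" by simp
    moreover have "1 - 1 / l\<^sup>2 > 0" using inv_l2 by simp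
    moreover have "complex_of_real a powr b = exp (b * of_real (ln a))" if "a > 0" for a b
      using that by (simp add: powr_def Ln_of_real)
    ultimately show ?thesis by (simp only:)
  qed
  also have "K * exp (- (1 + \<alpha>) * of_real (2 * ln l)) * \<dots> = K * exp (- (1 + \<alpha>) * of_real (ln (l\<^sup>2 - 1)))"
  proof -
    \<comment> \<open>The factor l^(-2 (1 + \<alpha>)) pulled out of the terms recombines with the
      binomial sum to a power of l^2 - 1.\<close>
    have "l\<^sup>2 - 1 = l\<^sup>2 * (1 - 1 / l\<^sup>2)" using l by (simp add: field_simps)
    hence "ln (l\<^sup>2 - 1) = ln (l\<^sup>2) + ln (1 - 1 / l\<^sup>2)" using l2 inv_l2 by (simp add: ln_mult)
    also have "ln (l\<^sup>2) = 2 * ln l" using l by (simp add: ln_realpow)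
    finally show ?thesis by (simp add: algebra_simps flip: exp_add)
  qed
  finally show ?thesis using intG by (simp add: has_bochner_integral_iff K_def G_def)
qed

lemma bessel_r_continuous: "\<bar>Re \<alpha>\<bar> < 1 / 2 \<Longrightarrow> continuous_on S (bessel_r \<alpha>)"
  by (intro continuous_at_imp_continuous_on ballI DERIV_isCont[OF bessel_r_deriv])

lemma bessel_series_bounded:
  assumes c: "Re c > 0"
  obtains M where "M \<ge> 0" "\<And>y. norm y \<le> X \<Longrightarrow> norm (bessel_series c y) \<le> M"
proof -
  have "continuous_on (cball 0 X) (bessel_series c)"
    by (intro continuous_at_imp_continuous_on ballI DERIV_isCont[OF bessel_series_deriv[OF c]])
  hence "bounded (bessel_series c ` cball 0 X)"
    by (intro compact_imp_bounded compact_continuous_image) auto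
  then obtain M where "M > 0" "\<And>y. y \<in> cball 0 X \<Longrightarrow> norm (bessel_series c y) \<le> M"
    unfolding bounded_pos by auto
  thus ?thesis by (intro that[of M]) auto
qed

text \<open>Since the limit exists, it can be read off the Laplace transform near its singularity at \<open>1\<close>.\<close>

lemma bessel_r_leading:
  assumes a: "\<bar>Re \<alpha>\<bar> < 1 / 2"
    and L: "((\<lambda>x. exp (- of_real x) * bessel_r \<alpha> (of_real (ln x))) \<longlongrightarrow> L) at_top"
  shows "L = Gamma (\<alpha> + 1 / 2) * exp (\<alpha> * of_real (ln 2)) / (2 * of_real (sqrt pi))"
proof -
  define h where "h = (\<lambda>x::real. exp (- complex_of_real x) * bessel_r \<alpha> (of_real (ln x)))"
  define \<kappa> where "\<kappa> = (\<lambda>x::real. exp (\<alpha> * of_real (ln x) - of_real x))"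
  define K where "K = Gamma (\<alpha> + 1 / 2) * Gamma (1 + \<alpha>) * exp (2 * \<alpha> * of_real (ln 2)) / of_real (sqrt pi)"
  \<comment> \<open>Substituting x -> T x in the Laplace integral with l = 1 + 1/T and multiplying
    by T^(-\<alpha>) yields this integrand. Letting T grow moves l to the singularity, while
    \<open>s T\<close> tends pointwise to \<kappa> times L on x > 0.\<close>
  define s where "s = (\<lambda>T x. indicator {0<..} x *\<^sub>R (\<kappa> x * h (T * x)))"
  have bes_meas: "bessel_r \<alpha> \<in> borel_measurable borel"
    by (rule borel_measurable_continuous_onI[OF bessel_r_continuous[OF a]])
  have h_meas: "h \<in> borel_measurable borel"
    unfolding h_def by (intro borel_measurable_times measurable_compose[OF _ bes_meas]) measurable
  have s_meas: "s T \<in> borel_measurable lborel" for T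
  proof -
    have "(\<lambda>x. h (T * x)) \<in> borel_measurable borel"
      by (rule measurable_compose[OF _ h_meas]) measurable
    thus ?thesis unfolding s_def \<kappa>_def by measurable
  qed
  have int_s: "integral\<^sup>L lborel (s T) = K * exp (- (1 + \<alpha>) * of_real (ln (2 + 1 / T)))" if T: "T > 0" for T
  proof -
    define l where "l = 1 + 1 / T"
    define G where "G = (\<lambda>x. indicator {0<..} x *\<^sub>R (exp (\<alpha> * of_real (ln x) - of_real (l * x)) * bessel_r \<alpha> (of_real (ln x))))"
    define I where "I = K * exp (- (1 + \<alpha>) * of_real (ln (l\<^sup>2 - 1)))"
    have l: "l > 1" using T by (simp add: l_def)
    \<comment> \<open>This quotient raised to -(1 + \<alpha>) contributes T^(1 + \<alpha>), which
      the prefactor T^(-\<alpha>) and the Jacobian 1/T cancel exactly; the integral therefore has a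
      finite limit.\<close>
    have "l\<^sup>2 - 1 = (2 + 1 / T) / T"
      using T by (simp add: l_def power2_eq_square field_simps)
    hence lnl: "ln (l\<^sup>2 - 1) = ln (2 + 1 / T) - ln T"
    proof -
      have "2 + 1 / T > 0" using T by (simp add: add_pos_pos)
      hence "ln ((2 + 1 / T) / T) = ln (2 + 1 / T) - ln T" using T by (simp only: ln_divide_pos)
      thus ?thesis using \<open>l\<^sup>2 - 1 = (2 + 1 / T) / T\<close> by simp
    qed
    have "has_bochner_integral lborel G I"
      unfolding G_def I_def K_def by (rule bessel_r_Laplace[OF a l])
    hence "has_bochner_integral lborel (\<lambda>x. G (0 + T * x)) (I /\<^sub>R \<bar>T\<bar>)"
      using lborel_has_bochner_integral_real_affine_iff[of T G I 0] T by simp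
    hence "has_bochner_integral lborel (\<lambda>x. exp (- \<alpha> * of_real (ln T)) * G (0 + T * x))
        (exp (- \<alpha> * of_real (ln T)) * (I /\<^sub>R \<bar>T\<bar>))"
      by (rule has_bochner_integral_mult_right[rotated])
    also have "(\<lambda>x. exp (- \<alpha> * of_real (ln T)) * G (0 + T * x)) = s T"
    proof
      fix x :: real
      show "exp (- \<alpha> * of_real (ln T)) * G (0 + T * x) = s T x"
      proof (cases "x > 0")
        case True
        hence "T * x > 0" using T by simp
        have lT: "l * (T * x) = T * x + x" using T by (simp add: l_def algebra_simps)
        have lnT: "ln (T * x) = ln T + ln x" using T True by (simp add: ln_mult)
        have "exp (- \<alpha> * of_real (ln T)) * G (0 + T * x) =
           (exp (- \<alpha> * of_real (ln T)) * exp (\<alpha> * of_real (ln T + ln x) - of_real (T * x + x))) * bessel_r \<alpha> (of_real (ln (T * x)))"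
          using True \<open>T * x > 0\<close> by (simp only: G_def lT lnT add_0_left greaterThan_iff indicator_simps scaleR_one mult.assoc)
        also have "exp (- \<alpha> * of_real (ln T)) * exp (\<alpha> * of_real (ln T + ln x) - of_real (T * x + x)) = \<kappa> x * exp (- complex_of_real (T * x))"
          by (simp add: \<kappa>_def algebra_simps flip: exp_add)
        finally show ?thesis using True by (simp add: s_def h_def)
      next
        case False
        hence "\<not> T * x > 0" using T by (simp add: zero_less_mult_iff)
        thus ?thesis using False by (simp add: s_def G_def)
      qed
    qed
    finally have "integral\<^sup>L lborel (s T) = exp (- \<alpha> * of_real (ln T)) * (I /\<^sub>R \<bar>T\<bar>)"
      by (rule has_bochner_integral_integral_eq)
    also have "\<dots> = exp (- \<alpha> * of_real (ln T)) * exp (- of_real (ln T)) * I"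
      using T by (simp add: exp_minus exp_of_real scaleR_conv_of_real)
    also have "exp (- \<alpha> * of_real (ln T)) * exp (- of_real (ln T)) * I = K * exp (- (1 + \<alpha>) * of_real (ln (2 + 1 / T)))"
      unfolding I_def lnl by (simp add: algebra_simps flip: exp_add)
    finally show ?thesis .
  qed
  \<comment> \<open>Dominated convergence needs \<open>h\<close> bounded on the whole half-axis:
    near infinity by the assumed limit, on the remaining bounded interval by the series, where 1 +
    Re \<alpha> > 0 keeps the power bounded at 0.\<close>
  obtain M where M: "\<And>x. x > 0 \<Longrightarrow> norm (h x) \<le> M"
  proof -
    have "((\<lambda>x. norm (h x)) \<longlongrightarrow> norm L) at_top" using L unfolding h_def by (intro tendsto_norm)
    hence "\<forall>\<^sub>F x in at_top. norm (h x) < norm L + 1" by (rule order_tendstoD(2)) simp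
    then obtain X where X: "\<And>x. x \<ge> X \<Longrightarrow> norm (h x) < norm L + 1"
      by (auto simp: eventually_at_top_linorder)
    define Y where "Y = max X 1"
    obtain B where B: "B \<ge> 0" "\<And>y. norm y \<le> Y\<^sup>2 \<Longrightarrow> norm (bessel_series (\<alpha> + 3 / 2) y) \<le> B"
    proof (rule bessel_series_bounded[of "\<alpha> + 3 / 2" "Y\<^sup>2"])
      show "0 < Re (\<alpha> + 3 / 2)" using a by auto
    qed blast
    define D where "D = exp ((1 + Re \<alpha>) * ln Y) * B / norm (1 + 2 * \<alpha>)"
    have "norm (h x) \<le> max (norm L + 1) D" if x: "x > 0" for x
    proof (cases "x \<ge> X")
      case False
      hence xY: "x \<le> Y" by (simp add: Y_def)
      have "norm (exp (2 * complex_of_real (ln x))) = x\<^sup>2"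
        using x unfolding exp_double norm_power norm_exp_eq_Re by simp
      also have "\<dots> \<le> Y\<^sup>2" using x xY by (intro power_mono) auto
      finally have b: "norm (bessel_series (\<alpha> + 3 / 2) (exp (2 * of_real (ln x)))) \<le> B" by (rule B(2))
      have "norm (h x) \<le> 1 * norm (bessel_r \<alpha> (of_real (ln x)))"
        unfolding h_def norm_mult using x by (intro mult_right_mono) auto
      also have "\<dots> = exp ((1 + Re \<alpha>) * ln x) * norm (bessel_series (\<alpha> + 3 / 2) (exp (2 * of_real (ln x)))) / norm (1 + 2 * \<alpha>)"
        by (simp add: bessel_r_def norm_mult norm_divide)
      also have "\<dots> \<le> D"
        unfolding D_def using b B(1) a x xY by (intro divide_right_mono mult_mono) (auto intro!: mult_left_mono)
      finally show ?thesis by simp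
    qed (use X[of x] in simp)
    thus ?thesis using that by blast
  qed
  have "((\<lambda>T. integral\<^sup>L lborel (s T)) \<longlongrightarrow> integral\<^sup>L lborel (\<lambda>x. indicator {0<..} x *\<^sub>R (\<kappa> x * L))) at_top"
  proof (rule integral_dominated_convergence_at_top[where w = "\<lambda>x. M * (indicator {0<..} x * exp ((Re \<alpha> + 1 - 1) * ln x - 1 * x))"])
    show "(\<lambda>x. indicator {0<..} x *\<^sub>R (\<kappa> x * L)) \<in> borel_measurable lborel"
      unfolding \<kappa>_def by measurable
    show "integrable lborel (\<lambda>x. M * (indicator {0<..} x * exp ((Re \<alpha> + 1 - 1) * ln x - 1 * x)))"
      using Gamma_kernel_real[of "Re \<alpha> + 1" 1] a
      by (intro integrable_mult_right) (auto simp: has_bochner_integral_iff)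
    show "AE x in lborel. ((\<lambda>T. s T x) \<longlongrightarrow> indicator {0<..} x *\<^sub>R (\<kappa> x * L)) at_top"
    proof (rule AE_I2)
      fix x :: real
      show "((\<lambda>T. s T x) \<longlongrightarrow> indicator {0<..} x *\<^sub>R (\<kappa> x * L)) at_top"
      proof (cases "x > 0")
        case True
        have "filterlim (\<lambda>T. T * x) at_top at_top"
          by (rule filterlim_at_top_mult_tendsto_pos[OF tendsto_const True filterlim_ident])
        hence "((\<lambda>T. h (T * x)) \<longlongrightarrow> L) at_top"
          using L unfolding h_def[symmetric] by (rule filterlim_compose[rotated])
        thus ?thesis unfolding s_def by (intro tendsto_intros)
      qed (simp add: s_def)
    qed
    show "\<forall>\<^sub>F T in at_top. AE x in lborel. norm (s T x) \<le> M * (indicator {0<..} x * exp ((Re \<alpha> + 1 - 1) * ln x - 1 * x))"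
      using eventually_gt_at_top[of 0]
    proof eventually_elim
      case (elim T)
      show ?case
      proof (rule AE_I2)
        fix x :: real
        show "norm (s T x) \<le> M * (indicator {0<..} x * exp ((Re \<alpha> + 1 - 1) * ln x - 1 * x))"
        proof (cases "x > 0")
          case True
          have "norm (s T x) = exp (Re \<alpha> * ln x - x) * norm (h (T * x))"
            using True by (simp add: s_def norm_mult \<kappa>_def)
          also have "\<dots> \<le> exp (Re \<alpha> * ln x - x) * M"
            using True elim by (intro mult_left_mono M) auto
          finally show ?thesis using True by (simp add: mult.commute)
        qed (simp add: s_def)
      qed
    qed
  qed (rule s_meas)
  also have "integral\<^sup>L lborel (\<lambda>x. indicator {0<..} x *\<^sub>R (\<kappa> x * L)) = Gamma (1 + \<alpha>) * L"
  proof -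
    have "has_bochner_integral lborel (\<lambda>x. (indicator {0<..} x *\<^sub>R exp ((1 + \<alpha> - 1) * of_real (ln x) - of_real (1 * x))) * L)
       (Gamma (1 + \<alpha>) * exp (- (1 + \<alpha>) * of_real (ln 1)) * L)"
      by (intro has_bochner_integral_mult_left Gamma_kernel) (use a in auto)
    thus ?thesis by (simp add: \<kappa>_def has_bochner_integral_iff)
  qed
  finally have lim1: "((\<lambda>T. integral\<^sup>L lborel (s T)) \<longlongrightarrow> Gamma (1 + \<alpha>) * L) at_top" .
  have "((\<lambda>T::real. 2 + 1 / T) \<longlongrightarrow> 2 + 0) at_top"
    by (intro tendsto_add tendsto_const real_tendsto_divide_at_top[OF tendsto_const filterlim_ident])
  hence "((\<lambda>T. K * exp (- (1 + \<alpha>) * of_real (ln (2 + 1 / T)))) \<longlongrightarrow> K * exp (- (1 + \<alpha>) * of_real (ln 2))) at_top"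
    by (intro tendsto_intros) auto
  hence lim2: "((\<lambda>T. integral\<^sup>L lborel (s T)) \<longlongrightarrow> K * exp (- (1 + \<alpha>) * of_real (ln 2))) at_top"
    by (rule Lim_transform_eventually)
      (auto intro!: eventually_mono[OF eventually_gt_at_top[of 0]] simp: int_s)
  have "Gamma (1 + \<alpha>) * L = K * exp (- (1 + \<alpha>) * of_real (ln 2))"
    by (rule tendsto_unique[OF _ lim1 lim2]) simp
  also have "\<dots> = Gamma (1 + \<alpha>) * (Gamma (\<alpha> + 1 / 2) / of_real (sqrt pi) * (exp (2 * \<alpha> * of_real (ln 2)) * exp (- (1 + \<alpha>) * of_real (ln 2))))"
    by (simp add: K_def)
  also have "exp (2 * \<alpha> * of_real (ln 2)) * exp (- (1 + \<alpha>) * of_real (ln 2)) = exp (\<alpha> * of_real (ln 2)) * exp (- complex_of_real (ln 2))"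
    by (simp add: algebra_simps flip: exp_add)
  also have "exp (- complex_of_real (ln 2)) = 1 / 2"
    by (simp add: exp_minus exp_of_real)
  finally have "Gamma (1 + \<alpha>) * L = Gamma (1 + \<alpha>) * (Gamma (\<alpha> + 1 / 2) * exp (\<alpha> * of_real (ln 2)) / (2 * of_real (sqrt pi)))"
    by simp
  moreover have "Gamma (1 + \<alpha>) \<noteq> 0"
    using not_nonpos_Int[of "1 + \<alpha>"] a by (auto simp: Gamma_eq_zero_iff)
  ultimately show ?thesis using mult_left_cancel by blast
qed

section \<open>Connection coefficients\<close>

lemma mat2_nth [simp]:
  "mat2 a b c d $ 1 $ 1 = a" "mat2 a b c d $ 1 $ 2 = b"
  "mat2 a b c d $ 2 $ 1 = c" "mat2 a b c d $ 2 $ 2 = d"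
  by (simp_all add: mat2_def)

lemma mat2_eq_iff: "A = mat2 a b c d \<longleftrightarrow> A $ 1 $ 1 = a \<and> A $ 1 $ 2 = b \<and> A $ 2 $ 1 = c \<and> A $ 2 $ 2 = d"
  by (auto simp: vec_eq_iff forall_2)

lemma mat2_mult:
  "mat2 a b c d ** mat2 a' b' c' d' = mat2 (a * a' + b * c') (a * b' + b * d') (c * a' + d * c') (c * b' + d * d')"
  by (simp add: mat2_eq_iff matrix_matrix_mult_def sum_2)

lemma mat_eq_mat2: "mat x = mat2 x 0 0 x"
  by (simp add: mat2_eq_iff mat_def)

lemma norm_mat2_le: "norm (mat2 a b c d) \<le> norm a + norm b + norm c + norm d"
proof -
  have r: "norm (A :: complex^2^2) \<le> norm (A $ 1) + norm (A $ 2)" for A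
    using L2_set_le_sum[of UNIV "\<lambda>i. norm (A $ i)"] by (simp add: norm_vec_def sum_2)
  have "norm (v :: complex^2) \<le> norm (v $ 1) + norm (v $ 2)" for v
    using L2_set_le_sum[of UNIV "\<lambda>i. norm (v $ i)"] by (simp add: norm_vec_def sum_2)
  from this[of "mat2 a b c d $ 1"] this[of "mat2 a b c d $ 2"] r[of "mat2 a b c d"]
  show ?thesis by simp
qed

lemma mat2_diff: "mat2 a b c d - mat2 a' b' c' d' = mat2 (a - a') (b - b') (c - c') (d - d')"
  by (simp add: mat2_eq_iff)

text \<open>The limit of exp (- x) (p + r) on the positive axis. It is twice the limit in
  \<open>bessel_r_leading\<close>, since p and r share their leading term there.\<close>

definition lead :: "complex \<Rightarrow> complex" where
  "lead \<alpha> = Gamma (\<alpha> + 1 / 2) * exp (\<alpha> * of_real (ln 2)) / of_real (sqrt pi)"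

lemma lead_nonzero: "\<bar>Re \<alpha>\<bar> < 1 / 2 \<Longrightarrow> lead \<alpha> \<noteq> 0"
  using not_nonpos_Int[of "\<alpha> + 1 / 2"] by (auto simp: lead_def Gamma_eq_zero_iff)

text \<open>With this normalisation, \<open>x + y\<close> is the coefficient of the growing exponential on the positive axis.\<close>

definition colP :: "complex \<Rightarrow> complex \<Rightarrow> complex \<Rightarrow> complex \<Rightarrow> complex" where
  "colP \<alpha> x y w = x / lead \<alpha> * (bessel_p \<alpha> w + bessel_r \<alpha> w) +
     y / lead (- \<alpha>) * (bessel_p (- \<alpha>) w + bessel_r (- \<alpha>) w)"

text \<open>Replacing \<alpha> by -\<alpha> in the Dirac system amounts to replacing Q by -Q. Hence
  the part belonging to -\<alpha> enters with p - r instead of r - p.\<close>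

definition colQ :: "complex \<Rightarrow> complex \<Rightarrow> complex \<Rightarrow> complex \<Rightarrow> complex" where
  "colQ \<alpha> x y w = x / lead \<alpha> * (bessel_r \<alpha> w - bessel_p \<alpha> w) +
     y / lead (- \<alpha>) * (bessel_p (- \<alpha>) w - bessel_r (- \<alpha>) w)"

lemma colP_deriv:
  assumes "\<bar>Re \<alpha>\<bar> < 1 / 2"
  shows "(colP \<alpha> x y has_field_derivative exp w * colP \<alpha> x y w - \<alpha> * colQ \<alpha> x y w) (at w)"
  unfolding colP_def[abs_def] colQ_def
  by (rule DERIV_cong, rule DERIV_add; (rule DERIV_cmult, rule DERIV_add; rule bessel_p_deriv bessel_r_deriv)?)
    (use assms in \<open>auto simp: algebra_simps\<close>)

lemma colQ_deriv:
  assumes "\<bar>Re \<alpha>\<bar> < 1 / 2"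
  shows "(colQ \<alpha> x y has_field_derivative - exp w * colQ \<alpha> x y w - \<alpha> * colP \<alpha> x y w) (at w)"
  unfolding colQ_def[abs_def] colP_def
  by (rule DERIV_cong, rule DERIV_add; (rule DERIV_cmult, rule DERIV_diff; rule bessel_p_deriv bessel_r_deriv)?)
    (use assms in \<open>auto simp: algebra_simps\<close>)

text \<open>The series depend on z^2 only, so a half turn acts through the powers z^\<alpha> and
  z^(1 + \<alpha>); the additional factor z gives \<open>bessel_r\<close> the opposite sign.\<close>

lemma bessel_rotate:
  "bessel_p \<alpha> (w + \<i> * of_real pi) = exp (\<i> * of_real pi * \<alpha>) * bessel_p \<alpha> w"
  "bessel_r \<alpha> (w + \<i> * of_real pi) = - exp (\<i> * of_real pi * \<alpha>) * bessel_r \<alpha> w"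
proof -
  have "exp (2 * (w + \<i> * of_real pi)) = exp (2 * w) * exp (2 * of_real pi * \<i>)"
    by (simp only: exp_add[symmetric]) (simp add: algebra_simps)
  hence e: "exp (2 * (w + \<i> * of_real pi)) = exp (2 * w)" by simp
  have "exp (\<alpha> * (w + \<i> * of_real pi)) = exp (\<i> * of_real pi * \<alpha>) * exp (\<alpha> * w)"
    by (simp add: algebra_simps flip: exp_add)
  thus "bessel_p \<alpha> (w + \<i> * of_real pi) = exp (\<i> * of_real pi * \<alpha>) * bessel_p \<alpha> w"
    unfolding bessel_p_def e by simp
  have "exp ((1 + \<alpha>) * (w + \<i> * of_real pi)) = exp (\<i> * of_real pi * \<alpha>) * exp (\<i> * of_real pi) * exp ((1 + \<alpha>) * w)"
    by (simp only: exp_add[symmetric]) (simp add: algebra_simps)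
  hence "exp ((1 + \<alpha>) * (w + \<i> * of_real pi)) = - exp (\<i> * of_real pi * \<alpha>) * exp ((1 + \<alpha>) * w)"
    by simp
  thus "bessel_r \<alpha> (w + \<i> * of_real pi) = - exp (\<i> * of_real pi * \<alpha>) * bessel_r \<alpha> w"
    unfolding bessel_r_def e by simp
qed

text \<open>A half turn flips the sign of r relative to p and so exchanges p + r with r - p up to
  factors. Thus Q on the negative axis is P on the positive axis with other coefficients, and a full
  turn acts diagonally on the coefficients (x, y).\<close>

lemma col_rotate:
  "colP \<alpha> x y (w + \<i> * of_real pi) = colQ \<alpha> (- exp (\<i> * of_real pi * \<alpha>) * x) (exp (- (\<i> * of_real pi * \<alpha>)) * y) w"
  "colQ \<alpha> x y (w + \<i> * of_real pi) = colP \<alpha> (- exp (\<i> * of_real pi * \<alpha>) * x) (exp (- (\<i> * of_real pi * \<alpha>)) * y) w"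
  by (simp_all add: colP_def colQ_def bessel_rotate algebra_simps add_divide_distrib diff_divide_distrib)

lemma col_rotate_back:
  "colP \<alpha> x y (w - \<i> * of_real pi) = colQ \<alpha> (- exp (- (\<i> * of_real pi * \<alpha>)) * x) (exp (\<i> * of_real pi * \<alpha>) * y) w"
  "colQ \<alpha> x y (w - \<i> * of_real pi) = colP \<alpha> (- exp (- (\<i> * of_real pi * \<alpha>)) * x) (exp (\<i> * of_real pi * \<alpha>) * y) w"
  using col_rotate[of \<alpha> "- exp (- (\<i> * of_real pi * \<alpha>)) * x" "exp (\<i> * of_real pi * \<alpha>) * y" "w - \<i> * of_real pi"]
  by (simp_all add: mult.assoc[symmetric] flip: exp_add)

text \<open>The right-hand side has its cut along the negative imaginary axis. It is therefore
  differentiable at every nonzero point of the closed upper half-plane, including the negative real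
  axis, where \<open>Ln\<close> has the same value but jumps.\<close>

lemma Ln_upper:
  assumes "Im z \<ge> 0" "z \<noteq> 0"
  shows "Ln z = Ln (- \<i> * z) + \<i> * of_real (pi / 2)"
proof (rule Ln_unique)
  have "exp (Ln (- \<i> * z) + \<i> * of_real (pi / 2)) = (- \<i> * z) * exp (\<i> * of_real (pi / 2))"
    using assms by (simp add: exp_add)
  also have "exp (\<i> * complex_of_real (pi / 2)) = \<i>" by (metis cis_conv_exp cis_pi_half)
  finally show "exp (Ln (- \<i> * z) + \<i> * of_real (pi / 2)) = z" by (simp add: algebra_simps)
  have "\<bar>Im (Ln (- \<i> * z))\<bar> \<le> pi / 2" using assms by (subst Re_Ln_pos_le) auto
  thus "- pi < Im (Ln (- \<i> * z) + \<i> * of_real (pi / 2))" "Im (Ln (- \<i> * z) + \<i> * of_real (pi / 2)) \<le> pi"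
    using pi_gt_zero by (simp_all add: abs_le_iff; linarith)+
qed

text \<open>At this stage A and B are only known to exist; their values require the limits on the
  two half-axes.\<close>

lemma col_estimate_exists:
  assumes a: "\<bar>Re \<alpha>\<bar> < 1 / 2"
  obtains A B C where "C \<ge> 0"
    "\<And>z. Im z \<ge> 0 \<Longrightarrow> norm z \<ge> 1 + norm \<alpha> \<Longrightarrow>
       norm (exp (- z) * colP \<alpha> x y (Ln z) - A) \<le> C / norm z * (norm A + exp (- 2 * Re z) * norm B)"
    "\<And>z. Im z \<ge> 0 \<Longrightarrow> norm z \<ge> 1 + norm \<alpha> \<Longrightarrow>
       exp (- 2 * Re z) * norm (exp z * colQ \<alpha> x y (Ln z) - B)
         \<le> C / norm z * (norm A + exp (- 2 * Re z) * norm B)"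
proof -
  define l where "l = (\<lambda>z. Ln (- \<i> * z) + \<i> * of_real (pi / 2))"
  have dl: "(l has_field_derivative 1 / z) (at z)" and el: "exp (l z) = z" if "Im z \<ge> 0" "z \<noteq> 0" for z
  proof -
    have n: "- \<i> * z \<notin> \<real>\<^sub>\<le>\<^sub>0"
    proof
      assume "- \<i> * z \<in> \<real>\<^sub>\<le>\<^sub>0"
      hence "Im z \<le> 0" "Re z = 0" by (auto simp: complex_nonpos_Reals_iff)
      thus False using that by (auto simp: complex_eq_iff)
    qed
    have "(l has_field_derivative inverse (- \<i> * z) * (- \<i>)) (at z)"
      unfolding l_def by (rule derivative_eq_intros refl n | simp)+
    thus "(l has_field_derivative 1 / z) (at z)" using that by (simp add: field_simps)
    show "exp (l z) = z" using that Ln_upper[of z] unfolding l_def by (metis exp_Ln)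
  qed
  have dP: "((\<lambda>z. colP \<alpha> x y (l z)) has_field_derivative colP \<alpha> x y (l z) - \<alpha> / z * colQ \<alpha> x y (l z)) (at z)"
    if "Im z \<ge> 0" "z \<noteq> 0" for z
    by (rule DERIV_cong[OF DERIV_chain2[OF colP_deriv[OF a] dl[OF that]]])
      (use that in \<open>simp add: el field_simps\<close>)
  have dQ: "((\<lambda>z. colQ \<alpha> x y (l z)) has_field_derivative - colQ \<alpha> x y (l z) - \<alpha> / z * colP \<alpha> x y (l z)) (at z)"
    if "Im z \<ge> 0" "z \<noteq> 0" for z
    by (rule DERIV_cong[OF DERIV_chain2[OF colQ_deriv[OF a] dl[OF that]]])
      (use that in \<open>simp add: el field_simps\<close>)
  obtain A B C where *: "C \<ge> 0"
    "\<And>z. Im z \<ge> 0 \<Longrightarrow> norm z \<ge> 1 + norm \<alpha> \<Longrightarrow>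
       norm (exp (- z) * colP \<alpha> x y (l z) - A) \<le> C / norm z * (norm A + exp (- 2 * Re z) * norm B)"
    "\<And>z. Im z \<ge> 0 \<Longrightarrow> norm z \<ge> 1 + norm \<alpha> \<Longrightarrow>
       exp (- 2 * Re z) * norm (exp z * colQ \<alpha> x y (l z) - B)
         \<le> C / norm z * (norm A + exp (- 2 * Re z) * norm B)"
    by (rule dirac_asymptotics[OF dP dQ]; (rule that)?; assumption)
  have lz: "l z = Ln z" if "Im z \<ge> 0" "norm z \<ge> 1 + norm \<alpha>" for z
  proof -
    have "z \<noteq> 0" using that norm_ge_zero[of \<alpha>] by force
    thus ?thesis using Ln_upper that by (simp add: l_def)
  qed
  show ?thesis
    by (rule that[OF *(1)]) (use *(2,3) lz in auto)
qed

lemma line_error_tendsto_0: "((\<lambda>t::real. c / t * (a + exp (- 2 * t) * b)) \<longlongrightarrow> 0) at_top"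
proof -
  have "((\<lambda>t::real. c / t) \<longlongrightarrow> 0) at_top"
    by (rule real_tendsto_divide_at_top[OF tendsto_const filterlim_ident])
  moreover have "((\<lambda>t::real. exp (- 2 * t)) \<longlongrightarrow> 0) at_top"
    by (intro filterlim_compose[OF exp_at_bot] filterlim_tendsto_neg_mult_at_bot[OF tendsto_const _ filterlim_ident]) simp
  ultimately have "((\<lambda>t::real. c / t * (a + exp (- 2 * t) * b)) \<longlongrightarrow> 0 * (a + 0 * b)) at_top"
    by (intro tendsto_intros)
  thus ?thesis by simp
qed

text \<open>\<open>bessel_r_leading\<close> evaluates a limit whose existence it assumes. Existence
  is provided by the half-plane estimates on the positive axis, applied to the solution with y = 0;
  the general case follows by linearity.\<close>

lemma col_leading:
  assumes a: "\<bar>Re \<alpha>\<bar> < 1 / 2"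
  shows "((\<lambda>t. exp (- of_real t) * colP \<alpha> x y (of_real (ln t))) \<longlongrightarrow> x + y) at_top"
proof -
  have basis: "((\<lambda>t. exp (- of_real t) * (bessel_p \<alpha> (of_real (ln t)) + bessel_r \<alpha> (of_real (ln t)))) \<longlongrightarrow> lead \<alpha>) at_top"
    if a: "\<bar>Re \<alpha>\<bar> < 1 / 2" for \<alpha>
  proof -
    have l: "lead \<alpha> \<noteq> 0" by (rule lead_nonzero[OF a])
    obtain A B C where *: "C \<ge> 0"
      "\<And>z. Im z \<ge> 0 \<Longrightarrow> norm z \<ge> 1 + norm \<alpha> \<Longrightarrow>
         norm (exp (- z) * colP \<alpha> (lead \<alpha>) 0 (Ln z) - A) \<le> C / norm z * (norm A + exp (- 2 * Re z) * norm B)"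
      "\<And>z. Im z \<ge> 0 \<Longrightarrow> norm z \<ge> 1 + norm \<alpha> \<Longrightarrow>
         exp (- 2 * Re z) * norm (exp z * colQ \<alpha> (lead \<alpha>) 0 (Ln z) - B)
           \<le> C / norm z * (norm A + exp (- 2 * Re z) * norm B)"
      by (rule col_estimate_exists[OF a, of "lead \<alpha>" 0]; (rule that)?; assumption)
    define p where "p = (\<lambda>t::real. exp (- complex_of_real t) * bessel_p \<alpha> (of_real (ln t)))"
    define r where "r = (\<lambda>t::real. exp (- complex_of_real t) * bessel_r \<alpha> (of_real (ln t)))"
    have ev: "\<forall>\<^sub>F t in at_top. t \<ge> 1 + norm \<alpha>" by (rule eventually_ge_at_top)
    have P: "((\<lambda>t. (p t + r t) - A) \<longlongrightarrow> 0) at_top"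
    proof (rule Lim_null_comparison[OF eventually_mono[OF ev] line_error_tendsto_0])
      fix t assume t: "t \<ge> 1 + norm \<alpha>"
      hence t0: "t > 0" using norm_ge_zero[of \<alpha>] by linarith
      show "norm ((p t + r t) - A) \<le> C / t * (norm A + exp (- 2 * t) * norm B)"
        using *(2)[of "of_real t"] t t0 l by (simp add: p_def r_def colP_def Ln_of_real algebra_simps)
    qed
    have Q: "((\<lambda>t. (r t - p t) - of_real (exp (- 2 * t)) * B) \<longlongrightarrow> 0) at_top"
    proof (rule Lim_null_comparison[OF eventually_mono[OF ev] line_error_tendsto_0])
      fix t assume t: "t \<ge> 1 + norm \<alpha>"
      hence t0: "t > 0" using norm_ge_zero[of \<alpha>] by linarith
      have e: "complex_of_real (exp (- 2 * t)) * exp (of_real t) = exp (- of_real t)"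
        unfolding exp_of_real[symmetric] by (simp flip: exp_add)
      have "(r t - p t) - of_real (exp (- 2 * t)) * B = of_real (exp (- 2 * t)) * (exp (of_real t) * colQ \<alpha> (lead \<alpha>) 0 (of_real (ln t)) - B)"
        unfolding right_diff_distrib mult.assoc[symmetric] e using l by (simp add: p_def r_def colQ_def algebra_simps)
      hence "norm ((r t - p t) - of_real (exp (- 2 * t)) * B) = exp (- 2 * t) * norm (exp (of_real t) * colQ \<alpha> (lead \<alpha>) 0 (of_real (ln t)) - B)"
        by (simp only: norm_mult norm_of_real abs_exp_cancel)
      also have "\<dots> \<le> C / t * (norm A + exp (- 2 * t) * norm B)"
        using *(3)[of "of_real t"] t t0 by (simp add: Ln_of_real)
      finally show "norm ((r t - p t) - of_real (exp (- 2 * t)) * B) \<le> C / t * (norm A + exp (- 2 * t) * norm B)" .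
    qed
    have "((\<lambda>t::real. exp (- 2 * t)) \<longlongrightarrow> 0) at_top"
      by (intro filterlim_compose[OF exp_at_bot] filterlim_tendsto_neg_mult_at_bot[OF tendsto_const _ filterlim_ident]) simp
    hence e0: "((\<lambda>t. complex_of_real (exp (- 2 * t)) * B) \<longlongrightarrow> of_real 0 * B) at_top"
      by (intro tendsto_intros)
    \<comment> \<open>After multiplication by exp (- t), p + r tends to A and r - p to 0. Half their
      sum isolates r, with limit A / 2.\<close>
    have "((\<lambda>t. (((p t + r t) - A) + ((r t - p t) - of_real (exp (- 2 * t)) * B) + of_real (exp (- 2 * t)) * B + A) / 2) \<longlongrightarrow> (0 + 0 + of_real 0 * B + A) / 2) at_top"
      by (intro tendsto_intros P Q e0) simp
    hence "(r \<longlongrightarrow> A / 2) at_top" by simp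
    from bessel_r_leading[OF a this[unfolded r_def]] have "A = lead \<alpha>"
      by (simp add: lead_def field_simps)
    thus ?thesis using LIM_zero_cancel[OF P] by (simp add: p_def r_def distrib_left)
  qed
  have a': "\<bar>Re (- \<alpha>)\<bar> < 1 / 2" using a by simp
  have "((\<lambda>t. x / lead \<alpha> * (exp (- of_real t) * (bessel_p \<alpha> (of_real (ln t)) + bessel_r \<alpha> (of_real (ln t)))) +
      y / lead (- \<alpha>) * (exp (- of_real t) * (bessel_p (- \<alpha>) (of_real (ln t)) + bessel_r (- \<alpha>) (of_real (ln t)))))
      \<longlongrightarrow> x / lead \<alpha> * lead \<alpha> + y / lead (- \<alpha>) * lead (- \<alpha>)) at_top"
    by (intro tendsto_intros basis a a')
  thus ?thesis using lead_nonzero[OF a] lead_nonzero[OF a'] by (simp add: colP_def algebra_simps)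
qed

text \<open>A is read off at t and B at -t, for large t > 0. On the negative axis the weight exp (-2
  Re z) becomes exp (2 t), and A and B change roles. A half turn rewrites Q there as P with
  coefficients x', y', whose limit x' + y' is given by \<open>col_leading\<close>.\<close>

lemma col_estimate:
  fixes \<alpha> x y :: complex
  defines "A \<equiv> x + y" and "B \<equiv> exp (- (\<i> * of_real pi * \<alpha>)) * y - exp (\<i> * of_real pi * \<alpha>) * x"
  assumes a: "\<bar>Re \<alpha>\<bar> < 1 / 2"
  obtains C where "C \<ge> 0"
    "\<And>z. Im z \<ge> 0 \<Longrightarrow> norm z \<ge> 1 + norm \<alpha> \<Longrightarrow>
       norm (exp (- z) * colP \<alpha> x y (Ln z) - A) \<le> C / norm z * (norm A + exp (- 2 * Re z) * norm B)"
    "\<And>z. Im z \<ge> 0 \<Longrightarrow> norm z \<ge> 1 + norm \<alpha> \<Longrightarrow>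
       exp (- 2 * Re z) * norm (exp z * colQ \<alpha> x y (Ln z) - B)
         \<le> C / norm z * (norm A + exp (- 2 * Re z) * norm B)"
proof -
  obtain A' B' C where *: "C \<ge> 0"
    "\<And>z. Im z \<ge> 0 \<Longrightarrow> norm z \<ge> 1 + norm \<alpha> \<Longrightarrow>
       norm (exp (- z) * colP \<alpha> x y (Ln z) - A') \<le> C / norm z * (norm A' + exp (- 2 * Re z) * norm B')"
    "\<And>z. Im z \<ge> 0 \<Longrightarrow> norm z \<ge> 1 + norm \<alpha> \<Longrightarrow>
       exp (- 2 * Re z) * norm (exp z * colQ \<alpha> x y (Ln z) - B')
         \<le> C / norm z * (norm A' + exp (- 2 * Re z) * norm B')"
    by (rule col_estimate_exists[OF a, of x y]; (rule that)?; assumption)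
  have ev: "\<forall>\<^sub>F t in at_top. t \<ge> 1 + norm \<alpha>" by (rule eventually_ge_at_top)
  have "((\<lambda>t. exp (- of_real t) * colP \<alpha> x y (of_real (ln t)) - A') \<longlongrightarrow> 0) at_top"
  proof (rule Lim_null_comparison[OF eventually_mono[OF ev] line_error_tendsto_0])
    fix t assume t: "t \<ge> 1 + norm \<alpha>"
    hence t0: "t > 0" using norm_ge_zero[of \<alpha>] by linarith
    show "norm (exp (- of_real t) * colP \<alpha> x y (of_real (ln t)) - A') \<le> C / t * (norm A' + exp (- 2 * t) * norm B')"
      using *(2)[of "of_real t"] t t0 by (simp add: Ln_of_real)
  qed
  hence A: "A' = A" unfolding A_def
    using tendsto_unique[OF _ col_leading[OF a] LIM_zero_cancel] by force
  define x' where "x' = - exp (\<i> * of_real pi * \<alpha>) * x"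
  define y' where "y' = exp (- (\<i> * of_real pi * \<alpha>)) * y"
  have "((\<lambda>t. exp (- of_real t) * colP \<alpha> x' y' (of_real (ln t)) - B') \<longlongrightarrow> 0) at_top"
  proof (rule Lim_null_comparison[OF eventually_mono[OF ev] line_error_tendsto_0])
    fix t assume t: "t \<ge> 1 + norm \<alpha>"
    hence t0: "t > 0" using norm_ge_zero[of \<alpha>] by linarith
    have "Ln (- of_real t) = of_real (ln t) + \<i> * of_real pi"
      using t0 by (subst Ln_minus) (auto simp: Ln_of_real)
    hence Q: "colQ \<alpha> x y (Ln (- of_real t)) = colP \<alpha> x' y' (of_real (ln t))"
      by (simp add: col_rotate x'_def y'_def)
    have "exp (2 * t) * norm (exp (- of_real t) * colP \<alpha> x' y' (of_real (ln t)) - B') \<le> C / t * (norm A' + exp (2 * t) * norm B')"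
      using *(3)[of "- of_real t"] t t0 by (simp add: Q)
    hence "exp (- 2 * t) * (exp (2 * t) * norm (exp (- of_real t) * colP \<alpha> x' y' (of_real (ln t)) - B')) \<le> exp (- 2 * t) * (C / t * (norm A' + exp (2 * t) * norm B'))"
      by (intro mult_left_mono) auto
    moreover have "exp (- 2 * t) * (exp (2 * t) * n) = n" for n
      by (simp add: mult.assoc[symmetric] flip: exp_add)
    moreover have "exp (- 2 * t) * (C / t * (norm A' + exp (2 * t) * norm B')) = C / t * (norm B' + exp (- 2 * t) * norm A')"
    proof -
      have "exp (- 2 * t) * (C / t * (norm A' + exp (2 * t) * norm B')) = C / t * (exp (- 2 * t) * (exp (2 * t) * norm B') + exp (- 2 * t) * norm A')"
        by (simp add: algebra_simps)
      thus ?thesis by (simp add: mult.assoc[symmetric] flip: exp_add)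
    qed
    ultimately show "norm (exp (- of_real t) * colP \<alpha> x' y' (of_real (ln t)) - B') \<le> C / t * (norm B' + exp (- 2 * t) * norm A')"
      by (simp only:)
  qed
  hence "B' = x' + y'"
    using tendsto_unique[OF _ col_leading[OF a] LIM_zero_cancel] by force
  hence B: "B' = B" by (simp add: B_def x'_def y'_def)
  show ?thesis by (rule that[OF *(1)]) (use *(2,3) in \<open>simp_all only: A B\<close>)
qed

text \<open>Each column is a solution with its own coefficients, and the constants in front are
  those of \<open>Phi0\<close>. A constant matrix on the right merely recombines the coefficients,
  so \<open>E_hat\<close>, the Stokes factors and the monodromy all become algebra on four
  numbers.\<close>

definition cols :: "complex \<Rightarrow> complex \<Rightarrow> complex \<Rightarrow> complex \<Rightarrow> complex \<Rightarrow> complex \<Rightarrow> complex^2^2" where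
  "cols \<alpha> x1 y1 x2 y2 w =
     mat2 (exp (- (\<i> * of_real pi / 4)) / 2 * colP \<alpha> x1 y1 w) (exp (- (\<i> * of_real pi / 4)) / 2 * colP \<alpha> x2 y2 w)
          (exp (\<i> * of_real pi / 4) / 2 * colQ \<alpha> x1 y1 w) (exp (\<i> * of_real pi / 4) / 2 * colQ \<alpha> x2 y2 w)"

lemma cols_mult:
  "cols \<alpha> x1 y1 x2 y2 w ** mat2 a b c d =
     cols \<alpha> (x1 * a + x2 * c) (y1 * a + y2 * c) (x1 * b + x2 * d) (y1 * b + y2 * d) w"
  unfolding cols_def mat2_mult
  by (simp add: mat2_eq_iff colP_def colQ_def algebra_simps add_divide_distrib diff_divide_distrib)

text \<open>Subtracting (\<alpha>/z) v from v' turns (v1, v1') into (p, r), and (v2, v2') into 1 - 2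
  \<alpha> times the pair (r, p) at -\<alpha>. The matrix with rows 1, 1 and -1, 1 then forms P and
  Q.\<close>

lemma Phi0_eq_cols:
  assumes a: "\<bar>Re \<alpha>\<bar> < 1 / 2"
  shows "Phi0 \<alpha> w = cols \<alpha> (lead \<alpha>) 0 0 ((1 - 2 * \<alpha>) * lead (- \<alpha>)) w"
proof -
  have a': "\<bar>Re (- \<alpha>)\<bar> < 1 / 2" using a by simp
  have "(v1 \<alpha> has_field_derivative \<alpha> * bessel_p \<alpha> w + exp w * bessel_r \<alpha> w) (at w)"
    unfolding v1_eq_bessel_p[OF a, abs_def] by (rule bessel_p_deriv[OF a])
  hence d1: "covering_deriv (v1 \<alpha>) w = exp (- w) * (\<alpha> * bessel_p \<alpha> w) + bessel_r \<alpha> w"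
    by (simp add: covering_deriv_def DERIV_imp_deriv distrib_left mult.assoc[symmetric] flip: exp_add)
  have "(v2 \<alpha> has_field_derivative (1 - 2 * \<alpha>) * (exp w * bessel_p (- \<alpha>) w - (- \<alpha>) * bessel_r (- \<alpha>) w)) (at w)"
    unfolding v2_eq_bessel_r[OF a, abs_def] by (rule DERIV_cmult[OF bessel_r_deriv[OF a']])
  hence "covering_deriv (v2 \<alpha>) w = exp (- w) * ((1 - 2 * \<alpha>) * (exp w * bessel_p (- \<alpha>) w + \<alpha> * bessel_r (- \<alpha>) w))"
    by (simp add: covering_deriv_def DERIV_imp_deriv)
  also have "\<dots> = (exp (- w) * exp w) * ((1 - 2 * \<alpha>) * bessel_p (- \<alpha>) w) + exp (- w) * ((1 - 2 * \<alpha>) * \<alpha> * bessel_r (- \<alpha>) w)"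
    by (simp add: algebra_simps)
  also have "exp (- w) * exp w = 1" by (simp flip: exp_add)
  finally have d2: "covering_deriv (v2 \<alpha>) w = (1 - 2 * \<alpha>) * bessel_p (- \<alpha>) w + exp (- w) * ((1 - 2 * \<alpha>) * \<alpha> * bessel_r (- \<alpha>) w)"
    by simp
  have dv: "- \<alpha> / exp w = - exp (- w) * \<alpha>" by (simp add: exp_minus divide_inverse mult.commute)
  show ?thesis
    unfolding Phi0_def cols_def d1 d2 dv v1_eq_bessel_p[OF a] v2_eq_bessel_r[OF a] mat_eq_mat2 exp_sigma3_def mat2_mult
    using lead_nonzero[OF a] lead_nonzero[OF a']
    by (simp add: mat2_eq_iff colP_def colQ_def algebra_simps add_divide_distrib diff_divide_distrib)
qed

text \<open>The diagonal factor of \<open>E_hat\<close> is made to cancel the leading constants at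
  \<alpha> and -\<alpha>. Of all Gamma functions and powers of 2 only the common factor 1 / cos (pi
  \<alpha>) survives, once Gamma (3/2 - \<alpha>) is reduced to Gamma (1/2 - \<alpha>).\<close>

lemma Phi1_eq_cols:
  fixes \<alpha> :: complex
  defines "u \<equiv> exp (\<i> * of_real pi * \<alpha>)" and "\<omega> \<equiv> exp (\<i> * of_real pi / 4)" and "c \<equiv> cos (of_real pi * \<alpha>)"
  assumes a: "\<bar>Re \<alpha>\<bar> < 1 / 2"
  shows "Phi1 \<alpha> w = cols \<alpha> (\<omega> / u / c) (\<omega> * u / c) (\<omega> * \<i> / c) (1 / \<omega> / c) w"
proof -
  have a': "\<bar>Re (- \<alpha>)\<bar> < 1 / 2" using a by simp
  define d1 where "d1 = 2 powr (1 - \<alpha>) / Gamma (1 / 2 + \<alpha>)"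
  define d2 where "d2 = 2 powr \<alpha> / Gamma (3 / 2 - \<alpha>)"
  define \<kappa> where "\<kappa> = complex_of_real (sqrt pi) / (2 * c)"
  have powr2: "(2 :: complex) powr b = exp (b * of_real (ln 2))" for b
    using Ln_of_real[of 2] by (simp add: powr_def)
  have sp: "complex_of_real (sqrt pi) \<noteq> 0" by simp
  have G: "Gamma (1 / 2 + \<alpha>) \<noteq> 0" "Gamma (1 / 2 - \<alpha>) \<noteq> 0" "Gamma (3 / 2 - \<alpha>) = (1 / 2 - \<alpha>) * Gamma (1 / 2 - \<alpha>)"
    "1 - 2 * \<alpha> \<noteq> 0"
  proof -
    have n: "1 / 2 + \<alpha> \<notin> \<int>\<^sub>\<le>\<^sub>0" "1 / 2 - \<alpha> \<notin> \<int>\<^sub>\<le>\<^sub>0" by (rule not_nonpos_Int; use a in auto)+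
    thus "Gamma (1 / 2 + \<alpha>) \<noteq> 0" "Gamma (1 / 2 - \<alpha>) \<noteq> 0" by (simp_all add: Gamma_eq_zero_iff)
    have "1 / 2 - \<alpha> + 1 = 3 / 2 - \<alpha>" by simp
    thus "Gamma (3 / 2 - \<alpha>) = (1 / 2 - \<alpha>) * Gamma (1 / 2 - \<alpha>)" using Gamma_plus1[OF n(2)] by (simp only:)
    show "1 - 2 * \<alpha> \<noteq> 0" using a by (auto simp: complex_eq_iff)
  qed
  have e2: "exp (\<alpha> * of_real (ln 2)) * exp ((1 - \<alpha>) * of_real (ln 2)) = 2"
  proof -
    have "exp (\<alpha> * of_real (ln 2)) * exp ((1 - \<alpha>) * of_real (ln 2)) = exp (complex_of_real (ln 2))"
      by (simp add: algebra_simps flip: exp_add)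
    thus ?thesis by (simp add: exp_of_real)
  qed
  have L1: "lead \<alpha> * (\<kappa> * d1) = 1 / c"
  proof -
    have "lead \<alpha> * (\<kappa> * d1) = (exp (\<alpha> * of_real (ln 2)) * exp ((1 - \<alpha>) * of_real (ln 2))) / (2 * c)"
      using G sp by (simp add: lead_def \<kappa>_def d1_def powr2 add.commute)
    thus ?thesis unfolding e2 by simp
  qed
  have L2: "(1 - 2 * \<alpha>) * lead (- \<alpha>) * (\<kappa> * d2) = 1 / c"
  proof -
    have h: "1 - 2 * \<alpha> = 2 * (1 / 2 - \<alpha>)" by (simp add: algebra_simps)
    hence h0: "1 / 2 - \<alpha> \<noteq> 0" using G(4) by (metis mult_zero_right)
    have e: "exp (- \<alpha> * of_real (ln 2)) * exp (\<alpha> * of_real (ln 2)) = 1"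
      by (simp flip: exp_add)
    have l: "lead (- \<alpha>) = Gamma (1 / 2 - \<alpha>) * exp (- \<alpha> * of_real (ln 2)) / of_real (sqrt pi)"
      by (simp add: lead_def add.commute)
    have gen: "(2 * h) * (g * e1 / s) * (s / (2 * c) * (e2 / (h * g))) = (e1 * e2) / c"
      if "h \<noteq> 0" "g \<noteq> 0" "s \<noteq> 0" for h g e1 e2 s :: complex
      using that by simp
    have "2 * (1 / 2 - \<alpha>) * lead (- \<alpha>) * (\<kappa> * d2) = (exp (- \<alpha> * of_real (ln 2)) * exp (\<alpha> * of_real (ln 2))) / c"
    proof -
      have d2: "d2 = exp (\<alpha> * of_real (ln 2)) / ((1 / 2 - \<alpha>) * Gamma (1 / 2 - \<alpha>))"
        by (simp only: d2_def powr2 G(3))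
      show ?thesis unfolding l \<kappa>_def d2 by (rule gen[OF h0 G(2) sp])
    qed
    hence "(1 - 2 * \<alpha>) * lead (- \<alpha>) * (\<kappa> * d2) = (exp (- \<alpha> * of_real (ln 2)) * exp (\<alpha> * of_real (ln 2))) / c"
      by (simp only: h)
    thus ?thesis unfolding e .
  qed
  have "E_hat \<alpha> = mat2 (\<kappa> * d1 * (\<omega> / u)) (\<kappa> * d1 * (\<omega> * \<i>)) (\<kappa> * d2 * (\<i> * u / \<omega>)) (\<kappa> * d2 / \<omega>)"
  proof -
    have "exp (- (\<i> * of_real pi / 4)) = 1 / \<omega>" "exp (- \<i> * of_real pi * \<alpha>) = 1 / u"
      by (simp_all add: \<omega>_def u_def exp_minus inverse_eq_divide)
    thus ?thesis
      unfolding E_hat_def exp_sigma3_def mat_eq_mat2 mat2_mult c_def[symmetric] d1_def[symmetric] d2_def[symmetric]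
        \<kappa>_def[symmetric] \<omega>_def[symmetric] u_def[symmetric]
      by (simp add: mat2_eq_iff)
  qed
  hence "Phi1 \<alpha> w = cols \<alpha> (lead \<alpha> * (\<kappa> * d1 * (\<omega> / u))) ((1 - 2 * \<alpha>) * lead (- \<alpha>) * (\<kappa> * d2 * (\<i> * u / \<omega>)))
     (lead \<alpha> * (\<kappa> * d1 * (\<omega> * \<i>))) ((1 - 2 * \<alpha>) * lead (- \<alpha>) * (\<kappa> * d2 / \<omega>)) w"
    unfolding Phi1_def Phi0_eq_cols[OF a] by (simp only: cols_mult mult_zero_left add_0_left add_0_right)
  also have "lead \<alpha> * (\<kappa> * d1 * (\<omega> / u)) = (lead \<alpha> * (\<kappa> * d1)) * (\<omega> / u)" by simp
  also have "(1 - 2 * \<alpha>) * lead (- \<alpha>) * (\<kappa> * d2 * (\<i> * u / \<omega>)) = ((1 - 2 * \<alpha>) * lead (- \<alpha>) * (\<kappa> * d2)) * (\<i> / \<omega> * u)" by simp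
  also have "lead \<alpha> * (\<kappa> * d1 * (\<omega> * \<i>)) = (lead \<alpha> * (\<kappa> * d1)) * (\<omega> * \<i>)" by simp
  also have "(1 - 2 * \<alpha>) * lead (- \<alpha>) * (\<kappa> * d2 / \<omega>) = ((1 - 2 * \<alpha>) * lead (- \<alpha>) * (\<kappa> * d2)) / \<omega>" by simp
  also have "\<i> / \<omega> = \<omega>"
  proof -
    have "\<omega> * \<omega> = \<i>" using cis_conv_exp[of "pi / 2"] by (simp add: \<omega>_def flip: exp_add)
    moreover have "\<omega> \<noteq> 0" by (simp add: \<omega>_def)
    ultimately show ?thesis by (simp add: field_simps)
  qed
  finally show ?thesis unfolding L1 L2 by (simp add: mult.commute)
qed

section \<open>Monodromy and the limit at infinity in the two half-planes\<close>

lemma exp_quarter: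
  "exp (\<i> * of_real pi / 4) * exp (\<i> * of_real pi / 4) = \<i>"
  "exp (- (\<i> * of_real pi / 4)) = 1 / exp (\<i> * of_real pi / 4)"
  using cis_conv_exp[of "pi / 2"] by (simp_all add: exp_minus inverse_eq_divide flip: exp_add)

lemma cos_pi_nonzero:
  assumes "\<bar>Re \<alpha>\<bar> < 1 / 2"
  shows "cos (of_real pi * \<alpha>) \<noteq> 0"
proof
  assume "cos (of_real pi * \<alpha>) = 0"
  then obtain n :: int where "of_real pi * \<alpha> = of_real (n * pi) + of_real pi / 2"
    by (auto simp: cos_eq_0)
  hence "Re (of_real pi * \<alpha>) = Re (of_real (n * pi) + of_real pi / 2)" by simp
  hence "Re \<alpha> * pi = (of_int n + 1 / 2) * pi" by (simp add: algebra_simps)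
  hence "Re \<alpha> = of_int n + 1 / 2" by (simp only: mult_cancel_right pi_neq_zero simp_thms)
  hence "\<bar>of_int n + 1 / 2\<bar> < (1 / 2 :: real)" using assms by simp
  hence "- 1 < (of_int n :: real)" "(of_int n :: real) < 0" by linarith+
  hence "- 1 < n" "n < 0" by linarith+
  thus False by linarith
qed

lemma sin_cos_exp_pi:
  fixes \<alpha> :: complex
  defines "u \<equiv> exp (\<i> * of_real pi * \<alpha>)"
  shows "2 * sin (of_real pi * \<alpha>) = - \<i> * (u - 1 / u)" "2 * cos (of_real pi * \<alpha>) = u + 1 / u"
    "exp (- (\<i> * of_real pi * \<alpha>)) = 1 / u"
proof -
  show e: "exp (- (\<i> * of_real pi * \<alpha>)) = 1 / u" by (simp add: u_def exp_minus inverse_eq_divide)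
  show "2 * sin (of_real pi * \<alpha>) = - \<i> * (u - 1 / u)" "2 * cos (of_real pi * \<alpha>) = u + 1 / u"
    unfolding u_def sin_exp_eq cos_exp_eq by (simp_all add: mult.assoc exp_minus inverse_eq_divide)
qed

lemma half_le: "norm x \<le> b \<Longrightarrow> norm x / 2 \<le> (b :: real)"
  using norm_ge_zero[of x] by linarith

lemma cols_rotate_twice:
  fixes \<alpha> :: complex
  defines "u \<equiv> exp (\<i> * of_real pi * \<alpha>)"
  shows "cols \<alpha> x1 y1 x2 y2 (w + 2 * of_real pi * \<i>) =
     cols \<alpha> (u * u * x1) (1 / u * (1 / u * y1)) (u * u * x2) (1 / u * (1 / u * y2)) w"
proof -
  have w: "w + 2 * of_real pi * \<i> = (w + \<i> * of_real pi) + \<i> * of_real pi" by simp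
  show ?thesis
    unfolding cols_def w col_rotate sin_cos_exp_pi(3) u_def[symmetric] by (simp add: mult.assoc)
qed

text \<open>A full turn multiplies the coefficients x by u^2 and y by u^-2, where u = exp (i pi
  \<alpha>). As 2 sin (pi \<alpha>) = -i (u - 1/u), the claim is four identities in u. They say that
  the Stokes factor \<open>S1_hat\<close> is compatible with the monodromy; the triangular factor
  that remains is the inverse of \<open>S2_hat\<close>.\<close>

lemma Phi2_monodromy:
  assumes a: "\<bar>Re \<alpha>\<bar> < 1 / 2"
  shows "Phi2 \<alpha> (w + 2 * of_real pi * \<i>) = Phi1 \<alpha> w ** mat2 1 0 (2 * sin (of_real pi * \<alpha>)) 1"
proof -
  define u where "u = exp (\<i> * of_real pi * \<alpha>)"
  define \<omega> where "\<omega> = exp (\<i> * complex_of_real pi / 4)"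
  define c where "c = cos (of_real pi * \<alpha>)"
  have nz: "u \<noteq> 0" "\<omega> \<noteq> 0" by (simp_all add: u_def \<omega>_def)
  have \<omega>: "\<omega> * \<omega> = \<i>" unfolding \<omega>_def by (rule exp_quarter)
  hence \<omega>': "1 / \<omega> = - \<i> * \<omega>" using nz by (simp add: field_simps)
  \<comment> \<open>With v for 1/u and r for \<omega>/c the four identities are polynomial modulo u
    v = 1 and i^2 = -1, a form that \<open>algebra\<close> decides.\<close>
  define v where "v = 1 / u"
  define r where "r = \<omega> / c"
  have uv: "u * v = 1" using nz by (simp add: v_def)
  have ii: "\<i> * \<i> = - 1" by simp
  have \<omega>'': "1 / \<omega> / c = - \<i> * r" unfolding \<omega>' by (simp add: r_def)
  have rs: "\<omega> / u / c = r * v" "\<omega> * u / c = r * u" "\<omega> * \<i> / c = r * \<i>"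
    by (simp_all add: r_def v_def)
  note * = Phi1_eq_cols[OF a, folded u_def \<omega>_def c_def, unfolded \<omega>'' rs]
  have s: "2 * sin (of_real pi * \<alpha>) = - \<i> * (u - v)" unfolding u_def v_def by (rule sin_cos_exp_pi)
  have 1: "u * u * (r * v) * 1 + u * u * (r * \<i>) * 0 = r * v * 1 + r * \<i> * (- \<i> * (u - v))"
      "v * (v * (r * u)) * 1 + v * (v * (- \<i> * r)) * 0 = r * u * 1 + - \<i> * r * (- \<i> * (u - v))"
      "u * u * (r * v) * (- \<i> * (u - v)) + u * u * (r * \<i>) * 1 = r * v * 0 + r * \<i> * 1"
      "v * (v * (r * u)) * (- \<i> * (u - v)) + v * (v * (- \<i> * r)) * 1 = r * u * 0 + - \<i> * r * 1"
    using uv ii by algebra+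
  show ?thesis
    unfolding Phi2_def S1_hat_def * cols_rotate_twice[of \<alpha>, folded u_def] cols_mult s v_def[symmetric] 1 ..
qed

text \<open>Together with \<open>Phi2_monodromy\<close> this expresses \<open>Phi_check\<close>
  through \<open>Phi1\<close> at the principal logarithm: the shift of sheet undoes both Stokes
  factors above the real axis and leaves one triangular factor below it.\<close>

lemma Phi3_monodromy:
  assumes a: "\<bar>Re \<alpha>\<bar> < 1 / 2"
  shows "Phi3 \<alpha> (w + 2 * of_real pi * \<i>) = Phi1 \<alpha> w"
proof -
  have "mat2 1 0 (2 * sin (of_real pi * \<alpha>)) 1 ** S2_hat \<alpha> = mat 1"
    by (simp add: S2_hat_def mat2_mult mat_eq_mat2)
  thus ?thesis
    unfolding Phi3_def Phi2_monodromy[OF a] by (simp add: matrix_mul_assoc[symmetric])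
qed

text \<open>When B vanishes the weight exp (-2 Re z) leaves the right-hand side. The estimate
  becomes uniform in the closed half-plane outside a disc, also where Re z is very negative.\<close>

lemma col_growing:
  fixes \<alpha> x y :: complex
  assumes a: "\<bar>Re \<alpha>\<bar> < 1 / 2"
    and B: "exp (- (\<i> * of_real pi * \<alpha>)) * y - exp (\<i> * of_real pi * \<alpha>) * x = 0"
    and A: "x + y = A"
  obtains C where "C \<ge> 0"
    "\<And>z. Im z \<ge> 0 \<Longrightarrow> norm z \<ge> 1 + norm \<alpha> \<Longrightarrow> norm (exp (- z) * colP \<alpha> x y (Ln z) - A) \<le> C / norm z"
    "\<And>z. Im z \<ge> 0 \<Longrightarrow> norm z \<ge> 1 + norm \<alpha> \<Longrightarrow> norm (exp (- z) * colQ \<alpha> x y (Ln z)) \<le> C / norm z"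
proof -
  obtain C where C: "C \<ge> 0"
    "\<And>z. Im z \<ge> 0 \<Longrightarrow> norm z \<ge> 1 + norm \<alpha> \<Longrightarrow>
       norm (exp (- z) * colP \<alpha> x y (Ln z) - A) \<le> C / norm z * (norm A + exp (- 2 * Re z) * norm (0::complex))"
    "\<And>z. Im z \<ge> 0 \<Longrightarrow> norm z \<ge> 1 + norm \<alpha> \<Longrightarrow>
       exp (- 2 * Re z) * norm (exp z * colQ \<alpha> x y (Ln z) - 0)
         \<le> C / norm z * (norm A + exp (- 2 * Re z) * norm (0::complex))"
    by (rule col_estimate[OF a, of x y, unfolded A B]; (rule that)?; assumption)
  have e: "norm (exp (- z) * colQ \<alpha> x y (Ln z)) = exp (- 2 * Re z) * norm (exp z * colQ \<alpha> x y (Ln z))" for z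
    by (simp add: norm_mult mult.assoc[symmetric] flip: exp_add)
  show ?thesis
    by (rule that[of "C * norm A"]) (use C e in auto)
qed

text \<open>When A vanishes the weight is a common factor of both sides and cancels.\<close>

lemma col_decaying:
  fixes \<alpha> x y :: complex
  assumes a: "\<bar>Re \<alpha>\<bar> < 1 / 2" and A: "x + y = 0"
    and B: "exp (- (\<i> * of_real pi * \<alpha>)) * y - exp (\<i> * of_real pi * \<alpha>) * x = B"
  obtains C where "C \<ge> 0"
    "\<And>z. Im z \<ge> 0 \<Longrightarrow> norm z \<ge> 1 + norm \<alpha> \<Longrightarrow> norm (exp z * colQ \<alpha> x y (Ln z) - B) \<le> C / norm z"
    "\<And>z. Im z \<ge> 0 \<Longrightarrow> norm z \<ge> 1 + norm \<alpha> \<Longrightarrow> norm (exp z * colP \<alpha> x y (Ln z)) \<le> C / norm z"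
proof -
  obtain C where C: "C \<ge> 0"
    "\<And>z. Im z \<ge> 0 \<Longrightarrow> norm z \<ge> 1 + norm \<alpha> \<Longrightarrow>
       norm (exp (- z) * colP \<alpha> x y (Ln z) - 0) \<le> C / norm z * (norm (0::complex) + exp (- 2 * Re z) * norm B)"
    "\<And>z. Im z \<ge> 0 \<Longrightarrow> norm z \<ge> 1 + norm \<alpha> \<Longrightarrow>
       exp (- 2 * Re z) * norm (exp z * colQ \<alpha> x y (Ln z) - B)
         \<le> C / norm z * (norm (0::complex) + exp (- 2 * Re z) * norm B)"
    by (rule col_estimate[OF a, of x y, unfolded A B]; (rule that)?; assumption)
  have e: "norm (exp (- z) * colP \<alpha> x y (Ln z)) = exp (- 2 * Re z) * norm (exp z * colP \<alpha> x y (Ln z))" for z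
    by (simp add: norm_mult mult.assoc[symmetric] flip: exp_add)
  have cancel: "m \<le> C * norm B / norm z"
    if "exp (- 2 * Re z) * m \<le> C / norm z * (norm (0::complex) + exp (- 2 * Re z) * norm B)" for m and z :: complex
  proof -
    have "exp (- 2 * Re z) * m \<le> exp (- 2 * Re z) * (C * norm B / norm z)" using that by (simp add: mult_ac)
    thus ?thesis by (simp only: mult_le_cancel_left_pos exp_gt_zero)
  qed
  show ?thesis
  proof (rule that[of "C * norm B"])
    fix z assume z: "Im z \<ge> 0" "norm z \<ge> 1 + norm \<alpha>"
    show "norm (exp z * colQ \<alpha> x y (Ln z) - B) \<le> C * norm B / norm z" by (rule cancel[OF C(3)[OF z]])
    show "norm (exp z * colP \<alpha> x y (Ln z)) \<le> C * norm B / norm z"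
      using cancel[of z] C(2)[OF z] e by simp
  qed (use C in auto)
qed

text \<open>The coefficients produced by \<open>E_hat\<close> are those with B = 0 in the first
  column and A = 0 in the second. By u + 1/u = 2 cos (pi \<alpha>) the surviving limits are 2
  \<omega> and 2 / \<omega>, which the prefactors in \<open>cols\<close> turn into 1.\<close>

lemma Phi1_asymptotics_upper:
  assumes a: "\<bar>Re \<alpha>\<bar> < 1 / 2"
  obtains C where "C \<ge> 0"
    "\<And>z. Im z \<ge> 0 \<Longrightarrow> norm z \<ge> 1 + norm \<alpha> \<Longrightarrow> norm (Phi1 \<alpha> (Ln z) ** exp_sigma3 (- z) - mat 1) \<le> C / norm z"
proof -
  define u where "u = exp (\<i> * of_real pi * \<alpha>)"
  define \<omega> where "\<omega> = exp (\<i> * complex_of_real pi / 4)"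
  define c where "c = cos (of_real pi * \<alpha>)"
  have nz: "u \<noteq> 0" "\<omega> \<noteq> 0" "c \<noteq> 0" using cos_pi_nonzero[OF a] by (simp_all add: u_def \<omega>_def c_def)
  have \<omega>: "\<omega> * \<omega> = \<i>" unfolding \<omega>_def by (rule exp_quarter)
  hence \<omega>': "1 / \<omega> = - \<i> * \<omega>" using nz by (simp add: field_simps)
  have u': "exp (- (\<i> * of_real pi * \<alpha>)) = 1 / u" unfolding u_def by (rule sin_cos_exp_pi)
  have c2: "u + 1 / u = 2 * c" unfolding u_def c_def by (rule sin_cos_exp_pi(2)[symmetric])
  have \<omega>n: "norm \<omega> = 1" by (simp add: \<omega>_def norm_exp_eq_Re)
  have A1: "\<omega> / u / c + \<omega> * u / c = 2 * \<omega>"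
  proof -
    have "\<omega> / u / c + \<omega> * u / c = \<omega> * (u + 1 / u) / c" by (simp add: algebra_simps add_divide_distrib)
    thus ?thesis unfolding c2 using nz by simp
  qed
  have B1: "exp (- (\<i> * of_real pi * \<alpha>)) * (\<omega> * u / c) - exp (\<i> * of_real pi * \<alpha>) * (\<omega> / u / c) = 0"
    unfolding u' u_def[symmetric] using nz by simp
  have A2: "\<omega> * \<i> / c + 1 / \<omega> / c = 0" unfolding \<omega>' by (simp add: algebra_simps)
  have B2: "exp (- (\<i> * of_real pi * \<alpha>)) * (1 / \<omega> / c) - exp (\<i> * of_real pi * \<alpha>) * (\<omega> * \<i> / c) = 2 / \<omega>"
  proof -
    have "a * (b / c) - d * (e / c) = (a * b - d * e) / c" for a b d e :: complex
      by (simp add: diff_divide_distrib)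
    hence "1 / u * (1 / \<omega> / c) - u * (\<omega> * \<i> / c) = (1 / u * (1 / \<omega>) - u * (\<omega> * \<i>)) / c" .
    also have "1 / u * (1 / \<omega>) - u * (\<omega> * \<i>) = (u + 1 / u) * (1 / \<omega>)"
    proof -
      have "\<omega> * \<i> = - (1 / \<omega>)" unfolding \<omega>' by simp
      thus ?thesis unfolding distrib_right by (simp only:) simp
    qed
    finally show ?thesis unfolding u' u_def[symmetric] c2 using nz by simp
  qed
  obtain C1 where C1: "C1 \<ge> 0"
    "\<And>z. Im z \<ge> 0 \<Longrightarrow> norm z \<ge> 1 + norm \<alpha> \<Longrightarrow> norm (exp (- z) * colP \<alpha> (\<omega> / u / c) (\<omega> * u / c) (Ln z) - 2 * \<omega>) \<le> C1 / norm z"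
    "\<And>z. Im z \<ge> 0 \<Longrightarrow> norm z \<ge> 1 + norm \<alpha> \<Longrightarrow> norm (exp (- z) * colQ \<alpha> (\<omega> / u / c) (\<omega> * u / c) (Ln z)) \<le> C1 / norm z"
    by (rule col_growing[OF a B1 A1]; (rule that)?; assumption)
  obtain C2 where C2: "C2 \<ge> 0"
    "\<And>z. Im z \<ge> 0 \<Longrightarrow> norm z \<ge> 1 + norm \<alpha> \<Longrightarrow> norm (exp z * colQ \<alpha> (\<omega> * \<i> / c) (1 / \<omega> / c) (Ln z) - 2 / \<omega>) \<le> C2 / norm z"
    "\<And>z. Im z \<ge> 0 \<Longrightarrow> norm z \<ge> 1 + norm \<alpha> \<Longrightarrow> norm (exp z * colP \<alpha> (\<omega> * \<i> / c) (1 / \<omega> / c) (Ln z)) \<le> C2 / norm z"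
    by (rule col_decaying[OF a A2 B2]; (rule that)?; assumption)
  show ?thesis
  proof (rule that[of "2 * C1 + 2 * C2"])
    fix z assume z: "Im z \<ge> 0" "norm z \<ge> 1 + norm \<alpha>"
    let ?P1 = "exp (- z) * colP \<alpha> (\<omega> / u / c) (\<omega> * u / c) (Ln z)" and ?Q1 = "exp (- z) * colQ \<alpha> (\<omega> / u / c) (\<omega> * u / c) (Ln z)"
    let ?P2 = "exp z * colP \<alpha> (\<omega> * \<i> / c) (1 / \<omega> / c) (Ln z)" and ?Q2 = "exp z * colQ \<alpha> (\<omega> * \<i> / c) (1 / \<omega> / c) (Ln z)"
    have eq: "Phi1 \<alpha> (Ln z) ** exp_sigma3 (- z) - mat 1 =
        mat2 (1 / \<omega> / 2 * (?P1 - 2 * \<omega>)) (1 / \<omega> / 2 * ?P2) (\<omega> / 2 * ?Q1) (\<omega> / 2 * (?Q2 - 2 / \<omega>))"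
      unfolding Phi1_eq_cols[OF a, folded u_def \<omega>_def c_def] cols_def exp_quarter(2) \<omega>_def[symmetric] exp_sigma3_def mat2_mult mat_eq_mat2 mat2_diff
      using nz by (simp add: mat2_eq_iff right_diff_distrib)
    have "norm (Phi1 \<alpha> (Ln z) ** exp_sigma3 (- z) - mat 1) \<le> norm (?P1 - 2 * \<omega>) / 2 + norm ?P2 / 2 + norm ?Q1 / 2 + norm (?Q2 - 2 / \<omega>) / 2"
      unfolding eq by (rule order_trans[OF norm_mat2_le]) (simp add: norm_mult norm_divide \<omega>n)
    also have "\<dots> \<le> C1 / norm z + C2 / norm z + C1 / norm z + C2 / norm z"
      by (rule add_mono[OF add_mono[OF add_mono]]; rule half_le, rule C1(2)[OF z] C2(3)[OF z] C1(3)[OF z] C2(2)[OF z])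
    also have "\<dots> = (2 * C1 + 2 * C2) / norm z" by (simp add: add_divide_distrib)
    finally show "norm (Phi1 \<alpha> (Ln z) ** exp_sigma3 (- z) - mat 1) \<le> (2 * C1 + 2 * C2) / norm z" .
  qed (use C1(1) C2(1) in auto)
qed

lemma Ln_lower:
  assumes "Im z < 0"
  shows "Ln z = Ln (- z) - \<i> * of_real pi"
  using Ln_minus[of "- z"] assms by (auto simp: complex_eq_iff)

text \<open>For z below the axis the point -z lies above it, and the half turn back exchanges P with
  Q, hence growth with decay. By itself the first column would in general contain both exponentials
  there; adding 2 sin (pi \<alpha>) times the second column removes the unwanted one.\<close>

lemma Phi1_asymptotics_lower:
  assumes a: "\<bar>Re \<alpha>\<bar> < 1 / 2"
  obtains C where "C \<ge> 0"
    "\<And>z. Im z < 0 \<Longrightarrow> norm z \<ge> 1 + norm \<alpha> \<Longrightarrow>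
       norm (Phi1 \<alpha> (Ln z) ** mat2 1 0 (2 * sin (of_real pi * \<alpha>)) 1 ** exp_sigma3 (- z) - mat 1) \<le> C / norm z"
proof -
  define u where "u = exp (\<i> * of_real pi * \<alpha>)"
  define \<omega> where "\<omega> = exp (\<i> * complex_of_real pi / 4)"
  define c where "c = cos (of_real pi * \<alpha>)"
  have nz: "u \<noteq> 0" "\<omega> \<noteq> 0" "c \<noteq> 0" using cos_pi_nonzero[OF a] by (simp_all add: u_def \<omega>_def c_def)
  have \<omega>: "\<omega> * \<omega> = \<i>" unfolding \<omega>_def by (rule exp_quarter)
  hence \<omega>': "1 / \<omega> = - \<i> * \<omega>" using nz by (simp add: field_simps)
  have u': "exp (- (\<i> * of_real pi * \<alpha>)) = 1 / u" unfolding u_def by (rule sin_cos_exp_pi)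
  have c2: "u + 1 / u = 2 * c" unfolding u_def c_def by (rule sin_cos_exp_pi(2)[symmetric])
  have s: "2 * sin (of_real pi * \<alpha>) = - \<i> * (u - 1 / u)" unfolding u_def by (rule sin_cos_exp_pi)
  have \<omega>n: "norm \<omega> = 1" by (simp add: \<omega>_def norm_exp_eq_Re)
  have A1: "- \<omega> / c + \<omega> / c = 0" by simp
  have B1: "exp (- (\<i> * of_real pi * \<alpha>)) * (\<omega> / c) - exp (\<i> * of_real pi * \<alpha>) * (- \<omega> / c) = 2 * \<omega>"
  proof -
    have "1 / u * (\<omega> / c) - u * (- \<omega> / c) = \<omega> * (u + 1 / u) / c" by (simp add: algebra_simps add_divide_distrib)
    thus ?thesis unfolding u' u_def[symmetric] c2 using nz by simp
  qed
  have A2: "1 / u * (1 / \<omega> / c) + u * (1 / \<omega> / c) = 2 / \<omega>"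
  proof -
    have "1 / u * (1 / \<omega> / c) + u * (1 / \<omega> / c) = (u + 1 / u) * (1 / \<omega> / c)"
      unfolding distrib_right by (rule add.commute)
    thus ?thesis unfolding c2 using nz by simp
  qed
  have B2: "exp (- (\<i> * of_real pi * \<alpha>)) * (u * (1 / \<omega> / c)) - exp (\<i> * of_real pi * \<alpha>) * (1 / u * (1 / \<omega> / c)) = 0"
    unfolding u' u_def[symmetric] using nz by simp
  obtain C1 where C1: "C1 \<ge> 0"
    "\<And>z. Im z \<ge> 0 \<Longrightarrow> norm z \<ge> 1 + norm \<alpha> \<Longrightarrow> norm (exp z * colQ \<alpha> (- \<omega> / c) (\<omega> / c) (Ln z) - 2 * \<omega>) \<le> C1 / norm z"
    "\<And>z. Im z \<ge> 0 \<Longrightarrow> norm z \<ge> 1 + norm \<alpha> \<Longrightarrow> norm (exp z * colP \<alpha> (- \<omega> / c) (\<omega> / c) (Ln z)) \<le> C1 / norm z"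
    by (rule col_decaying[OF a A1 B1]; (rule that)?; assumption)
  obtain C2 where C2: "C2 \<ge> 0"
    "\<And>z. Im z \<ge> 0 \<Longrightarrow> norm z \<ge> 1 + norm \<alpha> \<Longrightarrow> norm (exp (- z) * colP \<alpha> (1 / u * (1 / \<omega> / c)) (u * (1 / \<omega> / c)) (Ln z) - 2 / \<omega>) \<le> C2 / norm z"
    "\<And>z. Im z \<ge> 0 \<Longrightarrow> norm z \<ge> 1 + norm \<alpha> \<Longrightarrow> norm (exp (- z) * colQ \<alpha> (1 / u * (1 / \<omega> / c)) (u * (1 / \<omega> / c)) (Ln z)) \<le> C2 / norm z"
    by (rule col_growing[OF a B2 A2]; (rule that)?; assumption)
  show ?thesis
  proof (rule that[of "2 * C1 + 2 * C2"])
    fix z assume z: "Im z < 0" "norm z \<ge> 1 + norm \<alpha>"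
    hence z': "Im (- z) \<ge> 0" "norm (- z) \<ge> 1 + norm \<alpha>" by simp_all
    let ?P1 = "exp (- z) * colP \<alpha> (- \<omega> / c) (\<omega> / c) (Ln (- z))" and ?Q1 = "exp (- z) * colQ \<alpha> (- \<omega> / c) (\<omega> / c) (Ln (- z))"
    let ?P2 = "exp z * colP \<alpha> (1 / u * (1 / \<omega> / c)) (u * (1 / \<omega> / c)) (Ln (- z))" and ?Q2 = "exp z * colQ \<alpha> (1 / u * (1 / \<omega> / c)) (u * (1 / \<omega> / c)) (Ln (- z))"
    \<comment> \<open>After the triangular factor and the half turn the first column has the
      coefficients -\<omega>/c and \<omega>/c. Their sum is 0, which is the condition A = 0 at
      -z.\<close>
    have x1: "- (1 / u) * (\<omega> / u / c * 1 + \<omega> * \<i> / c * (- \<i> * (u - 1 / u))) = - \<omega> / c"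
    proof -
      have "\<omega> / u / c * 1 + \<omega> * \<i> / c * X = \<omega> / c * (1 / u + \<i> * X)" for X
        by (simp add: ring_distribs ac_simps)
      hence "\<omega> / u / c * 1 + \<omega> * \<i> / c * (- \<i> * (u - 1 / u)) = \<omega> / c * (1 / u + \<i> * (- \<i> * (u - 1 / u)))" .
      also have "\<i> * (- \<i> * (u - 1 / u)) = u - 1 / u" by simp
      finally show ?thesis using nz by simp
    qed
    have y1: "u * (\<omega> * u / c * 1 + 1 / \<omega> / c * (- \<i> * (u - 1 / u))) = \<omega> / c"
    proof -
      have "\<omega> * u / c * 1 + - \<i> * \<omega> / c * X = \<omega> / c * (u + (- \<i>) * X)" for X
        by (simp add: ring_distribs ac_simps)
      hence "\<omega> * u / c * 1 + - \<i> * \<omega> / c * (- \<i> * (u - 1 / u)) = \<omega> / c * (u + (- \<i>) * (- \<i> * (u - 1 / u)))" .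
      also have "(- \<i>) * (- \<i> * (u - 1 / u)) = - (u - 1 / u)" by simp
      finally show ?thesis unfolding \<omega>' using nz by simp
    qed
    have x2: "- (1 / u) * (\<omega> / u / c * 0 + \<omega> * \<i> / c * 1) = 1 / u * (1 / \<omega> / c)" unfolding \<omega>' by simp
    have y2: "u * (\<omega> * u / c * 0 + 1 / \<omega> / c * 1) = u * (1 / \<omega> / c)" by simp
    have eq: "Phi1 \<alpha> (Ln z) ** mat2 1 0 (2 * sin (of_real pi * \<alpha>)) 1 ** exp_sigma3 (- z) - mat 1 =
        mat2 (1 / \<omega> / 2 * (?Q1 - 2 * \<omega>)) (1 / \<omega> / 2 * ?Q2) (\<omega> / 2 * ?P1) (\<omega> / 2 * (?P2 - 2 / \<omega>))"
      unfolding s Phi1_eq_cols[OF a, folded u_def \<omega>_def c_def] cols_mult Ln_lower[OF z(1)]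
      unfolding cols_def col_rotate_back u' u_def[symmetric] x1 y1 x2 y2 exp_quarter(2) \<omega>_def[symmetric] exp_sigma3_def mat2_mult mat_eq_mat2 mat2_diff
      using nz by (simp add: mat2_eq_iff right_diff_distrib)
    have "norm (Phi1 \<alpha> (Ln z) ** mat2 1 0 (2 * sin (of_real pi * \<alpha>)) 1 ** exp_sigma3 (- z) - mat 1) \<le> norm (?Q1 - 2 * \<omega>) / 2 + norm ?Q2 / 2 + norm ?P1 / 2 + norm (?P2 - 2 / \<omega>) / 2"
      unfolding eq by (rule order_trans[OF norm_mat2_le]) (simp add: norm_mult norm_divide \<omega>n)
    also have "\<dots> \<le> C1 / norm z + C2 / norm z + C1 / norm z + C2 / norm z"
      by (rule add_mono[OF add_mono[OF add_mono]]; rule half_le, rule C1(2)[OF z', unfolded minus_minus norm_minus_cancel]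
          C1(3)[OF z', unfolded minus_minus norm_minus_cancel]
          C2(2)[OF z', unfolded minus_minus norm_minus_cancel]
          C2(3)[OF z', unfolded minus_minus norm_minus_cancel])
    also have "\<dots> = (2 * C1 + 2 * C2) / norm z" by (simp add: add_divide_distrib)
    finally show "norm (Phi1 \<alpha> (Ln z) ** mat2 1 0 (2 * sin (of_real pi * \<alpha>)) 1 ** exp_sigma3 (- z) - mat 1) \<le> (2 * C1 + 2 * C2) / norm z" .
  qed (use C1(1) C2(1) in auto)
qed

section \<open>The sectors of the parametrix\<close>

lemma cos_sign:
  assumes "- (3 * pi / 2) < x" "x < 3 * pi / 2"
  shows "0 < cos x \<longleftrightarrow> \<bar>x\<bar> < pi / 2" "cos x < 0 \<longleftrightarrow> \<bar>x\<bar> > pi / 2"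
proof -
  have pos: "0 < cos x" if "\<bar>x\<bar> < pi / 2" using that by (intro cos_gt_zero_pi) auto
  have neg: "cos x < 0" if "\<bar>x\<bar> > pi / 2"
  proof -
    have "0 < cos (\<bar>x\<bar> - pi)" using that assms by (intro cos_gt_zero_pi) auto
    also have "cos (\<bar>x\<bar> - pi) = - cos \<bar>x\<bar>" by (simp add: cos_diff)
    finally show ?thesis by simp
  qed
  have zero: "cos x = 0" if "\<bar>x\<bar> = pi / 2"
    using that by (metis cos_abs_real cos_pi_half)
  from pos neg zero show "0 < cos x \<longleftrightarrow> \<bar>x\<bar> < pi / 2" "cos x < 0 \<longleftrightarrow> \<bar>x\<bar> > pi / 2"
    by (smt (verit))+
qed

lemma Re_rotated:
  assumes "w \<noteq> 0"
  shows "cos \<phi> * Re w + sin \<phi> * Im w = norm w * cos (Arg w - \<phi>)"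
proof -
  have "w = rcis (norm w) (Arg w)" by (simp add: rcis_cmod_Arg)
  hence "Re w = norm w * cos (Arg w)" "Im w = norm w * sin (Arg w)" by (metis Re_rcis, metis Im_rcis)
  thus ?thesis by (simp add: cos_diff algebra_simps)
qed

text \<open>The linear form is the scalar product of w with the unit vector at angle \<phi>. Since
  Arg w lies in (-pi, pi], the difference Arg w - \<phi> stays within 3 pi / 2 of 0, where its
  absolute value alone decides the sign of the cosine.\<close>

lemma half_plane_Arg:
  assumes w: "w \<noteq> 0" and \<phi>: "- (pi / 2) < \<phi>" "\<phi> \<le> pi / 2"
  shows "0 < cos \<phi> * Re w + sin \<phi> * Im w \<longleftrightarrow> \<bar>Arg w - \<phi>\<bar> < pi / 2"
    "cos \<phi> * Re w + sin \<phi> * Im w < 0 \<longleftrightarrow> \<bar>Arg w - \<phi>\<bar> > pi / 2"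
proof -
  have "- pi < Arg w" "Arg w \<le> pi" by (rule mpi_less_Arg, rule Arg_le_pi)
  hence r: "- (3 * pi / 2) < Arg w - \<phi>" "Arg w - \<phi> < 3 * pi / 2" using \<phi> by linarith+
  show "0 < cos \<phi> * Re w + sin \<phi> * Im w \<longleftrightarrow> \<bar>Arg w - \<phi>\<bar> < pi / 2"
    "cos \<phi> * Re w + sin \<phi> * Im w < 0 \<longleftrightarrow> \<bar>Arg w - \<phi>\<bar> > pi / 2"
    unfolding Re_rotated[OF w] using w cos_sign[OF r] by (auto simp: zero_less_mult_iff mult_less_0_iff)
qed

text \<open>The boundaries of these half-planes are the axes and the diagonals. Every sector in the
  construction is an intersection of them, so membership becomes linear arithmetic in Re w and Im
  w.\<close>

lemma Arg_half_planes:
  assumes w: "w \<noteq> 0"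
  shows "Im w < Re w \<longleftrightarrow> - (3 * pi / 4) < Arg w \<and> Arg w < pi / 4"
    "Re w < Im w \<longleftrightarrow> Arg w < - (3 * pi / 4) \<or> pi / 4 < Arg w"
    "- Im w < Re w \<longleftrightarrow> - (pi / 4) < Arg w \<and> Arg w < 3 * pi / 4"
    "Re w < - Im w \<longleftrightarrow> Arg w < - (pi / 4) \<or> 3 * pi / 4 < Arg w"
    "0 < Re w \<longleftrightarrow> - (pi / 2) < Arg w \<and> Arg w < pi / 2"
    "Re w < 0 \<longleftrightarrow> Arg w < - (pi / 2) \<or> pi / 2 < Arg w"
    "0 < Im w \<longleftrightarrow> 0 < Arg w \<and> Arg w < pi"
    "Im w < 0 \<longleftrightarrow> Arg w < 0"
proof -
  have b: "- (pi / 2) < - (pi / 4)" "- (pi / 4) \<le> pi / 2" "- (pi / 2) < pi / 4" "pi / 4 \<le> pi / 2"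
    "- (pi / 2) < 0" "0 \<le> pi / 2" "- (pi / 2) < pi / 2" "pi / 2 \<le> pi / 2"
    using pi_gt_zero by linarith+
  have bounds: "- pi < Arg w" "Arg w \<le> pi" by (rule mpi_less_Arg, rule Arg_le_pi)
  have q: "cos (- (pi / 4)) * Re w + sin (- (pi / 4)) * Im w = sqrt 2 / 2 * (Re w - Im w)"
    "cos (pi / 4) * Re w + sin (pi / 4) * Im w = sqrt 2 / 2 * (Re w - - Im w)"
    by (simp_all add: cos_45 sin_45 algebra_simps)
  note 1 = half_plane_Arg[OF w b(1,2), unfolded q] and 2 = half_plane_Arg[OF w b(3,4), unfolded q]
    and 3 = half_plane_Arg[OF w b(5,6)] and 4 = half_plane_Arg[OF w b(7,8)]
  have sgn: "0 < sqrt 2 / 2 * x \<longleftrightarrow> 0 < x" "sqrt 2 / 2 * x < 0 \<longleftrightarrow> x < 0" for x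
    by (simp_all add: zero_less_mult_iff mult_less_0_iff)
  have trig0: "cos 0 * Re w + sin 0 * Im w = Re w" "cos (pi / 2) * Re w + sin (pi / 2) * Im w = Im w"
    by simp_all
  have near: "\<bar>x - \<phi>\<bar> < pi / 2 \<longleftrightarrow> \<phi> - pi / 2 < x \<and> x < \<phi> + pi / 2"
    and far: "\<bar>x - \<phi>\<bar> > pi / 2 \<longleftrightarrow> x < \<phi> - pi / 2 \<or> \<phi> + pi / 2 < x" for x \<phi>
    by arith+
  have ends: "- (pi / 4) - pi / 2 = - (3 * pi / 4)" "- (pi / 4) + pi / 2 = pi / 4"
    "pi / 4 - pi / 2 = - (pi / 4)" "pi / 4 + pi / 2 = 3 * pi / 4" "0 - pi / 2 = - (pi / 2)" "0 + pi / 2 = pi / 2"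
    "pi / 2 - pi / 2 = 0" "pi / 2 + pi / 2 = pi"
    by simp_all
  note simps = sgn trig0 near far ends diff_gt_0_iff_gt diff_less_0_iff_less
  show "Im w < Re w \<longleftrightarrow> - (3 * pi / 4) < Arg w \<and> Arg w < pi / 4"
    "Re w < Im w \<longleftrightarrow> Arg w < - (3 * pi / 4) \<or> pi / 4 < Arg w"
    using 1 by (simp_all only: simps)
  show "- Im w < Re w \<longleftrightarrow> - (pi / 4) < Arg w \<and> Arg w < 3 * pi / 4"
    "Re w < - Im w \<longleftrightarrow> Arg w < - (pi / 4) \<or> 3 * pi / 4 < Arg w"
    using 2 by (simp_all only: simps)
  show "0 < Re w \<longleftrightarrow> - (pi / 2) < Arg w \<and> Arg w < pi / 2"
    "Re w < 0 \<longleftrightarrow> Arg w < - (pi / 2) \<or> pi / 2 < Arg w"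
    using 3 by (simp_all only: simps)
  show "0 < Im w \<longleftrightarrow> 0 < Arg w \<and> Arg w < pi" using 4(1) by (simp only: simps)
  show "Im w < 0 \<longleftrightarrow> Arg w < 0" using 4(2) bounds by (simp only: simps) auto
qed

text \<open>The analytic branches of \<open>Phi_bar\<close> in the right, left, upper and lower sector. In \<open>PsiU\<close> the cut of
  the logarithm is moved to the negative imaginary axis.\<close>

definition PsiR :: "complex \<Rightarrow> complex \<Rightarrow> complex^2^2" where
  "PsiR \<alpha> w = Phi1 \<alpha> (Ln (\<i> * w))"

definition PsiL :: "complex \<Rightarrow> complex \<Rightarrow> complex^2^2" where
  "PsiL \<alpha> w = Phi1 \<alpha> (Ln (\<i> * w)) ** mat2 1 0 (2 * sin (of_real pi * \<alpha>)) 1"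

definition PsiU :: "complex \<Rightarrow> complex \<Rightarrow> complex \<Rightarrow> complex^2^2" where
  "PsiU \<alpha> k w = Phi1 \<alpha> (Ln (- \<i> * w) + \<i> * of_real pi) ** mat2 1 (- s3 \<alpha> k) 0 1"

definition PsiD :: "complex \<Rightarrow> complex \<Rightarrow> complex \<Rightarrow> complex^2^2" where
  "PsiD \<alpha> k w = Phi1 \<alpha> (Ln (\<i> * w)) ** mat2 1 0 (- s1 \<alpha> k) 1"

lemma PsiU_right:
  assumes "Re w \<ge> 0" "Re w = 0 \<Longrightarrow> Im w > 0" "w \<noteq> 0"
  shows "PsiU \<alpha> k w = PsiR \<alpha> w ** mat2 1 (- s3 \<alpha> k) 0 1"
proof -
  have "Ln (\<i> * w) = Ln (- \<i> * w) + \<i> * of_real pi"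
    using Ln_minus[of "- \<i> * w"] assms by (auto simp: algebra_simps)
  thus ?thesis by (simp add: PsiU_def PsiR_def)
qed

text \<open>In the left half-plane the logarithms in \<open>PsiU\<close> and \<open>PsiL\<close>
  differ by 2 pi i, so the monodromy enters and contributes \<open>S1_hat\<close>. The relation s1 +
  s3 = -2 sin (pi \<alpha>) merges the triangular factors; for this reason the two definitions agree
  on the positive imaginary axis.\<close>

lemma PsiU_left:
  assumes a: "\<bar>Re \<alpha>\<bar> < 1 / 2" and w: "Re w < 0"
  shows "PsiU \<alpha> k w = PsiL \<alpha> w ** mat2 1 (s1 \<alpha> k) 0 1"
proof -
  have "w \<noteq> 0" using w by auto
  hence eq: "Ln (\<i> * w) + 2 * of_real pi * \<i> = Ln (- \<i> * w) + \<i> * of_real pi"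
    using Ln_minus[of "- \<i> * w"] w by (auto simp: algebra_simps)
  have "Phi2 \<alpha> (Ln (- \<i> * w) + \<i> * of_real pi) = PsiL \<alpha> w"
    using Phi2_monodromy[OF a, of "Ln (\<i> * w)"] unfolding eq PsiL_def .
  hence "PsiL \<alpha> w ** mat2 1 (s1 \<alpha> k) 0 1 =
      Phi1 \<alpha> (Ln (- \<i> * w) + \<i> * of_real pi) ** (S1_hat \<alpha> ** mat2 1 (s1 \<alpha> k) 0 1)"
    unfolding Phi2_def by (simp only: matrix_mul_assoc)
  also have "S1_hat \<alpha> ** mat2 1 (s1 \<alpha> k) 0 1 = mat2 1 (- s3 \<alpha> k) 0 1"
    by (simp add: S1_hat_def mat2_mult mat2_eq_iff s1_def s3_def)
  finally show ?thesis by (simp add: PsiU_def)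
qed

lemma PsiD_right: "PsiD \<alpha> k w = PsiR \<alpha> w ** mat2 1 0 (- s1 \<alpha> k) 1"
  by (simp add: PsiD_def PsiR_def)

text \<open>Again s1 + s3 = -2 sin (pi \<alpha>), now without monodromy, since the cut of
  \<open>Ln (\<i> * w)\<close> is the positive imaginary axis.\<close>

lemma PsiD_left: "PsiD \<alpha> k w = PsiL \<alpha> w ** mat2 1 0 (s3 \<alpha> k) 1"
  unfolding PsiD_def PsiL_def matrix_mul_assoc[symmetric] mat2_mult by (simp add: s1_def s3_def add.commute)

lemma Phi_tilde_eq:
  assumes a: "\<bar>Re \<alpha>\<bar> < 1 / 2"
  shows "Re w > 0 \<Longrightarrow> Phi_tilde \<alpha> w = PsiR \<alpha> w" "Re w < 0 \<Longrightarrow> Phi_tilde \<alpha> w = PsiL \<alpha> w"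
  by (simp_all add: Phi_tilde_def Phi_check_def PsiR_def PsiL_def Phi3_monodromy[OF a] Phi2_monodromy[OF a])

lemma Phi_sectors_eq:
  assumes a: "\<bar>Re \<alpha>\<bar> < 1 / 2"
  shows "\<bar>Im w\<bar> < Re w \<Longrightarrow> Phi_sectors \<alpha> k w = PsiR \<alpha> w"
    "\<bar>Im w\<bar> < - Re w \<Longrightarrow> Phi_sectors \<alpha> k w = PsiL \<alpha> w"
    "\<bar>Re w\<bar> < Im w \<Longrightarrow> Re w \<noteq> 0 \<Longrightarrow> Phi_sectors \<alpha> k w = PsiU \<alpha> k w"
    "\<bar>Re w\<bar> < - Im w \<Longrightarrow> Re w \<noteq> 0 \<Longrightarrow> Phi_sectors \<alpha> k w = PsiD \<alpha> k w"
proof -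
  have R: "\<bar>Arg w\<bar> < pi / 4 \<longleftrightarrow> \<bar>Im w\<bar> < Re w" if "w \<noteq> 0" for w
    using Arg_half_planes(1,3)[OF that] pi_gt_zero by (simp add: abs_less_iff; linarith)
  have L: "\<bar>Arg (- w)\<bar> < pi / 4 \<longleftrightarrow> \<bar>Im w\<bar> < - Re w" if "w \<noteq> 0"
    using R[of "- w"] that by simp
  have bounds: "- pi < Arg w" "Arg w \<le> pi" by (rule mpi_less_Arg, rule Arg_le_pi)
  {
    assume r: "\<bar>Im w\<bar> < Re w"
    hence "w \<noteq> 0" by auto
    thus "Phi_sectors \<alpha> k w = PsiR \<alpha> w"
      unfolding Phi_sectors_def using R[OF \<open>w \<noteq> 0\<close>] r by (simp add: Phi_tilde_eq[OF a])
  next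
    assume r: "\<bar>Im w\<bar> < - Re w"
    hence "w \<noteq> 0" by auto
    thus "Phi_sectors \<alpha> k w = PsiL \<alpha> w"
      unfolding Phi_sectors_def using L r by (simp add: Phi_tilde_eq[OF a])
  next
    assume u: "\<bar>Re w\<bar> < Im w" and nz: "Re w \<noteq> 0"
    hence w: "w \<noteq> 0" by auto
    note h = Arg_half_planes[OF w]
    have no: "\<not> (\<bar>Arg w\<bar> < pi / 4 \<or> \<bar>Arg (- w)\<bar> < pi / 4)" using R[OF w] L[OF w] u by auto
    show "Phi_sectors \<alpha> k w = PsiU \<alpha> k w"
    proof (cases "Re w > 0")
      case True
      hence "pi / 4 < Arg w \<and> Arg w < pi / 2" using h(2,5) u by auto
      thus ?thesis unfolding Phi_sectors_def if_not_P[OF no]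
        using True w by (simp add: Phi_tilde_eq[OF a] PsiU_right)
    next
      case False
      hence neg: "Re w < 0" using nz by simp
      hence "\<not> (pi / 4 < Arg w \<and> Arg w < pi / 2)" "pi / 2 < Arg w \<and> Arg w < 3 * pi / 4"
        using h(3,6) u by auto
      thus ?thesis unfolding Phi_sectors_def if_not_P[OF no]
        using neg by (simp add: Phi_tilde_eq[OF a] PsiU_left[OF a])
    qed
  next
    assume u: "\<bar>Re w\<bar> < - Im w" and nz: "Re w \<noteq> 0"
    hence w: "w \<noteq> 0" by auto
    note h = Arg_half_planes[OF w]
    have no: "\<not> (\<bar>Arg w\<bar> < pi / 4 \<or> \<bar>Arg (- w)\<bar> < pi / 4)" using R[OF w] L[OF w] u by auto
    have neg: "Arg w < 0" using h(8) u by auto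
    hence no2: "\<not> (pi / 4 < Arg w \<and> Arg w < pi / 2)" "\<not> (pi / 2 < Arg w \<and> Arg w < 3 * pi / 4)"
      using pi_gt_zero by linarith+
    show "Phi_sectors \<alpha> k w = PsiD \<alpha> k w"
    proof (cases "Re w > 0")
      case True
      have "- (pi / 2) < Arg w" "\<not> (- (pi / 4) < Arg w \<and> Arg w < 3 * pi / 4)" using h(3,5) u True by auto
      moreover have "Arg w \<noteq> - (pi / 4)"
        using h(4) u by auto
      ultimately have "- (pi / 2) < Arg w \<and> Arg w < - (pi / 4)" using neg pi_gt_zero by linarith
      thus ?thesis unfolding Phi_sectors_def if_not_P[OF no] if_not_P[OF no2(1)] if_not_P[OF no2(2)]
        using True by (simp add: Phi_tilde_eq[OF a] PsiD_right)
    next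
      case False
      hence neg': "Re w < 0" using nz by simp
      have "- (3 * pi / 4) < Arg w" using h(1) u by auto
      moreover have "Arg w < - (pi / 2)" using h(6) neg' neg pi_gt_zero by linarith
      ultimately have "\<not> (- (pi / 2) < Arg w \<and> Arg w < - (pi / 4))" "- (3 * pi / 4) < Arg w \<and> Arg w < - (pi / 2)"
        by linarith+
      thus ?thesis unfolding Phi_sectors_def if_not_P[OF no] if_not_P[OF no2(1)] if_not_P[OF no2(2)]
        using neg' by (simp add: Phi_tilde_eq[OF a] PsiD_left)
    qed
  }
qed

section \<open>Holomorphic matrix functions and the continuation across the imaginary axis\<close>

definition mat_holo :: "(complex \<Rightarrow> complex^2^2) \<Rightarrow> complex set \<Rightarrow> bool" where
  "mat_holo F S \<longleftrightarrow> (\<forall>i j. (\<lambda>z. F z $ i $ j) holomorphic_on S)"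

lemma mat_holo_mult: "mat_holo F S \<Longrightarrow> mat_holo G S \<Longrightarrow> mat_holo (\<lambda>z. F z ** G z) S"
  unfolding mat_holo_def matrix_matrix_mult_def by (auto intro!: holomorphic_intros simp: sum_2)

lemma mat_holo_const: "mat_holo (\<lambda>z. A) S"
  by (simp add: mat_holo_def)

lemma mat_holo_mat2:
  assumes "a holomorphic_on S" "b holomorphic_on S" "c holomorphic_on S" "d holomorphic_on S"
  shows "mat_holo (\<lambda>z. mat2 (a z) (b z) (c z) (d z)) S"
  using assms by (simp add: mat_holo_def forall_2)

lemma mat_holo_compose:
  assumes "mat_holo F UNIV" "f holomorphic_on S"
  shows "mat_holo (\<lambda>z. F (f z)) S"
  using assms holomorphic_on_compose_gen[of f S _ UNIV] unfolding mat_holo_def o_def by auto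

lemma mat_holo_subset: "mat_holo F S \<Longrightarrow> T \<subseteq> S \<Longrightarrow> mat_holo F T"
  unfolding mat_holo_def using holomorphic_on_subset by blast

lemma mat_holo_cong: "mat_holo F S \<Longrightarrow> (\<And>z. z \<in> S \<Longrightarrow> G z = F z) \<Longrightarrow> mat_holo G S"
  unfolding mat_holo_def by (metis (mono_tags, lifting) holomorphic_transform)

lemma mat_holo_exp_sigma3: "f holomorphic_on S \<Longrightarrow> mat_holo (\<lambda>z. exp_sigma3 (f z)) S"
  unfolding exp_sigma3_def by (intro mat_holo_mat2 holomorphic_intros) auto

lemma mat_holo_tendsto:
  assumes "mat_holo F S" "open S" "z \<in> S"
  shows "(F \<longlongrightarrow> F z) (at z within A)"
proof (intro vec_tendstoI)
  fix i j
  have "continuous_on S (\<lambda>z. F z $ i $ j)"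
    using assms(1) unfolding mat_holo_def by (intro holomorphic_on_imp_continuous_on) auto
  hence "isCont (\<lambda>z. F z $ i $ j) z" using assms by (simp add: continuous_on_eq_continuous_at)
  thus "((\<lambda>z. F z $ i $ j) \<longlongrightarrow> F z $ i $ j) (at z within A)"
    unfolding isCont_def by (rule tendsto_within_subset) simp
qed

text \<open>In the logarithmic coordinate the solutions are entire, since the series converge
  everywhere and powers are exponentials. Every branch of the parametrix is this one function
  composed with a branch of the logarithm, times a constant matrix.\<close>

lemma mat_holo_Phi1:
  assumes "\<bar>Re \<alpha>\<bar> < 1 / 2"
  shows "mat_holo (Phi1 \<alpha>) UNIV"
proof -
  have "colP \<alpha> x y holomorphic_on UNIV" "colQ \<alpha> x y holomorphic_on UNIV" for x y
    unfolding holomorphic_on_def field_differentiable_def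
    using colP_deriv[OF assms, THEN has_field_derivative_at_within]
      colQ_deriv[OF assms, THEN has_field_derivative_at_within] by blast+
  thus ?thesis unfolding Phi1_eq_cols[OF assms, abs_def] cols_def
    by (intro mat_holo_mat2 holomorphic_intros)
qed

lemma mat_holo_Psi:
  assumes a: "\<bar>Re \<alpha>\<bar> < 1 / 2"
  shows "mat_holo (PsiR \<alpha>) {w. Re w > 0}" "mat_holo (PsiL \<alpha>) {w. Re w < 0}"
    "mat_holo (PsiU \<alpha> k) {w. Im w > 0}" "mat_holo (PsiD \<alpha> k) {w. Im w < 0}"
  unfolding PsiR_def[abs_def] PsiL_def[abs_def] PsiU_def[abs_def] PsiD_def[abs_def]
  by (intro mat_holo_mult mat_holo_const mat_holo_compose[OF mat_holo_Phi1[OF a]] holomorphic_intros;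
      auto simp: complex_nonpos_Reals_iff)+

text \<open>On the imaginary axis the value is a limit from both sides. There \<open>PsiU\<close> or
  \<open>PsiD\<close> is holomorphic in a full neighbourhood and agrees with
  \<open>Phi_sectors\<close> off the axis, so its own value is that limit.\<close>

lemma Phi_bar_eq:
  assumes a: "\<bar>Re \<alpha>\<bar> < 1 / 2"
  shows "\<bar>Im w\<bar> < Re w \<Longrightarrow> Phi_bar \<alpha> k w = PsiR \<alpha> w"
    "\<bar>Im w\<bar> < - Re w \<Longrightarrow> Phi_bar \<alpha> k w = PsiL \<alpha> w"
    "\<bar>Re w\<bar> < Im w \<Longrightarrow> Phi_bar \<alpha> k w = PsiU \<alpha> k w"
    "\<bar>Re w\<bar> < - Im w \<Longrightarrow> Phi_bar \<alpha> k w = PsiD \<alpha> k w"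
proof -
  have axis: "Phi_bar \<alpha> k w = F w"
    if w: "Re w = 0" "w \<noteq> 0" and F: "mat_holo F S" and S: "open S" "w \<in> S"
      and eq: "\<And>v. v \<in> S \<Longrightarrow> Re v \<noteq> 0 \<Longrightarrow> Phi_sectors \<alpha> k v = F v" for F S
  proof -
    have "(F \<longlongrightarrow> F w) (at w within {w. Re w \<noteq> 0})" by (rule mat_holo_tendsto[OF F S])
    moreover have "\<forall>\<^sub>F v in at w within {w. Re w \<noteq> 0}. F v = Phi_sectors \<alpha> k v"
      using S eq by (auto simp: eventually_at_topological intro!: exI[of _ S])
    ultimately have lim: "(Phi_sectors \<alpha> k \<longlongrightarrow> F w) (at w within {w. Re w \<noteq> 0})"
      by (rule Lim_transform_eventually)
    \<comment> \<open>\<open>Lim\<close> is a definite description, so it has a determined value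
      only at a limit point of the set approached.\<close>
    have "w islimpt {w. Re w \<noteq> 0}"
    proof (rule islimpt_approachable[THEN iffD2], intro allI impI)
      fix e :: real assume "e > 0"
      thus "\<exists>x'\<in>{w. Re w \<noteq> 0}. x' \<noteq> w \<and> dist x' w < e"
        using w by (intro bexI[of _ "w + of_real (e / 2)"]) (auto simp: dist_norm)
    qed
    hence "\<not> trivial_limit (at w within {w. Re w \<noteq> 0})" by (simp add: trivial_limit_within)
    thus ?thesis unfolding Phi_bar_def using tendsto_Lim[OF _ lim] w by simp
  qed
  note off = Phi_sectors_eq[OF a]
  show "\<bar>Im w\<bar> < Re w \<Longrightarrow> Phi_bar \<alpha> k w = PsiR \<alpha> w" "\<bar>Im w\<bar> < - Re w \<Longrightarrow> Phi_bar \<alpha> k w = PsiL \<alpha> w"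
    using off(1,2) by (auto simp: Phi_bar_def)
  have cont: "continuous_on UNIV (\<lambda>w. \<bar>Re w\<bar>)" "continuous_on UNIV (\<lambda>w. Im w)" "continuous_on UNIV (\<lambda>w. - Im w)"
    by (intro continuous_intros)+
  have opU: "open {w. \<bar>Re w\<bar> < Im w}" and opD: "open {w. \<bar>Re w\<bar> < - Im w}"
    using open_Collect_less[OF cont(1,2)] open_Collect_less[OF cont(1,3)] by auto
  show "Phi_bar \<alpha> k w = PsiU \<alpha> k w" if "\<bar>Re w\<bar> < Im w"
  proof (cases "Re w = 0")
    case True
    show ?thesis
    proof (rule axis[where F = "PsiU \<alpha> k", OF True _ _ opU])
      show "mat_holo (PsiU \<alpha> k) {w. \<bar>Re w\<bar> < Im w}"
        by (rule mat_holo_subset[OF mat_holo_Psi(3)[OF a]]) auto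
    qed (use that off(3) in auto)
  qed (use that off(3) in \<open>auto simp: Phi_bar_def\<close>)
  show "Phi_bar \<alpha> k w = PsiD \<alpha> k w" if "\<bar>Re w\<bar> < - Im w"
  proof (cases "Re w = 0")
    case True
    show ?thesis
    proof (rule axis[where F = "PsiD \<alpha> k", OF True _ _ opD])
      show "mat_holo (PsiD \<alpha> k) {w. \<bar>Re w\<bar> < - Im w}"
        by (rule mat_holo_subset[OF mat_holo_Psi(4)[OF a]]) auto
    qed (use that off(4) in auto)
  qed (use that off(4) in \<open>auto simp: Phi_bar_def\<close>)
qed

section \<open>Behaviour at infinity and at the origin\<close>

lemma norm_entry_le: "norm (A $ i $ j) \<le> norm (A :: complex^2^2)"
  by (rule order_trans[OF Finite_Cartesian_Product.norm_nth_le Finite_Cartesian_Product.norm_nth_le])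

lemma mat2_of_entries: "A = mat2 (A $ 1 $ 1) (A $ 1 $ 2) (A $ 2 $ 1) (A $ 2 $ 2)"
  by (simp add: mat2_eq_iff)

lemma norm_le_entries:
  assumes "\<And>i j. norm ((A :: complex^2^2) $ i $ j) \<le> b"
  shows "norm A \<le> 4 * b"
  using norm_mat2_le[of "A $ 1 $ 1" "A $ 1 $ 2" "A $ 2 $ 1" "A $ 2 $ 2"]
    assms[of 1 1] assms[of 1 2] assms[of 2 1] assms[of 2 2]
  unfolding mat2_of_entries[symmetric] by linarith

text \<open>The factor 8 is 4 for passing from entries to the norm, times 2 for the two products in
  each entry. Only its being a constant matters.\<close>

lemma norm_matrix_mult_le:
  fixes A B :: "complex^2^2"
  shows "norm (A ** B) \<le> 8 * norm A * norm B"
proof -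
  have "norm ((A ** B) $ i $ j) \<le> 2 * norm A * norm B" for i j
  proof -
    have "norm (A $ i $ l * B $ l $ j) \<le> norm A * norm B" for l
      unfolding norm_mult by (intro mult_mono norm_entry_le) auto
    from add_mono[OF this[of 1] this[of 2]]
    have "norm (A $ i $ 1 * B $ 1 $ j) + norm (A $ i $ 2 * B $ 2 $ j) \<le> 2 * norm A * norm B" by simp
    thus ?thesis
      unfolding matrix_matrix_mult_def by (simp add: sum_2) (rule order_trans[OF norm_triangle_ineq])
  qed
  from norm_le_entries[OF this] show ?thesis by simp
qed

lemma exp_sigma3_mult: "exp_sigma3 x ** exp_sigma3 y = exp_sigma3 (x + y)"
  by (simp add: exp_sigma3_def mat2_mult mat2_eq_iff flip: exp_add)

lemma exp_sigma3_0 [simp]: "exp_sigma3 0 = mat 1"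
  by (simp add: exp_sigma3_def mat_eq_mat2)

lemma norm_exp_sigma3_le: "norm (exp_sigma3 x) \<le> 2 * exp (norm x)"
proof -
  have "norm (exp x) \<le> exp (norm x)" "norm (exp (- x)) \<le> exp (norm x)"
    using complex_Re_le_cmod[of x] complex_Re_le_cmod[of "- x"] by auto
  moreover have "norm (exp_sigma3 x) \<le> norm (exp x) + norm (exp (- x))"
    unfolding exp_sigma3_def by (rule order_trans[OF norm_mat2_le]) simp
  ultimately show ?thesis by linarith
qed

text \<open>For x = - i w the conjugated entry is b exp (2 i w), small above the real axis; the
  lower triangular counterpart gives b exp (- 2 i w), small below it.\<close>

lemma upper_exp_sigma3: "mat2 1 b 0 1 ** exp_sigma3 x = exp_sigma3 x ** mat2 1 (b * exp (- 2 * x)) 0 1"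
proof -
  have "exp x * exp (- 2 * x) = exp (- x)" by (simp flip: exp_add)
  thus ?thesis by (simp add: exp_sigma3_def mat2_mult mat2_eq_iff)
qed

lemma lower_exp_sigma3: "mat2 1 0 b 1 ** exp_sigma3 x = exp_sigma3 x ** mat2 1 0 (b * exp (2 * x)) 1"
proof -
  have "exp (- x) * exp (2 * x) = exp x" by (simp flip: exp_add)
  thus ?thesis by (simp add: exp_sigma3_def mat2_mult mat2_eq_iff)
qed

lemma near_identity_mult:
  fixes A B :: "complex^2^2"
  assumes "norm (A - mat 1) \<le> a" "norm (B - mat 1) \<le> b" "a \<ge> 0"
  shows "norm (A ** B - mat 1) \<le> a + b + 8 * a * b"
proof -
  have "A ** B - mat 1 = (A - mat 1) + (B - mat 1) + (A - mat 1) ** (B - mat 1)"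
    by (simp add: vec_eq_iff forall_2 matrix_matrix_mult_def sum_2 mat_def algebra_simps)
  also have "norm \<dots> \<le> norm (A - mat 1) + norm (B - mat 1) + norm ((A - mat 1) ** (B - mat 1))"
    by (rule order_trans[OF norm_triangle_ineq add_right_mono[OF norm_triangle_ineq]])
  also have "\<dots> \<le> a + b + 8 * a * b"
  proof (intro add_mono assms order_trans[OF norm_matrix_mult_le])
    show "8 * norm (A - mat 1) * norm (B - mat 1) \<le> 8 * a * b"
      using assms by (intro mult_mono) auto
  qed
  finally show ?thesis .
qed

lemma exp_minus_le_inverse:
  fixes x :: real
  assumes "x > 0"
  shows "exp (- x) \<le> 1 / x"
proof -
  have "x \<le> exp x" using exp_ge_add_one_self[of x] by linarith
  thus ?thesis using assms by (simp add: exp_minus inverse_eq_divide frac_le)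
qed

text \<open>Between the diagonals |w| \<le> 2 |Im w|, so the conjugated triangular factor differs
  from I by a constant times exp (- |w|) \<le> 1 / |w|. This is the order of the error of
  \<open>PsiR\<close> and \<open>PsiL\<close>, to which \<open>PsiU\<close> and \<open>PsiD\<close>
  reduce according to the sign of Re w.\<close>

lemma Phi_bar_asymptotics:
  assumes a: "\<bar>Re \<alpha>\<bar> < 1 / 2"
  obtains C where "C \<ge> 0"
    "\<And>w. norm w \<ge> 1 + norm \<alpha> \<Longrightarrow> \<bar>Re w\<bar> \<noteq> \<bar>Im w\<bar> \<Longrightarrow>
       norm (Phi_bar \<alpha> k w ** exp_sigma3 (- (\<i> * w)) - mat 1) \<le> C / norm w"
proof -
  obtain C1 where C1: "C1 \<ge> 0"
    "\<And>z. Im z \<ge> 0 \<Longrightarrow> norm z \<ge> 1 + norm \<alpha> \<Longrightarrow> norm (Phi1 \<alpha> (Ln z) ** exp_sigma3 (- z) - mat 1) \<le> C1 / norm z"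
    by (rule Phi1_asymptotics_upper[OF a]; (rule that)?; assumption)
  obtain C2 where C2: "C2 \<ge> 0"
    "\<And>z. Im z < 0 \<Longrightarrow> norm z \<ge> 1 + norm \<alpha> \<Longrightarrow>
       norm (Phi1 \<alpha> (Ln z) ** mat2 1 0 (2 * sin (of_real pi * \<alpha>)) 1 ** exp_sigma3 (- z) - mat 1) \<le> C2 / norm z"
    by (rule Phi1_asymptotics_lower[OF a]; (rule that)?; assumption)
  define C where "C = C1 + C2"
  define M where "M = norm (s1 \<alpha> k) + norm (s3 \<alpha> k)"
  \<comment> \<open>For z = i w one has Im z = Re w. The closed upper half-plane of the Bessel
    variable is therefore Re w \<ge> 0, and the imaginary axis is covered here.\<close>
  have R: "norm (PsiR \<alpha> w ** exp_sigma3 (- (\<i> * w)) - mat 1) \<le> C / norm w"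
    if "Re w \<ge> 0" "norm w \<ge> 1 + norm \<alpha>" for w
  proof -
    have "norm (PsiR \<alpha> w ** exp_sigma3 (- (\<i> * w)) - mat 1) \<le> C1 / norm w"
      using C1(2)[of "\<i> * w"] that by (simp add: PsiR_def norm_mult)
    also have "\<dots> \<le> C / norm w" using C2(1) by (intro divide_right_mono) (auto simp: C_def)
    finally show ?thesis .
  qed
  have L: "norm (PsiL \<alpha> w ** exp_sigma3 (- (\<i> * w)) - mat 1) \<le> C / norm w"
    if "Re w < 0" "norm w \<ge> 1 + norm \<alpha>" for w
  proof -
    have "norm (PsiL \<alpha> w ** exp_sigma3 (- (\<i> * w)) - mat 1) \<le> C2 / norm w"
      using C2(2)[of "\<i> * w"] that by (simp add: PsiL_def norm_mult)
    also have "\<dots> \<le> C / norm w" using C1(1) by (intro divide_right_mono) (auto simp: C_def)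
    finally show ?thesis .
  qed
  define D where "D = C + M + 8 * C * M"
  have C0: "C \<ge> 0" and M0: "M \<ge> 0" using C1(1) C2(1) by (simp_all add: C_def M_def)
  have D: "C / n \<le> D / n" if "n \<ge> 0" for n
    using that C0 M0 by (intro divide_right_mono) (auto simp: D_def)
  have exp_small: "norm (b * exp c) \<le> M / norm w"
    if "norm b \<le> M" "Re c = - 2 * \<bar>Im w\<bar>" "\<bar>Re w\<bar> < \<bar>Im w\<bar>" for b c w
  proof -
    have w: "norm w > 0" using that by auto
    have "norm w \<le> 2 * \<bar>Im w\<bar>" using cmod_le[of w] that by linarith
    hence "exp (- 2 * \<bar>Im w\<bar>) \<le> exp (- norm w)" by simp
    also have "\<dots> \<le> 1 / norm w" by (rule exp_minus_le_inverse[OF w])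
    finally have "norm b * exp (- 2 * \<bar>Im w\<bar>) \<le> M * (1 / norm w)"
      using that M0 by (intro mult_mono) auto
    thus ?thesis using that by (simp add: norm_mult)
  qed
  have tri: "norm (\<Psi> ** T ** exp_sigma3 (- (\<i> * w)) - mat 1) \<le> D / norm w"
    if \<Psi>: "norm (\<Psi> ** exp_sigma3 (- (\<i> * w)) - mat 1) \<le> C / norm w"
      and T: "T ** exp_sigma3 (- (\<i> * w)) = exp_sigma3 (- (\<i> * w)) ** T'"
      and T': "norm (T' - mat 1) \<le> M / norm w" and w: "norm w \<ge> 1 + norm \<alpha>" for \<Psi> T T' w
  proof -
    have w1: "norm w \<ge> 1" using w norm_ge_zero[of \<alpha>] by linarith
    have "\<Psi> ** T ** exp_sigma3 (- (\<i> * w)) = (\<Psi> ** exp_sigma3 (- (\<i> * w))) ** T'"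
      unfolding matrix_mul_assoc[symmetric] T ..
    hence "norm (\<Psi> ** T ** exp_sigma3 (- (\<i> * w)) - mat 1) \<le> C / norm w + M / norm w + 8 * (C / norm w) * (M / norm w)"
      using near_identity_mult[OF \<Psi> T'] C0 by simp
    \<comment> \<open>The product of two terms of order 1 / |w| is of that order again because |w|
      \<ge> 1.\<close>
    also have "8 * (C / norm w) * (M / norm w) \<le> 8 * C * (M / norm w)"
      using w1 C0 M0 by (intro mult_right_mono mult_left_mono) (auto simp: divide_le_eq mult_le_cancel_left1)
    finally show ?thesis by (simp add: D_def add_divide_distrib)
  qed
  have up: "norm (mat2 1 y 0 1 - mat 1) \<le> norm y" and low: "norm (mat2 1 0 y 1 - mat 1) \<le> norm y" for y
    using norm_mat2_le[of 0 y 0 0] norm_mat2_le[of 0 0 y 0] by (simp_all add: mat_eq_mat2 mat2_diff)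
  have Mb: "norm (- s3 \<alpha> k) \<le> M" "norm (s1 \<alpha> k) \<le> M" "norm (- s1 \<alpha> k) \<le> M" "norm (s3 \<alpha> k) \<le> M"
    by (simp_all add: M_def)
  show ?thesis
  proof (rule that[of D])
    show "D \<ge> 0" using C0 M0 by (simp add: D_def)
    fix w assume w: "norm w \<ge> 1 + norm \<alpha>" and ne: "\<bar>Re w\<bar> \<noteq> \<bar>Im w\<bar>"
    have w0: "w \<noteq> 0" using ne by auto
    consider "\<bar>Im w\<bar> < Re w" | "\<bar>Im w\<bar> < - Re w" | "\<bar>Re w\<bar> < Im w" | "\<bar>Re w\<bar> < - Im w"
      using ne by linarith
    thus "norm (Phi_bar \<alpha> k w ** exp_sigma3 (- (\<i> * w)) - mat 1) \<le> D / norm w"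
    proof cases
      case 1
      thus ?thesis using order_trans[OF R[OF _ w] D] by (simp add: Phi_bar_eq(1)[OF a])
    next
      case 2
      thus ?thesis using order_trans[OF L[OF _ w] D] by (simp add: Phi_bar_eq(2)[OF a])
    next
      case 3
      have e: "Re (- 2 * - (\<i> * w)) = - 2 * \<bar>Im w\<bar>" using 3 by simp
      have bound: "\<bar>Re w\<bar> < \<bar>Im w\<bar>" using 3 by simp
      show ?thesis unfolding Phi_bar_eq(3)[OF a 3]
      proof (cases "Re w < 0")
        case True
        show "norm (PsiU \<alpha> k w ** exp_sigma3 (- (\<i> * w)) - mat 1) \<le> D / norm w"
          unfolding PsiU_left[OF a True]
          by (rule tri[OF L[OF True w] upper_exp_sigma3 order_trans[OF up exp_small[OF Mb(2) e bound]] w])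
      next
        case False
        hence nn: "Re w \<ge> 0" by simp
        show "norm (PsiU \<alpha> k w ** exp_sigma3 (- (\<i> * w)) - mat 1) \<le> D / norm w"
          unfolding PsiU_right[OF nn _ w0, of \<alpha> k, simplified]
          by (subst PsiU_right[OF nn _ w0]; (rule tri[OF R[OF nn w] upper_exp_sigma3 order_trans[OF up exp_small[OF Mb(1) e bound]] w])?)
            (use 3 in auto)
      qed
    next
      case 4
      have e: "Re (2 * - (\<i> * w)) = - 2 * \<bar>Im w\<bar>" using 4 by simp
      have bound: "\<bar>Re w\<bar> < \<bar>Im w\<bar>" using 4 by simp
      show ?thesis unfolding Phi_bar_eq(4)[OF a 4]
      proof (cases "Re w < 0")
        case True
        show "norm (PsiD \<alpha> k w ** exp_sigma3 (- (\<i> * w)) - mat 1) \<le> D / norm w"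
          unfolding PsiD_left
          by (rule tri[OF L[OF True w] lower_exp_sigma3 order_trans[OF low exp_small[OF Mb(4) e bound]] w])
      next
        case False
        hence nn: "Re w \<ge> 0" by simp
        show "norm (PsiD \<alpha> k w ** exp_sigma3 (- (\<i> * w)) - mat 1) \<le> D / norm w"
          unfolding PsiD_right
          by (rule tri[OF R[OF nn w] lower_exp_sigma3 order_trans[OF low exp_small[OF Mb(3) e bound]] w])
      qed
    qed
  qed
qed

text \<open>Here |z^\<alpha>| is a power of |z| times exp (- Im \<alpha> Im w). The second factor is
  bounded since the argument stays within 2 pi, a range that contains the logarithms in all four
  branches. The exponent - |Re \<alpha>| gives one bound for \<alpha> and -\<alpha> alike.\<close>

lemma bessel_growth:
  assumes a: "\<bar>Re \<alpha>\<bar> < 1 / 2"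
  obtains K where "K \<ge> 0"
    "\<And>w. Re w \<le> 0 \<Longrightarrow> \<bar>Im w\<bar> \<le> 2 * pi \<Longrightarrow> norm (bessel_p \<alpha> w) \<le> K * exp (- \<bar>Re \<alpha>\<bar> * Re w)"
    "\<And>w. Re w \<le> 0 \<Longrightarrow> \<bar>Im w\<bar> \<le> 2 * pi \<Longrightarrow> norm (bessel_r \<alpha> w) \<le> K * exp (- \<bar>Re \<alpha>\<bar> * Re w)"
proof -
  have "Re (\<alpha> + 1 / 2) > 0" "Re (\<alpha> + 3 / 2) > 0" using a by auto
  obtain B1 where B1: "B1 \<ge> 0" "\<And>y. norm y \<le> 1 \<Longrightarrow> norm (bessel_series (\<alpha> + 1 / 2) y) \<le> B1"
    by (rule bessel_series_bounded[OF \<open>Re (\<alpha> + 1 / 2) > 0\<close>, of 1]) blast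
  obtain B2 where B2: "B2 \<ge> 0" "\<And>y. norm y \<le> 1 \<Longrightarrow> norm (bessel_series (\<alpha> + 3 / 2) y) \<le> B2"
    by (rule bessel_series_bounded[OF \<open>Re (\<alpha> + 3 / 2) > 0\<close>, of 1]) blast
  define c where "c = exp (\<bar>Im \<alpha>\<bar> * (2 * pi))"
  have expb: "norm (exp (\<alpha> * w)) \<le> c * exp (- \<bar>Re \<alpha>\<bar> * Re w)" and y1: "norm (exp (2 * w)) \<le> 1"
    if "Re w \<le> 0" "\<bar>Im w\<bar> \<le> 2 * pi" for w
  proof -
    have "Re \<alpha> * Re w \<le> - \<bar>Re \<alpha>\<bar> * Re w"
      using mult_right_mono_neg[of "- \<bar>Re \<alpha>\<bar>" "Re \<alpha>" "Re w"] that by simp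
    moreover have "- (Im \<alpha> * Im w) \<le> \<bar>Im \<alpha>\<bar> * (2 * pi)"
    proof -
      have "- (Im \<alpha> * Im w) \<le> \<bar>Im \<alpha>\<bar> * \<bar>Im w\<bar>" by (metis abs_ge_minus_self abs_mult)
      also have "\<dots> \<le> \<bar>Im \<alpha>\<bar> * (2 * pi)" using that by (intro mult_left_mono) auto
      finally show ?thesis .
    qed
    ultimately show "norm (exp (\<alpha> * w)) \<le> c * exp (- \<bar>Re \<alpha>\<bar> * Re w)"
      by (simp add: c_def flip: exp_add)
    show "norm (exp (2 * w)) \<le> 1" using that by simp
  qed
  have c: "c > 0" by (simp add: c_def)
  define K where "K = c * B1 + c * B2 / norm (1 + 2 * \<alpha>)"
  have K: "c * B1 \<le> K" "c * B2 / norm (1 + 2 * \<alpha>) \<le> K" "K \<ge> 0"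
    using c B1(1) B2(1) by (simp_all add: K_def)
  show ?thesis
  proof (rule that[OF K(3)])
    fix w :: complex assume w: "Re w \<le> 0" "\<bar>Im w\<bar> \<le> 2 * pi"
    let ?e = "exp (- \<bar>Re \<alpha>\<bar> * Re w)"
    have "norm (bessel_p \<alpha> w) \<le> (c * ?e) * B1"
      unfolding bessel_p_def norm_mult using c by (intro mult_mono expb B1(2) y1 w) auto
    also have "\<dots> = (c * B1) * ?e" by simp
    also have "\<dots> \<le> K * ?e" using K by (intro mult_right_mono) auto
    finally show "norm (bessel_p \<alpha> w) \<le> K * ?e" .
    have "norm (exp ((1 + \<alpha>) * w)) = exp (Re w) * norm (exp (\<alpha> * w))"
      by (simp add: distrib_right exp_add norm_mult)
    also have "\<dots> \<le> 1 * (c * ?e)" using w by (intro mult_mono expb) auto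
    finally have "norm (exp ((1 + \<alpha>) * w)) \<le> c * ?e" by simp
    hence "norm (bessel_r \<alpha> w) \<le> (c * ?e) * B2 / norm (1 + 2 * \<alpha>)"
      unfolding bessel_r_def norm_mult norm_divide using c
      by (intro divide_right_mono mult_mono B2(2) y1 w) auto
    also have "\<dots> = (c * B2 / norm (1 + 2 * \<alpha>)) * ?e" by simp
    also have "\<dots> \<le> K * ?e" using K by (intro mult_right_mono) auto
    finally show "norm (bessel_r \<alpha> w) \<le> K * ?e" .
  qed
qed

lemma Phi1_growth:
  assumes a: "\<bar>Re \<alpha>\<bar> < 1 / 2"
  obtains K where "K \<ge> 0"
    "\<And>w. Re w \<le> 0 \<Longrightarrow> \<bar>Im w\<bar> \<le> 2 * pi \<Longrightarrow> norm (Phi1 \<alpha> w) \<le> K * exp (- \<bar>Re \<alpha>\<bar> * Re w)"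
proof -
  have a': "\<bar>Re (- \<alpha>)\<bar> < 1 / 2" using a by simp
  obtain K1 where K1: "K1 \<ge> 0"
    "\<And>w. Re w \<le> 0 \<Longrightarrow> \<bar>Im w\<bar> \<le> 2 * pi \<Longrightarrow> norm (bessel_p \<alpha> w) \<le> K1 * exp (- \<bar>Re \<alpha>\<bar> * Re w)"
    "\<And>w. Re w \<le> 0 \<Longrightarrow> \<bar>Im w\<bar> \<le> 2 * pi \<Longrightarrow> norm (bessel_r \<alpha> w) \<le> K1 * exp (- \<bar>Re \<alpha>\<bar> * Re w)"
    by (rule bessel_growth[OF a]; (rule that)?; assumption)
  obtain K2 where K2: "K2 \<ge> 0"
    "\<And>w. Re w \<le> 0 \<Longrightarrow> \<bar>Im w\<bar> \<le> 2 * pi \<Longrightarrow> norm (bessel_p (- \<alpha>) w) \<le> K2 * exp (- \<bar>Re (- \<alpha>)\<bar> * Re w)"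
    "\<And>w. Re w \<le> 0 \<Longrightarrow> \<bar>Im w\<bar> \<le> 2 * pi \<Longrightarrow> norm (bessel_r (- \<alpha>) w) \<le> K2 * exp (- \<bar>Re (- \<alpha>)\<bar> * Re w)"
    by (rule bessel_growth[OF a']; (rule that)?; assumption)
  define m where "m = (\<lambda>x y. norm (x / lead \<alpha>) * (2 * K1) + norm (y / lead (- \<alpha>)) * (2 * K2))"
  have col: "norm (colP \<alpha> x y w) \<le> m x y * exp (- \<bar>Re \<alpha>\<bar> * Re w)" "norm (colQ \<alpha> x y w) \<le> m x y * exp (- \<bar>Re \<alpha>\<bar> * Re w)"
    if w: "Re w \<le> 0" "\<bar>Im w\<bar> \<le> 2 * pi" for x y w
  proof -
    define e where "e = exp (- \<bar>Re \<alpha>\<bar> * Re w)"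
    have b: "norm (bessel_p \<alpha> w) \<le> K1 * e" "norm (bessel_r \<alpha> w) \<le> K1 * e"
      "norm (bessel_p (- \<alpha>) w) \<le> K2 * e" "norm (bessel_r (- \<alpha>) w) \<le> K2 * e"
      using K1(2,3)[OF w] K2(2,3)[OF w] by (simp_all add: e_def)
    have gen: "norm (X * A + Y * B) \<le> (norm X * (2 * K1) + norm Y * (2 * K2)) * e"
      if "norm A \<le> K1 * e + K1 * e" "norm B \<le> K2 * e + K2 * e" for X Y A B :: complex
    proof -
      have "norm (X * A + Y * B) \<le> norm X * norm A + norm Y * norm B"
        using norm_triangle_ineq[of "X * A" "Y * B"] by (simp add: norm_mult)
      also have "\<dots> \<le> norm X * (K1 * e + K1 * e) + norm Y * (K2 * e + K2 * e)"
        using that by (intro add_mono mult_left_mono) auto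
      finally show ?thesis by (simp add: algebra_simps)
    qed
    show "norm (colP \<alpha> x y w) \<le> m x y * exp (- \<bar>Re \<alpha>\<bar> * Re w)"
      unfolding colP_def m_def e_def[symmetric]
      by (rule gen; rule order_trans[OF norm_triangle_ineq]; intro add_mono b)
    show "norm (colQ \<alpha> x y w) \<le> m x y * exp (- \<bar>Re \<alpha>\<bar> * Re w)"
      unfolding colQ_def m_def e_def[symmetric]
      by (rule gen; rule order_trans[OF norm_triangle_ineq4]; intro add_mono b)
  qed
  have m0: "m x y \<ge> 0" for x y using K1(1) K2(1) by (simp add: m_def)
  define u where "u = exp (\<i> * of_real pi * \<alpha>)"
  define \<omega> where "\<omega> = exp (\<i> * complex_of_real pi / 4)"
  define c where "c = cos (of_real pi * \<alpha>)"
  define x1 y1 x2 y2 where "x1 = \<omega> / u / c" and "y1 = \<omega> * u / c" and "x2 = \<omega> * \<i> / c" and "y2 = 1 / \<omega> / c"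
  have Phi: "Phi1 \<alpha> w = cols \<alpha> x1 y1 x2 y2 w" for w
    unfolding x1_def y1_def x2_def y2_def u_def \<omega>_def c_def by (rule Phi1_eq_cols[OF a])
  show ?thesis
  proof (rule that[of "m x1 y1 + m x2 y2 + m x1 y1 + m x2 y2"])
    fix w assume w: "Re w \<le> 0" "\<bar>Im w\<bar> \<le> 2 * pi"
    have half: "norm (exp c / 2 * v) \<le> b" if "Re c = 0" "norm v \<le> b" for c v :: complex and b
    proof -
      have "norm (exp c / 2 * v) = norm v / 2" using that by (simp add: norm_mult norm_divide)
      thus ?thesis using half_le[OF that(2)] by (simp only:)
    qed
    have "norm (Phi1 \<alpha> w) \<le> m x1 y1 * exp (- \<bar>Re \<alpha>\<bar> * Re w) + m x2 y2 * exp (- \<bar>Re \<alpha>\<bar> * Re w)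
       + m x1 y1 * exp (- \<bar>Re \<alpha>\<bar> * Re w) + m x2 y2 * exp (- \<bar>Re \<alpha>\<bar> * Re w)"
      unfolding Phi cols_def
      by (rule order_trans[OF norm_mat2_le]; intro add_mono half col w) simp_all
    thus "norm (Phi1 \<alpha> w) \<le> (m x1 y1 + m x2 y2 + m x1 y1 + m x2 y2) * exp (- \<bar>Re \<alpha>\<bar> * Re w)"
      by (simp only: distrib_right)
  qed (use m0 in auto)
qed

lemma Phi_bar_growth:
  assumes a: "\<bar>Re \<alpha>\<bar> < 1 / 2"
  obtains K where "K \<ge> 0"
    "\<And>w. w \<noteq> 0 \<Longrightarrow> norm w \<le> 1 \<Longrightarrow> \<bar>Re w\<bar> \<noteq> \<bar>Im w\<bar> \<Longrightarrow>
       norm (Phi_bar \<alpha> k w) \<le> K * norm w powr (- \<bar>Re \<alpha>\<bar>)"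
proof -
  obtain K where K: "K \<ge> 0"
    "\<And>w. Re w \<le> 0 \<Longrightarrow> \<bar>Im w\<bar> \<le> 2 * pi \<Longrightarrow> norm (Phi1 \<alpha> w) \<le> K * exp (- \<bar>Re \<alpha>\<bar> * Re w)"
    by (rule Phi1_growth[OF a]; (rule that)?; assumption)
  define JL where "JL = mat2 1 0 (2 * sin (of_real pi * \<alpha>)) 1"
  define JU where "JU = mat2 1 (- s3 \<alpha> k) 0 1"
  define JD where "JD = mat2 1 0 (- s1 \<alpha> k) 1"
  define M where "M = 1 + 8 * norm JL + 8 * norm JU + 8 * norm JD"
  have bi: "norm (Phi1 \<alpha> (Ln (\<i> * w))) \<le> K * norm w powr (- \<bar>Re \<alpha>\<bar>)"
    "norm (Phi1 \<alpha> (Ln (- \<i> * w) + \<i> * of_real pi)) \<le> K * norm w powr (- \<bar>Re \<alpha>\<bar>)"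
    if w: "w \<noteq> 0" "norm w \<le> 1" for w
  proof -
    have n: "\<i> * w \<noteq> 0" "- \<i> * w \<noteq> 0" using w by simp_all
    have re: "Re (Ln (\<i> * w)) = ln (norm w)" "Re (Ln (- \<i> * w) + \<i> * of_real pi) = ln (norm w)"
      using Re_Ln[OF n(1)] Re_Ln[OF n(2)] by (simp_all add: norm_mult)
    have im: "\<bar>Im (Ln (\<i> * w))\<bar> \<le> 2 * pi" "\<bar>Im (Ln (- \<i> * w) + \<i> * of_real pi)\<bar> \<le> 2 * pi"
      using mpi_less_Im_Ln[OF n(1)] Im_Ln_le_pi[OF n(1)] mpi_less_Im_Ln[OF n(2)] Im_Ln_le_pi[OF n(2)]
        pi_gt_zero unfolding plus_complex.sel by (simp_all add: abs_le_iff)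
    have neg: "ln (norm w) \<le> 0" using w by simp
    have p: "exp (- \<bar>Re \<alpha>\<bar> * ln (norm w)) = norm w powr (- \<bar>Re \<alpha>\<bar>)" using w by (simp add: powr_def)
    show "norm (Phi1 \<alpha> (Ln (\<i> * w))) \<le> K * norm w powr (- \<bar>Re \<alpha>\<bar>)"
      using K(2)[of "Ln (\<i> * w)"] im(1) neg unfolding re p by blast
    show "norm (Phi1 \<alpha> (Ln (- \<i> * w) + \<i> * of_real pi)) \<le> K * norm w powr (- \<bar>Re \<alpha>\<bar>)"
      using K(2)[of "Ln (- \<i> * w) + \<i> * of_real pi"] im(2) neg unfolding re p by blast
  qed
  have mul: "norm (A ** J) \<le> (K * M) * q" if "norm A \<le> K * q" "8 * norm J \<le> M" "q \<ge> 0"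
    for A J :: "complex^2^2" and q
  proof -
    have "norm (A ** J) \<le> norm A * (8 * norm J)" using norm_matrix_mult_le[of A J] by (simp add: mult_ac)
    also have "\<dots> \<le> (K * q) * M" using that K(1) by (intro mult_mono) auto
    finally show ?thesis by (simp add: mult_ac)
  qed
  have M: "8 * norm JL \<le> M" "8 * norm JU \<le> M" "8 * norm JD \<le> M" "1 \<le> M" by (simp_all add: M_def)
  show ?thesis
  proof (rule that[of "K * M"])
    show "K * M \<ge> 0" using K(1) M(4) by simp
    fix w assume w: "w \<noteq> 0" "norm w \<le> 1" and ne: "\<bar>Re w\<bar> \<noteq> \<bar>Im w\<bar>"
    consider "\<bar>Im w\<bar> < Re w" | "\<bar>Im w\<bar> < - Re w" | "\<bar>Re w\<bar> < Im w" | "\<bar>Re w\<bar> < - Im w"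
      using ne by linarith
    thus "norm (Phi_bar \<alpha> k w) \<le> (K * M) * norm w powr (- \<bar>Re \<alpha>\<bar>)"
    proof cases
      case 1
      have "K * norm w powr (- \<bar>Re \<alpha>\<bar>) \<le> (K * M) * norm w powr (- \<bar>Re \<alpha>\<bar>)"
        using K(1) M(4) by (intro mult_right_mono) (auto simp: mult_le_cancel_left1)
      thus ?thesis unfolding Phi_bar_eq(1)[OF a 1] PsiR_def by (rule order_trans[OF bi(1)[OF w]])
    next
      case 2
      show ?thesis unfolding Phi_bar_eq(2)[OF a 2] PsiL_def JL_def[symmetric]
        by (rule mul[OF bi(1)[OF w] M(1)]) simp
    next
      case 3
      show ?thesis unfolding Phi_bar_eq(3)[OF a 3] PsiU_def JU_def[symmetric]
        by (rule mul[OF bi(2)[OF w] M(2)]) simp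
    next
      case 4
      show ?thesis unfolding Phi_bar_eq(4)[OF a 4] PsiD_def JD_def[symmetric]
        by (rule mul[OF bi(1)[OF w] M(3)]) simp
    qed
  qed
qed

section \<open>The local parametrix\<close>

lemma eta_deriv: "(eta has_field_derivative 1 - 4 * z\<^sup>2) (at z)"
  unfolding eta_eq[abs_def] by (auto intro!: derivative_eq_intros)

lemma eta_holomorphic: "eta holomorphic_on S"
  unfolding eta_eq[abs_def] by (intro holomorphic_intros)

text \<open>The critical point \<open>1/2\<close> of \<open>eta\<close> cannot lie in the disc.\<close>

lemma biholomorphic_eta_radius:
  assumes "biholomorphic_on eta (ball 0 (2 * \<delta>))"
  shows "\<delta> \<le> 1 / 4"
proof (rule ccontr)
  assume "\<not> \<delta> \<le> 1 / 4"
  hence half: "(1 / 2 :: complex) \<in> ball 0 (2 * \<delta>)" by simp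
  obtain g where op: "open (eta ` ball 0 (2 * \<delta>))" and g: "g holomorphic_on (eta ` ball 0 (2 * \<delta>))"
    "\<And>z. z \<in> ball 0 (2 * \<delta>) \<Longrightarrow> g (eta z) = z"
    using assms unfolding biholomorphic_on_def by blast
  have dg: "(g has_field_derivative deriv g (eta (1 / 2))) (at (eta (1 / 2)))"
    by (rule holomorphic_derivI[OF g(1) op]) (use half in blast)
  have "((\<lambda>z. g (eta z)) has_field_derivative deriv g (eta (1 / 2)) * (1 - 4 * (1 / 2)\<^sup>2)) (at (1 / 2))"
    by (rule DERIV_chain2[OF dg eta_deriv])
  hence "((\<lambda>z. g (eta z)) has_field_derivative 0) (at (1 / 2))" by (simp add: power2_eq_square)
  moreover have "((\<lambda>z. g (eta z)) has_field_derivative 1) (at (1 / 2))"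
    by (rule has_field_derivative_transform_within_open[OF DERIV_ident open_ball half]) (use g(2) in auto)
  ultimately show False using DERIV_unique by force
qed

text \<open>Im (eta z) is Im z times 1 - 4 (Re z)^2 + 4/3 (Im z)^2, and the second factor is
  positive for |Re z| < 1/2. This reconciles two case distinctions: that of \<open>T0\<close> by the
  sign of Im z, and that of the parametrix by the argument of eta.\<close>

lemma Im_eta_sign:
  assumes "norm z < 1 / 2"
  shows "0 < Im (eta z) \<longleftrightarrow> 0 < Im z" "Im (eta z) < 0 \<longleftrightarrow> Im z < 0"
proof -
  have "\<bar>Re z\<bar> < 1 / 2" using assms abs_Re_le_cmod[of z] by linarith
  hence "\<bar>Re z\<bar>\<^sup>2 < (1 / 2)\<^sup>2" by (intro power_strict_mono) auto
  hence "(Re z)\<^sup>2 < 1 / 4" by (simp add: power2_eq_square)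
  hence pos: "1 - 4 * (Re z)\<^sup>2 + 4 / 3 * (Im z)\<^sup>2 > 0" using zero_le_power2[of "Im z"] by argo
  have eq: "Im (eta z) = Im z * (1 - 4 * (Re z)\<^sup>2 + 4 / 3 * (Im z)\<^sup>2)"
    by (simp add: eta_eq power2_eq_square power3_eq_cube algebra_simps diff_divide_distrib)
  show "0 < Im (eta z) \<longleftrightarrow> 0 < Im z" "Im (eta z) < 0 \<longleftrightarrow> Im z < 0"
    unfolding eq using pos by (simp_all add: zero_less_mult_iff mult_less_0_iff)
qed

lemma norm_eta_bounds:
  assumes "norm z \<le> 1 / 2"
  shows "norm z / 2 \<le> norm (eta z)" "norm (eta z) \<le> 2 * norm z"
proof -
  have eq: "eta z = z * (1 - 4 / 3 * z\<^sup>2)" by (simp add: eta_eq power2_eq_square power3_eq_cube algebra_simps)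
  have "norm (z\<^sup>2) \<le> (1 / 2)\<^sup>2" unfolding norm_power using assms by (intro power_mono) auto
  hence s: "norm (4 / 3 * z\<^sup>2) \<le> 1 / 3" by (simp add: norm_mult power2_eq_square)
  have "norm (1 :: complex) - norm (4 / 3 * z\<^sup>2) \<le> norm (1 - 4 / 3 * z\<^sup>2)" by (rule norm_triangle_ineq2)
  hence lo: "1 / 2 \<le> norm (1 - 4 / 3 * z\<^sup>2)" using s by simp
  have "norm (1 - 4 / 3 * z\<^sup>2) \<le> norm (1 :: complex) + norm (4 / 3 * z\<^sup>2)" by (rule norm_triangle_ineq4)
  hence hi: "norm (1 - 4 / 3 * z\<^sup>2) \<le> 2" using s by simp
  show "norm z / 2 \<le> norm (eta z)" "norm (eta z) \<le> 2 * norm z"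
    unfolding eq norm_mult using mult_left_mono[OF lo, of "norm z"] mult_left_mono[OF hi, of "norm z"] by simp_all
qed

text \<open>\<open>arg \<eta>\<close> increases along circles about the origin, so every point of a ray is approached from both sides
  within the closed disc.\<close>

lemma eta_ray_closure:
  assumes z: "z \<noteq> 0" "norm z \<le> \<delta>" "\<delta> \<le> 1 / 4" and V: "open V" "eta z \<in> V" and \<sigma>: "\<sigma> = 1 \<or> \<sigma> = - 1"
    and sub: "\<And>y. y \<in> cball 0 \<delta> \<Longrightarrow> eta y \<in> V \<Longrightarrow> 0 < \<sigma> * Im (eta y * cnj (eta z)) \<Longrightarrow> y \<in> A"
  shows "z \<in> closure A"
proof -
  \<comment> \<open>Rotation keeps the modulus of z, so the curve stays in the closed disc even when
    z lies on the circle; \<sigma> chooses its direction. The function \<open>g\<close> is a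
    positive multiple of \<sigma> times the sine of the angle from eta z to eta on the
    curve.\<close>
  define c where "c = (\<lambda>\<tau>::real. z * exp (\<i> * of_real (\<sigma> * \<tau>)))"
  define g where "g = (\<lambda>\<tau>. Im (of_real \<sigma> * eta (c \<tau>) * cnj (eta z)))"
  have c0: "c 0 = z" by (simp add: c_def)
  have dc: "(c has_vector_derivative \<i> * of_real \<sigma> * z) (at 0)"
    unfolding c_def of_real_mult
    by (rule has_vector_derivative_real_field[where f = "\<lambda>s. z * exp (\<i> * (of_real \<sigma> * s))"])
      (auto intro!: derivative_eq_intros)
  have "((eta \<circ> c) has_vector_derivative (\<i> * of_real \<sigma> * z) * (1 - 4 * z\<^sup>2)) (at 0)"
    by (rule field_vector_diff_chain_at[OF dc]) (simp add: c0 eta_deriv)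
  hence "((\<lambda>\<tau>. of_real \<sigma> * eta (c \<tau>) * cnj (eta z)) has_vector_derivative of_real \<sigma> * ((\<i> * of_real \<sigma> * z) * (1 - 4 * z\<^sup>2)) * cnj (eta z)) (at 0)"
    by (intro has_vector_derivative_mult_left has_vector_derivative_mult_right) (simp add: o_def)
  hence "(g has_vector_derivative Im (of_real \<sigma> * ((\<i> * of_real \<sigma> * z) * (1 - 4 * z\<^sup>2)) * cnj (eta z))) (at 0)"
    unfolding g_def by (rule bounded_linear.has_vector_derivative[OF bounded_linear_Im])
  hence dg: "(g has_real_derivative Im (of_real \<sigma> * ((\<i> * of_real \<sigma> * z) * (1 - 4 * z\<^sup>2)) * cnj (eta z))) (at 0)"
    by (simp add: has_real_derivative_iff_has_vector_derivative)
  have "Im (of_real \<sigma> * ((\<i> * of_real \<sigma> * z) * (1 - 4 * z\<^sup>2)) * cnj (eta z)) > 0"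
  proof -
    define y where "y = z\<^sup>2"
    have e: "eta z = z * (1 - 4 / 3 * y)" by (simp add: eta_eq y_def power2_eq_square power3_eq_cube algebra_simps)
    have \<sigma>\<sigma>: "complex_of_real \<sigma> * of_real \<sigma> = 1" using \<sigma> by auto
    have "of_real \<sigma> * ((\<i> * of_real \<sigma> * z) * (1 - 4 * z\<^sup>2)) * cnj (eta z)
        = (complex_of_real \<sigma> * of_real \<sigma>) * (\<i> * ((z * cnj z) * ((1 - 4 * y) * cnj (1 - 4 / 3 * y))))"
      unfolding e y_def[symmetric] by (simp only: complex_cnj_mult mult_ac)
    also have "\<dots> = \<i> * (of_real ((norm z)\<^sup>2) * ((1 - 4 * y) * cnj (1 - 4 / 3 * y)))"
      unfolding \<sigma>\<sigma> complex_norm_square by simp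
    finally have "Im (of_real \<sigma> * ((\<i> * of_real \<sigma> * z) * (1 - 4 * z\<^sup>2)) * cnj (eta z)) =
        Im (\<i> * (of_real ((norm z)\<^sup>2) * ((1 - 4 * y) * cnj (1 - 4 / 3 * y))))" by (rule arg_cong)
    also have "\<dots> = (norm z)\<^sup>2 * Re ((1 - 4 * y) * cnj (1 - 4 / 3 * y))" by simp
    also have "Re ((1 - 4 * y) * cnj (1 - 4 / 3 * y)) = 1 - 16 / 3 * Re y + 16 / 3 * ((Re y)\<^sup>2 + (Im y)\<^sup>2)"
      by (simp add: power2_eq_square algebra_simps add_divide_distrib diff_divide_distrib)
    finally have eq: "Im (of_real \<sigma> * ((\<i> * of_real \<sigma> * z) * (1 - 4 * z\<^sup>2)) * cnj (eta z)) =
        (norm z)\<^sup>2 * (1 - 16 / 3 * Re y + 16 / 3 * ((Re y)\<^sup>2 + (Im y)\<^sup>2))" .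
    \<comment> \<open>Here the radius enters: |y| \<le> 1/16 keeps 1 - 16/3 Re y positive.\<close>
    have "norm z \<le> 1 / 4" using z by linarith
    hence "norm y \<le> (1 / 4)\<^sup>2" unfolding y_def norm_power by (intro power_mono) auto
    hence "Re y \<le> 1 / 16" using complex_Re_le_cmod[of y] by (simp add: power2_eq_square)
    hence "1 - 16 / 3 * Re y + 16 / 3 * ((Re y)\<^sup>2 + (Im y)\<^sup>2) > 0"
      using zero_le_power2[of "Re y"] zero_le_power2[of "Im y"] by argo
    thus ?thesis unfolding eq using z by simp
  qed
  from DERIV_pos_inc_right[OF dg this] obtain d where d: "d > 0" "\<And>h. 0 < h \<Longrightarrow> h < d \<Longrightarrow> g 0 < g h" by auto
  have g0: "g 0 = 0"
  proof -
    have "of_real \<sigma> * eta (c 0) * cnj (eta z) = of_real (\<sigma> * (norm (eta z))\<^sup>2)"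
      by (simp add: c0 mult.assoc flip: complex_norm_square)
    thus ?thesis unfolding g_def by (simp only: Im_complex_of_real)
  qed
  have cc: "isCont c 0" unfolding c_def by (intro continuous_intros)
  have ce: "isCont (\<lambda>\<tau>. eta (c \<tau>)) 0"
    by (rule isCont_o2[OF cc]) (simp add: DERIV_isCont[OF eta_deriv])
  have "\<forall>\<^sub>F \<tau> in at_right 0. eta (c \<tau>) \<in> V"
  proof (rule topological_tendstoD[OF _ V(1)])
    show "((\<lambda>\<tau>. eta (c \<tau>)) \<longlongrightarrow> eta z) (at_right 0)"
      using ce unfolding isCont_def c0 by (rule tendsto_within_subset) simp
  qed (rule V(2))
  moreover have "\<forall>\<^sub>F \<tau> in at_right 0. 0 < g \<tau>"
    using d g0 by (auto simp: eventually_at_right_field intro!: exI[of _ d])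
  ultimately have ev: "\<forall>\<^sub>F \<tau> in at_right 0. c \<tau> \<in> A"
  proof eventually_elim
    case (elim \<tau>)
    show ?case
    proof (rule sub[OF _ elim(1)])
      show "c \<tau> \<in> cball 0 \<delta>" using z by (simp add: c_def norm_mult)
      show "0 < \<sigma> * Im (eta (c \<tau>) * cnj (eta z))" using elim(2) by (simp add: g_def mult.assoc)
    qed
  qed
  have "(c \<longlongrightarrow> z) (at_right 0)"
    using cc unfolding isCont_def c0 by (rule tendsto_within_subset) simp
  show ?thesis
    by (rule Lim_in_closed_set[OF closed_closure _ _ \<open>(c \<longlongrightarrow> z) (at_right 0)\<close>])
      (use ev closure_subset in \<open>auto elim!: eventually_mono\<close>)
qed

text \<open>The continuation of \<open>E\<close> across the real axis. \<open>Ln (z - 1 / 2)\<close>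
  in \<open>N\<close> is replaced by \<open>Ln (1 / 2 - z)\<close>, which is analytic for |z| < 1/2.
  The two logarithms differ by i pi above the axis and by - i pi below it, and the constant factors
  in \<open>E\<close> compensate exactly this.\<close>

definition Eext :: "complex \<Rightarrow> complex \<Rightarrow> complex^2^2" where
  "Eext \<nu> z = exp_sigma3 (\<nu> * (Ln (1 / 2 + z) - Ln (1 / 2 - z)))"

lemma half_disc_slit:
  fixes z :: complex
  assumes "norm z < 1 / 2"
  shows "1 / 2 + z \<notin> \<real>\<^sub>\<le>\<^sub>0" "1 / 2 - z \<notin> \<real>\<^sub>\<le>\<^sub>0"
  using assms complex_Re_le_cmod[of z] complex_Re_le_cmod[of "- z"]
  by (auto simp: complex_nonpos_Reals_iff)

lemma mat_holo_Eext: "mat_holo (Eext \<nu>) (ball 0 (1 / 2))"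
  unfolding Eext_def[abs_def] using half_disc_slit
  by (intro mat_holo_exp_sigma3 holomorphic_intros) auto

lemma E_N_eq_Eext:
  assumes z: "norm z < 1 / 2"
  shows "Im z > 0 \<Longrightarrow> N \<alpha> k z ** exp_sigma3 (\<i> * of_real pi * nu \<alpha> k) = Eext (nu \<alpha> k) z"
    "Im z < 0 \<Longrightarrow> N \<alpha> k z ** exp_sigma3 (- \<i> * of_real pi * nu \<alpha> k) = Eext (nu \<alpha> k) z"
proof -
  have nz: "1 / 2 - z \<noteq> 0"
  proof
    assume "1 / 2 - z = 0"
    thus False using half_disc_slit(2)[OF z] by (simp only:) simp
  qed
  have m: "z - 1 / 2 = - (1 / 2 - z)" by simp
  {
    assume im: "Im z > 0"
    have eq: "Ln (z - 1 / 2) = Ln (1 / 2 - z) + \<i> * of_real pi"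
      unfolding m using Ln_minus[OF nz] im by simp
    show "N \<alpha> k z ** exp_sigma3 (\<i> * of_real pi * nu \<alpha> k) = Eext (nu \<alpha> k) z"
      unfolding N_def Eext_def exp_sigma3_mult eq by (simp add: algebra_simps)
  next
    assume im: "Im z < 0"
    have eq: "Ln (z - 1 / 2) = Ln (1 / 2 - z) - \<i> * of_real pi"
      unfolding m using Ln_minus[OF nz] im by simp
    show "N \<alpha> k z ** exp_sigma3 (- \<i> * of_real pi * nu \<alpha> k) = Eext (nu \<alpha> k) z"
      unfolding N_def Eext_def exp_sigma3_mult eq by (simp add: algebra_simps)
  }
qed

text \<open>The form of \<open>T0\<close> on a single sector, with an analytic branch in place of
  \<open>Phi_bar\<close> and the constant that belongs to the half-plane. Unlike \<open>T0\<close>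
  it makes sense beyond the sector, so boundary values of \<open>T0\<close> are values of
  \<open>Tpiece\<close>.\<close>

definition Tpiece :: "complex \<Rightarrow> complex \<Rightarrow> real \<Rightarrow> (complex \<Rightarrow> complex^2^2) \<Rightarrow> complex \<Rightarrow> complex \<Rightarrow> complex^2^2" where
  "Tpiece \<alpha> k t \<Psi> c z = Eext (nu \<alpha> k) z ** \<Psi> (of_real t * eta z) **
     exp_sigma3 (- \<i> * of_real t * eta z) ** exp_sigma3 c"

lemma T0_eq_Tpiece:
  assumes z: "norm z < 1 / 2"
  shows "0 < Im (eta z) \<Longrightarrow> T0 \<alpha> k t z = Tpiece \<alpha> k t (Phi_bar \<alpha> k) (- \<i> * of_real pi * nu \<alpha> k) z"
    "Im (eta z) < 0 \<Longrightarrow> T0 \<alpha> k t z = Tpiece \<alpha> k t (Phi_bar \<alpha> k) (\<i> * of_real pi * nu \<alpha> k) z"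
  using Im_eta_sign[OF z] E_N_eq_Eext[OF z] by (simp_all add: T0_def E_def Tpiece_def)

lemma T0_sectors:
  fixes \<alpha> k z :: complex and t :: real
  assumes a: "\<bar>Re \<alpha>\<bar> < 1 / 2" and z: "norm z < 1 / 2" and t: "t > 0"
  defines "w \<equiv> eta z" and "c \<equiv> \<i> * of_real pi * nu \<alpha> k"
  shows "0 < Im w \<Longrightarrow> Im w < Re w \<Longrightarrow> T0 \<alpha> k t z = Tpiece \<alpha> k t (PsiR \<alpha>) (- c) z"
    "0 < Im w \<Longrightarrow> Im w < - Re w \<Longrightarrow> T0 \<alpha> k t z = Tpiece \<alpha> k t (PsiL \<alpha>) (- c) z"
    "\<bar>Re w\<bar> < Im w \<Longrightarrow> T0 \<alpha> k t z = Tpiece \<alpha> k t (PsiU \<alpha> k) (- c) z"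
    "Im w < 0 \<Longrightarrow> - Im w < Re w \<Longrightarrow> T0 \<alpha> k t z = Tpiece \<alpha> k t (PsiR \<alpha>) c z"
    "Im w < 0 \<Longrightarrow> Re w < Im w \<Longrightarrow> T0 \<alpha> k t z = Tpiece \<alpha> k t (PsiL \<alpha>) c z"
    "\<bar>Re w\<bar> < - Im w \<Longrightarrow> T0 \<alpha> k t z = Tpiece \<alpha> k t (PsiD \<alpha> k) c z"
proof -
  have scale: "Re (of_real t * w) = t * Re w" "Im (of_real t * w) = t * Im w" by simp_all
  have cmp: "t * x < t * y \<longleftrightarrow> x < y" "\<bar>t * x\<bar> = t * \<bar>x\<bar>" "- (t * x) = t * (- x)" for x y
    using t by (simp_all add: abs_mult)
  note bar = Phi_bar_eq[OF a, of "of_real t * w" k, unfolded scale cmp]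
  note T = T0_eq_Tpiece[OF z, of \<alpha> k t, folded w_def]
  have c: "- \<i> * of_real pi * nu \<alpha> k = - c" by (simp add: c_def)
  show "0 < Im w \<Longrightarrow> Im w < Re w \<Longrightarrow> T0 \<alpha> k t z = Tpiece \<alpha> k t (PsiR \<alpha>) (- c) z"
    "0 < Im w \<Longrightarrow> Im w < - Re w \<Longrightarrow> T0 \<alpha> k t z = Tpiece \<alpha> k t (PsiL \<alpha>) (- c) z"
    "\<bar>Re w\<bar> < Im w \<Longrightarrow> T0 \<alpha> k t z = Tpiece \<alpha> k t (PsiU \<alpha> k) (- c) z"
    using T(1) bar(1,2,3) unfolding c Tpiece_def w_def by auto
  show "Im w < 0 \<Longrightarrow> - Im w < Re w \<Longrightarrow> T0 \<alpha> k t z = Tpiece \<alpha> k t (PsiR \<alpha>) c z"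
    "Im w < 0 \<Longrightarrow> Re w < Im w \<Longrightarrow> T0 \<alpha> k t z = Tpiece \<alpha> k t (PsiL \<alpha>) c z"
    "\<bar>Re w\<bar> < - Im w \<Longrightarrow> T0 \<alpha> k t z = Tpiece \<alpha> k t (PsiD \<alpha> k) c z"
    using T(2) bar(1,2,4) unfolding c_def Tpiece_def w_def by auto
qed

lemma mat_holo_Tpiece:
  assumes \<Psi>: "mat_holo \<Psi> D" and S: "S \<subseteq> ball 0 (1 / 2)" "\<And>z. z \<in> S \<Longrightarrow> of_real t * eta z \<in> D"
  shows "mat_holo (Tpiece \<alpha> k t \<Psi> c) S"
proof -
  have f: "(\<lambda>z. of_real t * eta z) holomorphic_on S" by (intro holomorphic_intros eta_holomorphic)
  have "mat_holo (\<lambda>z. \<Psi> (of_real t * eta z)) S"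
    unfolding mat_holo_def
  proof (intro allI)
    fix i j
    have h: "(\<lambda>w. \<Psi> w $ i $ j) holomorphic_on D" using \<Psi> by (simp add: mat_holo_def)
    have "((\<lambda>w. \<Psi> w $ i $ j) \<circ> (\<lambda>z. of_real t * eta z)) holomorphic_on S"
      by (rule holomorphic_on_compose_gen[OF f h]) (use S(2) in auto)
    thus "(\<lambda>z. \<Psi> (of_real t * eta z) $ i $ j) holomorphic_on S" by (simp add: o_def)
  qed
  thus ?thesis
    unfolding Tpiece_def[abs_def]
    by (intro mat_holo_mult mat_holo_const mat_holo_exp_sigma3 mat_holo_subset[OF mat_holo_Eext S(1)]
        holomorphic_intros eta_holomorphic)
qed

lemma open_eta_vimage:
  assumes "open D"
  shows "open {z \<in> ball 0 (1 / 2). of_real t * eta z \<in> D}"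
proof -
  have "continuous_on (ball 0 (1 / 2)) (\<lambda>z. of_real t * eta z)"
    by (intro holomorphic_on_imp_continuous_on holomorphic_intros eta_holomorphic)
  from continuous_open_preimage[OF this open_ball assms] show ?thesis
    by (simp add: vimage_def Int_def)
qed

lemma norm_matrix_mult_mono:
  fixes A B :: "complex^2^2"
  assumes "norm A \<le> x" "norm B \<le> y"
  shows "norm (A ** B) \<le> 8 * x * y"
proof -
  have "norm A * norm B \<le> x * y"
    using assms order_trans[OF norm_ge_zero assms(1)] by (intro mult_mono) auto
  thus ?thesis using norm_matrix_mult_le[of A B] by linarith
qed

section \<open>Sectors and rays in terms of real and imaginary parts\<close>

lemma Arg_sector_iff:
  "pi / 4 < Arg w \<and> Arg w < 3 * pi / 4 \<longleftrightarrow> \<bar>Re w\<bar> < Im w"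
  "- (3 * pi / 4) < Arg w \<and> Arg w < - (pi / 4) \<longleftrightarrow> \<bar>Re w\<bar> < - Im w"
  "0 < Arg w \<and> Arg w < pi / 4 \<longleftrightarrow> 0 < Im w \<and> Im w < Re w"
  "- (pi / 4) < Arg w \<and> Arg w < 0 \<longleftrightarrow> Im w < 0 \<and> - Im w < Re w"
  "3 * pi / 4 < Arg w \<and> Arg w < pi \<longleftrightarrow> 0 < Im w \<and> Im w < - Re w"
  "- pi < Arg w \<and> Arg w < - (3 * pi / 4) \<longleftrightarrow> Im w < 0 \<and> Re w < Im w"
proof -
  have pi0: "pi > 0" by simp
  have all: "(pi / 4 < Arg w \<and> Arg w < 3 * pi / 4 \<longleftrightarrow> \<bar>Re w\<bar> < Im w) \<and>
    (- (3 * pi / 4) < Arg w \<and> Arg w < - (pi / 4) \<longleftrightarrow> \<bar>Re w\<bar> < - Im w) \<and>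
    (0 < Arg w \<and> Arg w < pi / 4 \<longleftrightarrow> 0 < Im w \<and> Im w < Re w) \<and>
    (- (pi / 4) < Arg w \<and> Arg w < 0 \<longleftrightarrow> Im w < 0 \<and> - Im w < Re w) \<and>
    (3 * pi / 4 < Arg w \<and> Arg w < pi \<longleftrightarrow> 0 < Im w \<and> Im w < - Re w) \<and>
    (- pi < Arg w \<and> Arg w < - (3 * pi / 4) \<longleftrightarrow> Im w < 0 \<and> Re w < Im w)"
  proof (cases "w = 0")
    case True
    \<comment> \<open>At w = 0 both sides are false in every line, since Arg 0 = 0 lies in none of
      these open intervals.\<close>
    thus ?thesis using pi0 by (simp add: Arg_zero)
  next
    case False
    note h = Arg_half_planes[OF False]
    have b: "- pi < Arg w" "Arg w \<le> pi" by (rule mpi_less_Arg, rule Arg_le_pi)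
    have ab: "\<bar>Re w\<bar> < y \<longleftrightarrow> Re w < y \<and> - y < Re w" for y by arith
    have sw: "Im w < - Re w \<longleftrightarrow> Re w < - Im w" "- (- Im w) < Re w \<longleftrightarrow> Im w < Re w" by arith+
    show ?thesis
      unfolding ab sw h(1-4,7,8) using b pi0 by (intro conjI iffI; linarith)
  qed
  thus "pi / 4 < Arg w \<and> Arg w < 3 * pi / 4 \<longleftrightarrow> \<bar>Re w\<bar> < Im w"
    "- (3 * pi / 4) < Arg w \<and> Arg w < - (pi / 4) \<longleftrightarrow> \<bar>Re w\<bar> < - Im w"
    "0 < Arg w \<and> Arg w < pi / 4 \<longleftrightarrow> 0 < Im w \<and> Im w < Re w"
    "- (pi / 4) < Arg w \<and> Arg w < 0 \<longleftrightarrow> Im w < 0 \<and> - Im w < Re w"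
    "3 * pi / 4 < Arg w \<and> Arg w < pi \<longleftrightarrow> 0 < Im w \<and> Im w < - Re w"
    "- pi < Arg w \<and> Arg w < - (3 * pi / 4) \<longleftrightarrow> Im w < 0 \<and> Re w < Im w"
    by blast+
qed

lemma Arg_ray:
  assumes "w \<noteq> 0"
  shows "Arg w = 0 \<Longrightarrow> Im w = 0 \<and> 0 < Re w" "Arg w = pi \<Longrightarrow> Im w = 0 \<and> Re w < 0"
    "Arg w = pi / 4 \<Longrightarrow> Re w = Im w \<and> 0 < Im w" "Arg w = 3 * pi / 4 \<Longrightarrow> Re w = - Im w \<and> 0 < Im w"
    "Arg w = - (pi / 4) \<Longrightarrow> Re w = - Im w \<and> Im w < 0" "Arg w = - (3 * pi / 4) \<Longrightarrow> Re w = Im w \<and> Im w < 0"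
proof -
  note h = Arg_half_planes[OF assms]
  have pi0: "pi > 0" by simp
  {
    assume e: "Arg w = 0"
    have "\<not> 0 < Im w" "\<not> Im w < 0" "0 < Re w" unfolding h e using pi0 by simp_all
    thus "Im w = 0 \<and> 0 < Re w" by linarith
  next
    assume e: "Arg w = pi"
    have "\<not> 0 < Im w" "\<not> Im w < 0" "Re w < 0" unfolding h e using pi0 by simp_all
    thus "Im w = 0 \<and> Re w < 0" by linarith
  next
    assume e: "Arg w = pi / 4"
    have "\<not> Re w < Im w" "\<not> Im w < Re w" "0 < Im w" unfolding h e using pi0 by simp_all
    thus "Re w = Im w \<and> 0 < Im w" by linarith
  next
    assume e: "Arg w = 3 * pi / 4"
    have "\<not> Re w < - Im w" "\<not> - Im w < Re w" "0 < Im w" unfolding h e using pi0 by simp_all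
    thus "Re w = - Im w \<and> 0 < Im w" by linarith
  next
    assume e: "Arg w = - (pi / 4)"
    have "\<not> Re w < - Im w" "\<not> - Im w < Re w" "Im w < 0" unfolding h e using pi0 by simp_all
    thus "Re w = - Im w \<and> Im w < 0" by linarith
  next
    assume e: "Arg w = - (3 * pi / 4)"
    have "\<not> Re w < Im w" "\<not> Im w < Re w" "Im w < 0" unfolding h e using pi0 by simp_all
    thus "Re w = Im w \<and> Im w < 0" by linarith
  }
qed

lemma off_rays:
  assumes w: "w \<noteq> 0" and off: "Arg w \<notin> {0, pi, pi / 4, - (pi / 4), 3 * pi / 4, - (3 * pi / 4)}"
  shows "Im w \<noteq> 0" "\<bar>Re w\<bar> \<noteq> \<bar>Im w\<bar>"
proof -
  note h = Arg_half_planes[OF w]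
  have b: "- pi < Arg w" "Arg w \<le> pi" by (rule mpi_less_Arg, rule Arg_le_pi)
  have off': "Arg w \<noteq> 0" "Arg w \<noteq> pi" "Arg w \<noteq> pi / 4" "Arg w \<noteq> - (pi / 4)" "Arg w \<noteq> 3 * pi / 4" "Arg w \<noteq> - (3 * pi / 4)"
    using off by auto
  have "0 < Im w \<or> Im w < 0" unfolding h using off' b by linarith
  thus "Im w \<noteq> 0" by linarith
  have "Re w < Im w \<or> Im w < Re w" unfolding h using off' b by linarith
  moreover have "Re w < - Im w \<or> - Im w < Re w" unfolding h using off' b by linarith
  ultimately show "\<bar>Re w\<bar> \<noteq> \<bar>Im w\<bar>" by linarith
qed

lemma off_Sigma3:
  assumes "z \<in> cball 0 \<delta> - Sigma3 \<delta>" "\<delta> > 0" "\<delta> \<le> 1 / 4"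
  shows "z \<noteq> 0" "norm z \<le> \<delta>" "norm z < 1 / 2" "eta z \<noteq> 0" "Im (eta z) \<noteq> 0" "\<bar>Re (eta z)\<bar> \<noteq> \<bar>Im (eta z)\<bar>"
proof -
  have z: "norm z \<le> \<delta>" "norm z < 2 * \<delta>" using assms by auto
  hence *: "eta z \<noteq> 0" "Arg (eta z) \<notin> {0, pi, pi / 4, - (pi / 4), 3 * pi / 4, - (3 * pi / 4)}"
    using assms(1) unfolding Sigma3_def by (simp_all add: dist_norm)
  show "norm z \<le> \<delta>" "norm z < 1 / 2" "eta z \<noteq> 0" "Im (eta z) \<noteq> 0" "\<bar>Re (eta z)\<bar> \<noteq> \<bar>Im (eta z)\<bar>"
    using z assms(3) * off_rays[OF *] by simp_all
  show "z \<noteq> 0" using * by (auto simp: eta_eq)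
qed

section \<open>Analyticity off the contour and boundary values\<close>

lemma open_sectors:
  "open {w. 0 < Im w \<and> Im w < Re w}" "open {w. 0 < Im w \<and> Im w < - Re w}" "open {w. \<bar>Re w\<bar> < Im w}"
  "open {w. Im w < 0 \<and> - Im w < Re w}" "open {w. Im w < 0 \<and> Re w < Im w}" "open {w. \<bar>Re w\<bar> < - Im w}"
  by (intro open_Collect_conj open_Collect_less continuous_intros)+

lemma T0_analytic_at:
  assumes D: "open D" and \<Psi>: "mat_holo \<Psi> D'" and sub: "\<And>w. w \<in> D \<Longrightarrow> of_real t * w \<in> D'"
    and eq: "\<And>y. norm y < 1 / 2 \<Longrightarrow> eta y \<in> D \<Longrightarrow> T0 \<alpha> k t y = Tpiece \<alpha> k t \<Psi> c y"
    and z: "norm z < 1 / 2" "eta z \<in> D"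
  shows "(\<lambda>z. T0 \<alpha> k t z $ i $ j) analytic_on {z}"
proof -
  \<comment> \<open>This open set reaches beyond the closed disc of radius \<delta> \<le> 1/4, so
    points of the circle are interior and analyticity there is obtained as well.\<close>
  define S where "S = {y \<in> ball 0 (1 / 2). eta y \<in> D}"
  have S: "open S" using open_eta_vimage[OF D, of 1] by (simp add: S_def)
  have "mat_holo (Tpiece \<alpha> k t \<Psi> c) S"
    by (rule mat_holo_Tpiece[OF \<Psi>]) (use sub in \<open>auto simp: S_def\<close>)
  hence "mat_holo (T0 \<alpha> k t) S"
    by (rule mat_holo_cong) (use eq in \<open>auto simp: S_def\<close>)
  thus ?thesis unfolding analytic_at mat_holo_def
    using S z by (intro exI[of _ S]) (auto simp: S_def)
qed

lemma T0_analytic: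
  assumes a: "\<bar>Re \<alpha>\<bar> < 1 / 2" and \<delta>: "\<delta> > 0" "\<delta> \<le> 1 / 4" and t: "t > 0"
  shows "(\<lambda>z. T0 \<alpha> k t z $ i $ j) analytic_on (cball 0 \<delta> - Sigma3 \<delta>)"
proof (subst analytic_on_analytic_at, intro ballI)
  fix z assume "z \<in> cball 0 \<delta> - Sigma3 \<delta>"
  note z = off_Sigma3[OF this \<delta>]
  have sgn: "0 < t * x \<longleftrightarrow> 0 < x" "t * x < 0 \<longleftrightarrow> x < 0" for x
    using t by (simp_all add: zero_less_mult_iff mult_less_0_iff)
  note holo = mat_holo_Psi[OF a] and at = T0_analytic_at and T = T0_sectors[OF a _ t]
  consider "0 < Im (eta z) \<and> Im (eta z) < Re (eta z)" | "0 < Im (eta z) \<and> Im (eta z) < - Re (eta z)"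
    | "\<bar>Re (eta z)\<bar> < Im (eta z)" | "Im (eta z) < 0 \<and> - Im (eta z) < Re (eta z)"
    | "Im (eta z) < 0 \<and> Re (eta z) < Im (eta z)" | "\<bar>Re (eta z)\<bar> < - Im (eta z)"
    using z(5,6) by linarith
  thus "(\<lambda>z. T0 \<alpha> k t z $ i $ j) analytic_on {z}"
  proof cases
    case 1
    show ?thesis by (rule at[OF open_sectors(1) holo(1) _ T(1)]) (use 1 z sgn in auto)
  next
    case 2
    show ?thesis by (rule at[OF open_sectors(2) holo(2) _ T(2)]) (use 2 z sgn in auto)
  next
    case 3
    show ?thesis by (rule at[OF open_sectors(3) holo(3) _ T(3)]) (use 3 z sgn in auto)
  next
    case 4
    show ?thesis by (rule at[OF open_sectors(4) holo(1) _ T(4)]) (use 4 z sgn in auto)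
  next
    case 5
    show ?thesis by (rule at[OF open_sectors(5) holo(2) _ T(5)]) (use 5 z sgn in auto)
  next
    case 6
    show ?thesis by (rule at[OF open_sectors(6) holo(4) _ T(6)]) (use 6 z sgn in auto)
  qed
qed

text \<open>The branch is holomorphic at the boundary point itself, so the limit from the sector is
  plain evaluation.\<close>

lemma Tpiece_tendsto:
  assumes \<Psi>: "mat_holo \<Psi> D" "open D" and z: "norm z < 1 / 2" "of_real t * eta z \<in> D"
    and eq: "\<And>y. y \<in> A \<Longrightarrow> T0 \<alpha> k t y = Tpiece \<alpha> k t \<Psi> c y"
  shows "(T0 \<alpha> k t \<longlongrightarrow> Tpiece \<alpha> k t \<Psi> c z) (at z within A)"
proof -
  have "(Tpiece \<alpha> k t \<Psi> c \<longlongrightarrow> Tpiece \<alpha> k t \<Psi> c z) (at z within A)"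
    by (rule mat_holo_tendsto[OF mat_holo_Tpiece[OF \<Psi>(1)] open_eta_vimage[OF \<Psi>(2), of t]]) (use z in auto)
  moreover have "\<forall>\<^sub>F y in at z within A. Tpiece \<alpha> k t \<Psi> c y = T0 \<alpha> k t y"
    using eq by (simp add: eventually_at_filter)
  ultimately show ?thesis by (rule Lim_transform_eventually)
qed

text \<open>Moving the jump of the branches past the exponentials multiplies its entry by exp (2 i t
  eta) and by exp (- 2 c). For c = - i pi nu the latter is 1 / (1 - s1 s3), the origin of the
  denominators in the jump matrices.\<close>

lemma Tpiece_upper:
  assumes "\<Psi>' (of_real t * eta z) = \<Psi> (of_real t * eta z) ** mat2 1 b 0 1"
  shows "Tpiece \<alpha> k t \<Psi>' c z = Tpiece \<alpha> k t \<Psi> c z ** mat2 1 (b * exp (- 2 * (- \<i> * of_real t * eta z + c))) 0 1"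
proof -
  let ?x = "- \<i> * of_real t * eta z + c"
  have "Tpiece \<alpha> k t \<Psi>' c z = Eext (nu \<alpha> k) z ** \<Psi> (of_real t * eta z) ** (mat2 1 b 0 1 ** exp_sigma3 ?x)"
    unfolding Tpiece_def assms exp_sigma3_mult[symmetric] by (simp only: matrix_mul_assoc)
  also have "\<dots> = Eext (nu \<alpha> k) z ** \<Psi> (of_real t * eta z) ** (exp_sigma3 ?x ** mat2 1 (b * exp (- 2 * (- \<i> * of_real t * eta z + c))) 0 1)"
    by (simp only: upper_exp_sigma3)
  also have "\<dots> = Tpiece \<alpha> k t \<Psi> c z ** mat2 1 (b * exp (- 2 * (- \<i> * of_real t * eta z + c))) 0 1"
    unfolding Tpiece_def exp_sigma3_mult[symmetric] by (simp only: matrix_mul_assoc)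
  finally show ?thesis .
qed

lemma Tpiece_lower:
  assumes "\<Psi>' (of_real t * eta z) = \<Psi> (of_real t * eta z) ** mat2 1 0 b 1"
  shows "Tpiece \<alpha> k t \<Psi>' c z = Tpiece \<alpha> k t \<Psi> c z ** mat2 1 0 (b * exp (2 * (- \<i> * of_real t * eta z + c))) 1"
proof -
  let ?x = "- \<i> * of_real t * eta z + c"
  have "Tpiece \<alpha> k t \<Psi>' c z = Eext (nu \<alpha> k) z ** \<Psi> (of_real t * eta z) ** (mat2 1 0 b 1 ** exp_sigma3 ?x)"
    unfolding Tpiece_def assms exp_sigma3_mult[symmetric] by (simp only: matrix_mul_assoc)
  also have "\<dots> = Eext (nu \<alpha> k) z ** \<Psi> (of_real t * eta z) ** (exp_sigma3 ?x ** mat2 1 0 (b * exp (2 * (- \<i> * of_real t * eta z + c))) 1)"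
    by (simp only: lower_exp_sigma3)
  also have "\<dots> = Tpiece \<alpha> k t \<Psi> c z ** mat2 1 0 (b * exp (2 * (- \<i> * of_real t * eta z + c))) 1"
    unfolding Tpiece_def exp_sigma3_mult[symmetric] by (simp only: matrix_mul_assoc)
  finally show ?thesis .
qed

text \<open>On the real axis the same branch lies on both sides. The two pieces differ only in the
  final constant factor, and the quotient of these factors is the whole jump.\<close>

lemma Tpiece_diagonal:
  "Tpiece \<alpha> k t \<Psi> (- c) z = Tpiece \<alpha> k t \<Psi> c z ** mat2 (exp (- 2 * c)) 0 0 (1 / exp (- 2 * c))"
proof -
  have "mat2 (exp (- 2 * c)) 0 0 (1 / exp (- 2 * c)) = exp_sigma3 (- 2 * c)"
    by (simp add: exp_sigma3_def exp_minus inverse_eq_divide)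
  thus ?thesis unfolding Tpiece_def matrix_mul_assoc[symmetric] by (simp add: exp_sigma3_mult)
qed

section \<open>Matching on the circle and growth at the origin\<close>

lemma Eext_bounded:
  assumes "\<delta> \<le> 1 / 4"
  obtains G where "G > 0" "\<And>z::complex. norm z \<le> \<delta> \<Longrightarrow> norm (Eext \<nu> z) \<le> G"
    "\<And>z::complex. norm z \<le> \<delta> \<Longrightarrow> \<exists>B. norm B \<le> G \<and> B ** Eext \<nu> z = mat 1"
proof -
  define g where "g = (\<lambda>z. \<nu> * (Ln (1 / 2 + z) - Ln (1 / 2 - z)))"
  have "g holomorphic_on cball 0 \<delta>"
    unfolding g_def using half_disc_slit assms by (intro holomorphic_intros) auto
  hence "bounded (g ` cball 0 \<delta>)"
    by (intro compact_imp_bounded compact_continuous_image holomorphic_on_imp_continuous_on) auto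
  then obtain b where b': "\<forall>x\<in>g ` cball 0 \<delta>. norm x \<le> b"
    unfolding bounded_iff ..
  have b: "norm (g z) \<le> b" if "norm z \<le> \<delta>" for z
    using that by (intro bspec[OF b'] imageI) simp
  have le: "norm (exp_sigma3 x) \<le> 2 * exp b" if "norm x \<le> b" for x
    by (rule order_trans[OF norm_exp_sigma3_le]) (use that in simp)
  show ?thesis
  proof (rule that[of "2 * exp b"])
    fix z :: complex assume z: "norm z \<le> \<delta>"
    show "norm (Eext \<nu> z) \<le> 2 * exp b" using le[OF b[OF z]] by (simp add: Eext_def g_def)
    have "exp_sigma3 (- g z) ** Eext \<nu> z = mat 1" by (simp add: Eext_def g_def exp_sigma3_mult)
    moreover have "norm (exp_sigma3 (- g z)) \<le> 2 * exp b" using le[of "- g z"] b[OF z] by simp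
    ultimately show "\<exists>B. norm B \<le> 2 * exp b \<and> B ** Eext \<nu> z = mat 1" by blast
  qed simp
qed

text \<open>\<open>N\<close> equals \<open>Eext\<close> times exp (- c sigma3) with the constant c
  that also occurs in \<open>T0\<close>. The constants cancel, and what remains is the normalised
  parametrix conjugated by \<open>Eext\<close>. Its inverse \<open>B\<close> is kept as a variable
  so that a bound for it can be supplied separately.\<close>

lemma T0_Tpiece_N:
  assumes z: "norm z < 1 / 2" and im: "Im (eta z) \<noteq> 0" and B: "B ** Eext (nu \<alpha> k) z = mat 1"
  shows "T0 \<alpha> k t z ** matrix_inv (N \<alpha> k z) =
    Eext (nu \<alpha> k) z ** (Phi_bar \<alpha> k (of_real t * eta z) ** exp_sigma3 (- (\<i> * (of_real t * eta z)))) ** B"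
proof -
  define n where "n = nu \<alpha> k * (Ln (z + 1 / 2) - Ln (z - 1 / 2))"
  have N: "N \<alpha> k z = exp_sigma3 n" by (simp add: N_def n_def)
  \<comment> \<open>\<open>matrix_inv\<close> is defined by choice; uniqueness of the two-sided
    inverse determines it.\<close>
  have inv: "matrix_inv (N \<alpha> k z) = exp_sigma3 (- n)"
    unfolding N matrix_inv_def
  proof (rule some_equality)
    fix M assume M: "exp_sigma3 n ** M = mat 1 \<and> M ** exp_sigma3 n = mat 1"
    have "M = M ** (exp_sigma3 n ** exp_sigma3 (- n))" by (simp add: exp_sigma3_mult)
    also have "\<dots> = exp_sigma3 (- n)" by (simp only: matrix_mul_assoc M matrix_mul_lid)
    finally show "M = exp_sigma3 (- n)" .
  qed (simp add: exp_sigma3_mult)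
  obtain c where c: "T0 \<alpha> k t z = Tpiece \<alpha> k t (Phi_bar \<alpha> k) (- c) z" "Eext (nu \<alpha> k) z = exp_sigma3 (n + c)"
  proof (cases "Im (eta z) > 0")
    case True
    show ?thesis
      by (rule that[of "\<i> * of_real pi * nu \<alpha> k"])
        (use True T0_eq_Tpiece(1)[OF z] E_N_eq_Eext(1)[OF z, of \<alpha> k] Im_eta_sign(1)[OF z] in
          \<open>simp_all add: N exp_sigma3_mult\<close>)
  next
    case False
    hence "Im (eta z) < 0" using im by simp
    thus ?thesis
      by (intro that[of "- \<i> * of_real pi * nu \<alpha> k"])
        (use T0_eq_Tpiece(2)[OF z] E_N_eq_Eext(2)[OF z, of \<alpha> k] Im_eta_sign(2)[OF z] in
          \<open>simp_all add: N exp_sigma3_mult\<close>)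
  qed
  have "exp_sigma3 (- c) ** exp_sigma3 (- n) = (B ** Eext (nu \<alpha> k) z) ** (exp_sigma3 (- c) ** exp_sigma3 (- n))"
    by (simp add: B)
  also have "\<dots> = B" by (simp add: c(2) exp_sigma3_mult flip: matrix_mul_assoc)
  finally have "exp_sigma3 (- c) ** exp_sigma3 (- n) = B" .
  moreover have "- \<i> * of_real t * eta z = - (\<i> * (of_real t * eta z))" by simp
  ultimately show ?thesis unfolding c(1) inv Tpiece_def by (simp only: matrix_mul_assoc[symmetric])
qed

lemma T0_N_asymptotics:
  assumes a: "\<bar>Re \<alpha>\<bar> < 1 / 2" and \<delta>: "\<delta> > 0" "\<delta> \<le> 1 / 4"
  shows "\<exists>C. \<forall>\<^sub>F t in at_top. \<forall>z \<in> sphere 0 \<delta> - Sigma3 \<delta>.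
    norm (T0 \<alpha> k t z ** matrix_inv (N \<alpha> k z) - mat 1) \<le> C / t"
proof -
  obtain C where C: "C \<ge> 0"
    "\<And>w. norm w \<ge> 1 + norm \<alpha> \<Longrightarrow> \<bar>Re w\<bar> \<noteq> \<bar>Im w\<bar> \<Longrightarrow>
       norm (Phi_bar \<alpha> k w ** exp_sigma3 (- (\<i> * w)) - mat 1) \<le> C / norm w"
    by (rule Phi_bar_asymptotics[OF a, of k]; (rule that)?; assumption)
  obtain G where G: "G > 0" "\<And>z. norm z \<le> \<delta> \<Longrightarrow> norm (Eext (nu \<alpha> k) z) \<le> G"
    "\<And>z. norm z \<le> \<delta> \<Longrightarrow> \<exists>B. norm B \<le> G \<and> B ** Eext (nu \<alpha> k) z = mat 1"
    by (rule Eext_bounded[OF \<delta>(2), of "nu \<alpha> k"]; (rule that)?; assumption)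
  show ?thesis
  \<comment> \<open>The factor 64 comes from two matrix products, G G from \<open>Eext\<close> and
    its inverse, and 2 / \<delta> from |t eta z| \<ge> t \<delta> / 2 on the circle. The threshold
    on t puts t eta z into the range of \<open>Phi_bar_asymptotics\<close>.\<close>
  proof (rule exI[of _ "64 * G * G * (C * 2 / \<delta>)"], rule eventually_mono[OF eventually_ge_at_top], intro ballI)
    fix t z assume t: "t \<ge> 2 * (1 + norm \<alpha>) / \<delta>" and "z \<in> sphere 0 \<delta> - Sigma3 \<delta>"
    hence nz: "norm z = \<delta>" and "z \<in> cball 0 \<delta> - Sigma3 \<delta>" by auto
    note z = off_Sigma3[OF this(2) \<delta>]
    have t0: "t > 0"
    proof (rule less_le_trans[OF _ t])
      show "0 < 2 * (1 + norm \<alpha>) / \<delta>" using \<delta>(1) by (simp add: add_pos_nonneg)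
    qed
    define w where "w = of_real t * eta z"
    have "t * (\<delta> / 2) \<le> t * norm (eta z)" using norm_eta_bounds(1)[of z] z(3) nz t0 by (intro mult_left_mono) auto
    hence w: "t * \<delta> / 2 \<le> norm w" using t0 by (simp add: w_def norm_mult)
    have "1 + norm \<alpha> \<le> t * \<delta> / 2" using t \<delta>(1) by (simp add: field_simps)
    hence w1: "1 + norm \<alpha> \<le> norm w" using w by linarith
    have tp: "0 < t * \<delta> / 2" using t0 \<delta>(1) by simp
    hence wp: "0 < norm w" using w by linarith
    have off: "\<bar>Re w\<bar> \<noteq> \<bar>Im w\<bar>" using z(6) t0 by (simp add: w_def abs_mult)
    define X where "X = Phi_bar \<alpha> k w ** exp_sigma3 (- (\<i> * w))"
    have "norm (X - mat 1) \<le> C / norm w" unfolding X_def by (rule C(2)[OF w1 off])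
    also have "\<dots> \<le> C / (t * \<delta> / 2)" by (rule divide_left_mono[OF w C(1) mult_pos_pos[OF wp tp]])
    finally have X: "norm (X - mat 1) \<le> C * 2 / \<delta> / t" by (simp add: mult.commute)
    obtain B where B: "norm B \<le> G" "B ** Eext (nu \<alpha> k) z = mat 1" using G(3)[OF z(2)] by blast
    have BE: "Eext (nu \<alpha> k) z ** B = mat 1" using B(2) matrix_left_right_inverse by blast
    \<comment> \<open>Writing I as the product of \<open>Eext\<close> and \<open>B\<close> exposes
      the deviation X - I between bounded factors.\<close>
    have "T0 \<alpha> k t z ** matrix_inv (N \<alpha> k z) - mat 1 = Eext (nu \<alpha> k) z ** X ** B - Eext (nu \<alpha> k) z ** B"
      unfolding BE T0_Tpiece_N[OF z(3,5) B(2)] X_def w_def ..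
    also have "\<dots> = Eext (nu \<alpha> k) z ** (X - mat 1) ** B"
      by (simp add: vec_eq_iff forall_2 matrix_matrix_mult_def sum_2 mat_def algebra_simps)
    finally have "norm (T0 \<alpha> k t z ** matrix_inv (N \<alpha> k z) - mat 1) = norm (Eext (nu \<alpha> k) z ** (X - mat 1) ** B)"
      by (rule arg_cong)
    also have "\<dots> \<le> 8 * (8 * G * (C * 2 / \<delta> / t)) * G"
      by (intro norm_matrix_mult_mono G(2)[OF z(2)] X B(1))
    finally show "norm (T0 \<alpha> k t z ** matrix_inv (N \<alpha> k z) - mat 1) \<le> 64 * G * G * (C * 2 / \<delta>) / t"
      by (simp add: mult_ac)
  qed
qed

lemma T0_growth:
  assumes a: "\<bar>Re \<alpha>\<bar> < 1 / 2" and \<delta>: "\<delta> > 0" "\<delta> \<le> 1 / 4" and t: "t > 0"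
  shows "(\<lambda>z. norm (T0 \<alpha> k t z $ i $ j)) \<in> O[at 0 within (cball 0 \<delta> - Sigma3 \<delta>)](\<lambda>z. norm z powr (- \<bar>Re \<alpha>\<bar>))"
proof -
  obtain K where K: "K \<ge> 0"
    "\<And>w. w \<noteq> 0 \<Longrightarrow> norm w \<le> 1 \<Longrightarrow> \<bar>Re w\<bar> \<noteq> \<bar>Im w\<bar> \<Longrightarrow>
       norm (Phi_bar \<alpha> k w) \<le> K * norm w powr (- \<bar>Re \<alpha>\<bar>)"
    by (rule Phi_bar_growth[OF a, of k]; (rule that)?; assumption)
  obtain G where G: "G > 0" "\<And>z. norm z \<le> \<delta> \<Longrightarrow> norm (Eext (nu \<alpha> k) z) \<le> G"
    by (rule Eext_bounded[OF \<delta>(2), of "nu \<alpha> k"]; (rule that)?; assumption)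
  define c where "c = \<i> * of_real pi * nu \<alpha> k"
  define H where "H = 2 * exp (norm c)"
  have H: "norm (exp_sigma3 c) \<le> H" "norm (exp_sigma3 (- c)) \<le> H" "H > 0"
    using norm_exp_sigma3_le[of c] norm_exp_sigma3_le[of "- c"] by (simp_all add: H_def)
  define M where "M = 8 * (8 * (8 * G * (K * (t / 2) powr (- \<bar>Re \<alpha>\<bar>))) * (2 * exp 1)) * H"
  \<comment> \<open>As |eta z| \<le> 2 |z|, the condition |z| < 1 / (2 t) brings t eta z into the
    unit disc, where \<open>Phi_bar_growth\<close> applies. The exponent - |Re \<alpha>| is at most
    0, so the power is estimated through the lower bound |t eta z| \<ge> t |z| / 2.\<close>
  have bound: "norm (T0 \<alpha> k t z $ i $ j) \<le> M * norm z powr (- \<bar>Re \<alpha>\<bar>)"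
    if z': "z \<in> cball 0 \<delta> - Sigma3 \<delta>" and small: "norm z < 1 / (2 * t)" for z
  proof -
    note z = off_Sigma3[OF z' \<delta>]
    define w where "w = of_real t * eta z"
    have w0: "w \<noteq> 0" using z(4) t by (simp add: w_def)
    have "norm w \<le> t * (2 * norm z)"
      unfolding w_def norm_mult using norm_eta_bounds(2)[of z] z(3) t by (simp add: mult_left_mono)
    also have "\<dots> \<le> 1" using small t by (simp add: field_simps)
    finally have w1: "norm w \<le> 1" .
    have off: "\<bar>Re w\<bar> \<noteq> \<bar>Im w\<bar>" using z(6) t by (simp add: w_def abs_mult)
    have "t * (norm z / 2) \<le> norm w"
      unfolding w_def norm_mult using norm_eta_bounds(1)[of z] z(3) t by (simp add: mult_left_mono)
    hence low: "t / 2 * norm z \<le> norm w" by simp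
    have "norm (Phi_bar \<alpha> k w) \<le> K * norm w powr (- \<bar>Re \<alpha>\<bar>)" by (rule K(2)[OF w0 w1 off])
    also have "\<dots> \<le> K * (t / 2 * norm z) powr (- \<bar>Re \<alpha>\<bar>)"
      using low t z(1) K(1) by (intro mult_left_mono powr_mono2') auto
    also have "\<dots> = K * (t / 2) powr (- \<bar>Re \<alpha>\<bar>) * norm z powr (- \<bar>Re \<alpha>\<bar>)"
      using t by (subst powr_mult) auto
    finally have P: "norm (Phi_bar \<alpha> k w) \<le> K * (t / 2) powr (- \<bar>Re \<alpha>\<bar>) * norm z powr (- \<bar>Re \<alpha>\<bar>)" .
    have e: "norm (exp_sigma3 (- \<i> * of_real t * eta z)) \<le> 2 * exp 1"
    proof (rule order_trans[OF norm_exp_sigma3_le])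
      have "norm (- \<i> * of_real t * eta z) = norm w" by (simp add: w_def norm_mult)
      thus "2 * exp (norm (- \<i> * of_real t * eta z)) \<le> 2 * exp 1" using w1 by simp
    qed
    obtain c' where T: "T0 \<alpha> k t z = Tpiece \<alpha> k t (Phi_bar \<alpha> k) c' z" and c': "norm (exp_sigma3 c') \<le> H"
    proof (cases "Im (eta z) > 0")
      case True
      show ?thesis by (rule that[of "- c"]) (use True T0_eq_Tpiece(1)[OF z(3)] H in \<open>simp_all add: c_def\<close>)
    next
      case False
      hence "Im (eta z) < 0" using z(5) by simp
      thus ?thesis by (intro that[of c]) (use T0_eq_Tpiece(2)[OF z(3)] H in \<open>simp_all add: c_def\<close>)
    qed
    have "norm (T0 \<alpha> k t z $ i $ j) \<le> norm (T0 \<alpha> k t z)" by (rule norm_entry_le)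
    also have "\<dots> \<le> 8 * (8 * (8 * G * (K * (t / 2) powr (- \<bar>Re \<alpha>\<bar>) * norm z powr (- \<bar>Re \<alpha>\<bar>))) * (2 * exp 1)) * H"
      unfolding T Tpiece_def w_def[symmetric] by (intro norm_matrix_mult_mono G(2)[OF z(2)] P e c')
    also have "\<dots> = M * norm z powr (- \<bar>Re \<alpha>\<bar>)" by (simp add: M_def mult_ac)
    finally show ?thesis .
  qed
  show ?thesis
  proof (rule bigoI[of _ M])
    show "\<forall>\<^sub>F z in at 0 within cball 0 \<delta> - Sigma3 \<delta>. norm (norm (T0 \<alpha> k t z $ i $ j)) \<le> M * norm (norm z powr (- \<bar>Re \<alpha>\<bar>))"
      unfolding eventually_at using bound t by (intro exI[of _ "1 / (2 * t)"]) (auto simp: dist_norm)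
  qed
qed

text \<open>In the real regime |k| < cos (pi \<alpha>) gives q > 0. In the imaginary regime cos (pi
  \<alpha>) is a hyperbolic cosine and - k^2 \<ge> 0, so q is a positive square plus a square.
  Positivity turns the real logarithm in \<open>nu\<close> into exp (- 2 pi i nu) = q, the source of
  every q in the jumps.\<close>

lemma q_facts:
  fixes \<alpha> k :: complex
  assumes parameters:
    "(\<alpha> \<in> \<real> \<and> - (1 / 2) < Re \<alpha> \<and> Re \<alpha> < 1 / 2 \<and>
      k \<in> \<real> \<and> - cos (pi * Re \<alpha>) < Re k \<and> Re k < cos (pi * Re \<alpha>)) \<or>
     (Re \<alpha> = 0 \<and> Re k = 0)"
  defines "q \<equiv> 1 - s1 \<alpha> k * s3 \<alpha> k"
  shows "q = (cos (of_real pi * \<alpha>))\<^sup>2 - k\<^sup>2" "q \<in> \<real>" "Re q > 0"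
    "exp (- 2 * (\<i> * of_real pi * nu \<alpha> k)) = q"
proof -
  have "s1 \<alpha> k * s3 \<alpha> k = (sin (of_real pi * \<alpha>))\<^sup>2 + k\<^sup>2"
    by (simp add: s1_def s3_def power2_eq_square algebra_simps)
  thus q: "q = (cos (of_real pi * \<alpha>))\<^sup>2 - k\<^sup>2"
    unfolding q_def cos_squared_eq by simp
  have ex: "\<exists>r>0. q = of_real r"
  proof (rule disjE[OF parameters])
    assume *: "\<alpha> \<in> \<real> \<and> - (1 / 2) < Re \<alpha> \<and> Re \<alpha> < 1 / 2 \<and>
      k \<in> \<real> \<and> - cos (pi * Re \<alpha>) < Re k \<and> Re k < cos (pi * Re \<alpha>)"
    hence r: "\<alpha> = of_real (Re \<alpha>)" "k = of_real (Re k)" by simp_all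
    have "cos (of_real pi * \<alpha>) = of_real (cos (pi * Re \<alpha>))"
      by (subst r(1)) (simp flip: of_real_mult cos_of_real)
    hence "q = of_real ((cos (pi * Re \<alpha>))\<^sup>2 - (Re k)\<^sup>2)"
      unfolding q by (subst r(2)) simp
    moreover have "(Re k)\<^sup>2 < (cos (pi * Re \<alpha>))\<^sup>2"
    proof -
      have "\<bar>Re k\<bar>\<^sup>2 < (cos (pi * Re \<alpha>))\<^sup>2" using * by (intro power_strict_mono) auto
      thus ?thesis by simp
    qed
    ultimately show ?thesis by (intro exI[of _ "(cos (pi * Re \<alpha>))\<^sup>2 - (Re k)\<^sup>2"]) simp
  next
    assume *: "Re \<alpha> = 0 \<and> Re k = 0"
    obtain b \<kappa> where r: "\<alpha> = \<i> * of_real b" "k = \<i> * of_real \<kappa>"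
    proof
      show "\<alpha> = \<i> * of_real (Im \<alpha>)" "k = \<i> * of_real (Im k)" using * by (simp_all add: complex_eq_iff)
    qed
    define C where "C = (exp (- (pi * b)) + exp (pi * b)) / 2"
    have e: "\<i> * (of_real pi * \<alpha>) = of_real (- (pi * b))"
      unfolding r(1) by (simp add: complex_eq_iff)
    have "cos (of_real pi * \<alpha>) = of_real C"
      unfolding cos_exp_eq e of_real_minus[symmetric] exp_of_real minus_minus C_def by simp
    moreover have "k\<^sup>2 = - of_real (\<kappa>\<^sup>2)" unfolding r(2) by (simp add: power_mult_distrib)
    ultimately have "q = of_real (C\<^sup>2 + \<kappa>\<^sup>2)" unfolding q by simp
    moreover have "C > 0" by (simp add: C_def add_pos_pos)
    ultimately show ?thesis by (intro exI[of _ "C\<^sup>2 + \<kappa>\<^sup>2"]) (simp add: add_pos_nonneg)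
  qed
  then obtain r where r: "r > 0" "q = of_real r" by blast
  show "q \<in> \<real>" "Re q > 0" using r by simp_all
  have "- 2 * (\<i> * of_real pi * nu \<alpha> k) = of_real (ln r)"
    unfolding nu_def q_def[symmetric] r(2) by simp
  thus "exp (- 2 * (\<i> * of_real pi * nu \<alpha> k)) = q"
    using r by (simp add: exp_of_real)
qed

text \<open>The branches on both sides of a ray are holomorphic beyond it, so each jump is a
  relation at z itself: on the diagonal rays between \<open>PsiU\<close> or \<open>PsiD\<close> and
  the adjacent lateral branch, on the real axis between the two constant factors.\<close>

lemma T0_jumps:
  fixes \<alpha> k z :: complex and \<delta> t :: real
  assumes parameters:
    "(\<alpha> \<in> \<real> \<and> - (1 / 2) < Re \<alpha> \<and> Re \<alpha> < 1 / 2 \<and>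
      k \<in> \<real> \<and> - cos (pi * Re \<alpha>) < Re k \<and> Re k < cos (pi * Re \<alpha>)) \<or>
     (Re \<alpha> = 0 \<and> Re k = 0)"
    and \<delta>: "\<delta> > 0" "\<delta> \<le> 1 / 4" and t: "t > 0" and z: "norm z \<le> \<delta>" "z \<noteq> 0"
  defines "q \<equiv> 1 - s1 \<alpha> k * s3 \<alpha> k"
    and "U \<equiv> eta_sector \<delta> (pi / 4) (3 * pi / 4)"
    and "L \<equiv> eta_sector \<delta> (- (3 * pi / 4)) (- (pi / 4))"
    and "Rp \<equiv> eta_sector \<delta> 0 (pi / 4)"
    and "Rm \<equiv> eta_sector \<delta> (- (pi / 4)) 0"
    and "Lp \<equiv> eta_sector \<delta> (3 * pi / 4) pi"
    and "Lm \<equiv> eta_sector \<delta> (- pi) (- (3 * pi / 4))"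
  shows "(Arg (eta z) = 0 \<longrightarrow> jump_at (T0 \<alpha> k t) Rp Rm (mat2 q 0 0 (1 / q)) z) \<and>
        (Arg (eta z) = pi \<longrightarrow> jump_at (T0 \<alpha> k t) Lp Lm (mat2 q 0 0 (1 / q)) z) \<and>
        (Arg (eta z) = pi / 4 \<longrightarrow>
           jump_at (T0 \<alpha> k t) U Rp
             (mat2 1 (- (s3 \<alpha> k * exp (- 2 * of_real t * theta z) / q)) 0 1) z) \<and>
        (Arg (eta z) = 3 * pi / 4 \<longrightarrow>
           jump_at (T0 \<alpha> k t) U Lp
             (mat2 1 (s1 \<alpha> k * exp (- 2 * of_real t * theta z) / q) 0 1) z) \<and>
        (Arg (eta z) = - (pi / 4) \<longrightarrow>
           jump_at (T0 \<alpha> k t) L Rm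
             (mat2 1 0 (- (s1 \<alpha> k * exp (2 * of_real t * theta z) / q)) 1) z) \<and>
        (Arg (eta z) = - (3 * pi / 4) \<longrightarrow>
           jump_at (T0 \<alpha> k t) L Lm
             (mat2 1 0 (s3 \<alpha> k * exp (2 * of_real t * theta z) / q) 1) z)"
proof -
  have a: "\<bar>Re \<alpha>\<bar> < 1 / 2" using parameters by auto
  note q = q_facts(4)[OF parameters, folded q_def]
  define c where "c = \<i> * of_real pi * nu \<alpha> k"
  define w where "w = eta z"
  have z12: "norm z < 1 / 2" using z \<delta> by linarith
  have w0: "w \<noteq> 0" using norm_eta_bounds(1)[of z] z z12 by (auto simp: w_def)
  have eq: "exp (- 2 * c) = q" using q by (simp add: c_def)
  have e2c: "exp (2 * c) = 1 / q"
  proof -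
    have "exp (- 2 * c) * exp (2 * c) = 1" by (simp flip: exp_add)
    thus ?thesis unfolding eq by (metis nonzero_eq_divide_eq mult.commute mult_zero_left zero_neq_one)
  qed
  have eU: "exp (- 2 * (- \<i> * of_real t * eta z + - c)) = exp (- 2 * of_real t * theta z) / q"
  proof -
    have e: "- 2 * (- \<i> * of_real t * eta z + - c) = - 2 * of_real t * theta z + 2 * c"
      by (simp add: eta_def algebra_simps)
    show ?thesis unfolding e exp_add e2c by simp
  qed
  have eL: "exp (2 * (- \<i> * of_real t * eta z + c)) = exp (2 * of_real t * theta z) / q"
  proof -
    have e: "2 * (- \<i> * of_real t * eta z + c) = 2 * of_real t * theta z + 2 * c"
      by (simp add: eta_def algebra_simps)
    show ?thesis unfolding e exp_add e2c by simp
  qed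
  note S = eta_sector_def Arg_sector_iff
  have sets: "U = {y \<in> cball 0 \<delta>. \<bar>Re (eta y)\<bar> < Im (eta y)}" "L = {y \<in> cball 0 \<delta>. \<bar>Re (eta y)\<bar> < - Im (eta y)}"
    "Rp = {y \<in> cball 0 \<delta>. 0 < Im (eta y) \<and> Im (eta y) < Re (eta y)}"
    "Rm = {y \<in> cball 0 \<delta>. Im (eta y) < 0 \<and> - Im (eta y) < Re (eta y)}"
    "Lp = {y \<in> cball 0 \<delta>. 0 < Im (eta y) \<and> Im (eta y) < - Re (eta y)}"
    "Lm = {y \<in> cball 0 \<delta>. Im (eta y) < 0 \<and> Re (eta y) < Im (eta y)}"
    unfolding U_def L_def Rp_def Rm_def Lp_def Lm_def S by (rule refl)+
  have small: "norm y < 1 / 2" if "y \<in> cball 0 \<delta>" for y :: complex using that \<delta> by simp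
  note T = T0_sectors[OF a small t, where k = k, folded c_def]
  have onU: "T0 \<alpha> k t y = Tpiece \<alpha> k t (PsiU \<alpha> k) (- c) y" if "y \<in> U" for y using that T(3)[of y] by (simp add: sets)
  have onL: "T0 \<alpha> k t y = Tpiece \<alpha> k t (PsiD \<alpha> k) c y" if "y \<in> L" for y using that T(6)[of y] by (simp add: sets)
  have onRp: "T0 \<alpha> k t y = Tpiece \<alpha> k t (PsiR \<alpha>) (- c) y" if "y \<in> Rp" for y using that T(1)[of y] by (simp add: sets)
  have onRm: "T0 \<alpha> k t y = Tpiece \<alpha> k t (PsiR \<alpha>) c y" if "y \<in> Rm" for y using that T(4)[of y] by (simp add: sets)
  have onLp: "T0 \<alpha> k t y = Tpiece \<alpha> k t (PsiL \<alpha>) (- c) y" if "y \<in> Lp" for y using that T(2)[of y] by (simp add: sets)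
  have onLm: "T0 \<alpha> k t y = Tpiece \<alpha> k t (PsiL \<alpha>) c y" if "y \<in> Lm" for y using that T(5)[of y] by (simp add: sets)
  have half: "open {w. 0 < Re w}" "open {w. Re w < 0}" "open {w. 0 < Im w}" "open {w. Im w < 0}"
    by (intro open_Collect_less continuous_intros)+
  note lim = Tpiece_tendsto[OF _ _ z12]
  have sgn: "0 < t * x \<longleftrightarrow> 0 < x" "t * x < 0 \<longleftrightarrow> x < 0" for x
    using t by (simp_all add: zero_less_mult_iff mult_less_0_iff)
  have limU: "(T0 \<alpha> k t \<longlongrightarrow> Tpiece \<alpha> k t (PsiU \<alpha> k) (- c) z) (at z within U)" if "0 < Im w"
    by (rule lim[OF mat_holo_Psi(3)[OF a] half(3) _ onU]) (use that sgn in \<open>simp_all add: w_def\<close>)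
  have limL: "(T0 \<alpha> k t \<longlongrightarrow> Tpiece \<alpha> k t (PsiD \<alpha> k) c z) (at z within L)" if "Im w < 0"
    by (rule lim[OF mat_holo_Psi(4)[OF a] half(4) _ onL]) (use that sgn in \<open>simp_all add: w_def\<close>)
  have limRp: "(T0 \<alpha> k t \<longlongrightarrow> Tpiece \<alpha> k t (PsiR \<alpha>) (- c) z) (at z within Rp)" if "0 < Re w"
    by (rule lim[OF mat_holo_Psi(1)[OF a] half(1) _ onRp]) (use that sgn in \<open>simp_all add: w_def\<close>)
  have limRm: "(T0 \<alpha> k t \<longlongrightarrow> Tpiece \<alpha> k t (PsiR \<alpha>) c z) (at z within Rm)" if "0 < Re w"
    by (rule lim[OF mat_holo_Psi(1)[OF a] half(1) _ onRm]) (use that sgn in \<open>simp_all add: w_def\<close>)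
  have limLp: "(T0 \<alpha> k t \<longlongrightarrow> Tpiece \<alpha> k t (PsiL \<alpha>) (- c) z) (at z within Lp)" if "Re w < 0"
    by (rule lim[OF mat_holo_Psi(2)[OF a] half(2) _ onLp]) (use that sgn in \<open>simp_all add: w_def\<close>)
  have limLm: "(T0 \<alpha> k t \<longlongrightarrow> Tpiece \<alpha> k t (PsiL \<alpha>) c z) (at z within Lm)" if "Re w < 0"
    by (rule lim[OF mat_holo_Psi(2)[OF a] half(2) _ onLm]) (use that sgn in \<open>simp_all add: w_def\<close>)
  \<comment> \<open>The sign of this determinant tells on which side of the ray through eta z the
    point eta y lies.\<close>
  have cross: "Im (eta y * cnj (eta z)) = Im (eta y) * Re w - Re (eta y) * Im w" for y
    by (simp add: w_def)
  have clos: "z \<in> closure A"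
    if "\<sigma> = 1 \<or> \<sigma> = - 1" "open V" "w \<in> V"
      "\<And>y. y \<in> cball 0 \<delta> \<Longrightarrow> eta y \<in> V \<Longrightarrow> 0 < \<sigma> * (Im (eta y) * Re w - Re (eta y) * Im w) \<Longrightarrow> y \<in> A" for A V \<sigma>
    by (rule eta_ray_closure[OF z(2,1) \<delta>(2) that(2) _ that(1)]) (use that(3,4) in \<open>simp_all only: cross w_def\<close>)
  \<comment> \<open>Each of these neighbourhoods of a ray meets only the two sectors adjacent to it,
    so the side of the ray decides the sector. The sign \<sigma> in \<open>clos\<close> is 1 for the
    sector on the counterclockwise side.\<close>
  have V: "open {w. \<bar>Im w\<bar> < Re w}" "open {w. \<bar>Im w\<bar> < - Re w}"
    "open {w. 0 < Re w \<and> 0 < Im w}" "open {w. Re w < 0 \<and> 0 < Im w}" "open {w. 0 < Re w \<and> Im w < 0}" "open {w. Re w < 0 \<and> Im w < 0}"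
    by (intro open_Collect_conj open_Collect_less continuous_intros)+
  note ray = Arg_ray[OF w0]
  have t0: "of_real t * eta z \<noteq> 0" using w0 t by (simp add: w_def)
  have mul: "x * r - y * r = (x - y) * r" "x * r + y * r = (x + y) * r"
    "- (x * r) - y * r = (- x - y) * r" "- (x * r) + y * r = (y - x) * r" for x y r :: real
    by (simp_all add: algebra_simps)
  note pm = zero_less_mult_iff mult_less_0_iff
  have real_jump: "mat2 q 0 0 (1 / q) = mat2 (exp (- 2 * c)) 0 0 (1 / exp (- 2 * c))" by (simp only: eq)
  show ?thesis
  proof (intro conjI impI)
    assume "Arg (eta z) = 0"
    hence r: "Im w = 0" "0 < Re w" using ray(1) by (simp_all add: w_def)
    show "jump_at (T0 \<alpha> k t) Rp Rm (mat2 q 0 0 (1 / q)) z"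
      unfolding jump_at_def real_jump
    proof (intro conjI exI)
      show "z \<in> closure Rp" by (rule clos[of 1, OF _ V(1)]) (use r in \<open>auto simp: sets pm\<close>)
      show "z \<in> closure Rm" by (rule clos[of "- 1", OF _ V(1)]) (use r in \<open>auto simp: sets pm\<close>)
    qed (rule limRp[OF r(2)] limRm[OF r(2)] Tpiece_diagonal)+
  next
    assume "Arg (eta z) = pi"
    hence r: "Im w = 0" "Re w < 0" using ray(2) by (simp_all add: w_def)
    show "jump_at (T0 \<alpha> k t) Lp Lm (mat2 q 0 0 (1 / q)) z"
      unfolding jump_at_def real_jump
    proof (intro conjI exI)
      show "z \<in> closure Lp" by (rule clos[of "- 1", OF _ V(2)]) (use r in \<open>auto simp: sets pm\<close>)
      show "z \<in> closure Lm" by (rule clos[of 1, OF _ V(2)]) (use r in \<open>auto simp: sets pm\<close>)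
    qed (rule limLp[OF r(2)] limLm[OF r(2)] Tpiece_diagonal)+
  next
    assume "Arg (eta z) = pi / 4"
    hence r: "Re w = Im w" "0 < Im w" using ray(3) by (simp_all add: w_def)
    hence r': "0 < Re w" by simp
    have J: "PsiU \<alpha> k (of_real t * eta z) = PsiR \<alpha> (of_real t * eta z) ** mat2 1 (- s3 \<alpha> k) 0 1"
      by (rule PsiU_right[OF _ _ t0]) (use r' t in \<open>simp_all add: w_def\<close>)
    show "jump_at (T0 \<alpha> k t) U Rp (mat2 1 (- (s3 \<alpha> k * exp (- 2 * of_real t * theta z) / q)) 0 1) z"
      unfolding jump_at_def
    proof (intro conjI exI)
      show "z \<in> closure U"
        by (rule clos[of 1, OF _ V(3)]) (use r in \<open>auto simp: sets mul pm\<close>)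
      show "z \<in> closure Rp"
        by (rule clos[of "- 1", OF _ V(3)]) (use r in \<open>auto simp: sets mul pm\<close>)
      show "Tpiece \<alpha> k t (PsiU \<alpha> k) (- c) z = Tpiece \<alpha> k t (PsiR \<alpha>) (- c) z ** mat2 1 (- (s3 \<alpha> k * exp (- 2 * of_real t * theta z) / q)) 0 1"
        unfolding Tpiece_upper[of "PsiU \<alpha> k" t z "PsiR \<alpha>", OF J] eU by simp
    qed (rule limU[OF r(2)] limRp[OF r'])+
  next
    assume "Arg (eta z) = 3 * pi / 4"
    hence r: "Re w = - Im w" "0 < Im w" using ray(4) by (simp_all add: w_def)
    hence r': "Re w < 0" by simp
    have J: "PsiU \<alpha> k (of_real t * eta z) = PsiL \<alpha> (of_real t * eta z) ** mat2 1 (s1 \<alpha> k) 0 1"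
      by (rule PsiU_left[OF a]) (use r' sgn in \<open>simp add: w_def\<close>)
    show "jump_at (T0 \<alpha> k t) U Lp (mat2 1 (s1 \<alpha> k * exp (- 2 * of_real t * theta z) / q) 0 1) z"
      unfolding jump_at_def
    proof (intro conjI exI)
      show "z \<in> closure U"
        by (rule clos[of "- 1", OF _ V(4)]) (use r in \<open>auto simp: sets mul pm\<close>)
      show "z \<in> closure Lp"
        by (rule clos[of 1, OF _ V(4)]) (use r in \<open>auto simp: sets mul pm\<close>)
      show "Tpiece \<alpha> k t (PsiU \<alpha> k) (- c) z = Tpiece \<alpha> k t (PsiL \<alpha>) (- c) z ** mat2 1 (s1 \<alpha> k * exp (- 2 * of_real t * theta z) / q) 0 1"
        unfolding Tpiece_upper[of "PsiU \<alpha> k" t z "PsiL \<alpha>", OF J] eU by simp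
    qed (rule limU[OF r(2)] limLp[OF r'])+
  next
    assume "Arg (eta z) = - (pi / 4)"
    hence r: "Re w = - Im w" "Im w < 0" using ray(5) by (simp_all add: w_def)
    hence r': "0 < Re w" by simp
    show "jump_at (T0 \<alpha> k t) L Rm (mat2 1 0 (- (s1 \<alpha> k * exp (2 * of_real t * theta z) / q)) 1) z"
      unfolding jump_at_def
    proof (intro conjI exI)
      show "z \<in> closure L"
        by (rule clos[of "- 1", OF _ V(5)]) (use r in \<open>auto simp: sets mul pm\<close>)
      show "z \<in> closure Rm"
        by (rule clos[of 1, OF _ V(5)]) (use r in \<open>auto simp: sets mul pm\<close>)
      show "Tpiece \<alpha> k t (PsiD \<alpha> k) c z = Tpiece \<alpha> k t (PsiR \<alpha>) c z ** mat2 1 0 (- (s1 \<alpha> k * exp (2 * of_real t * theta z) / q)) 1"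
        unfolding Tpiece_lower[of "PsiD \<alpha> k" t z "PsiR \<alpha>", OF PsiD_right] eL by simp
    qed (rule limL[OF r(2)] limRm[OF r'])+
  next
    assume "Arg (eta z) = - (3 * pi / 4)"
    hence r: "Re w = Im w" "Im w < 0" using ray(6) by (simp_all add: w_def)
    hence r': "Re w < 0" by simp
    show "jump_at (T0 \<alpha> k t) L Lm (mat2 1 0 (s3 \<alpha> k * exp (2 * of_real t * theta z) / q) 1) z"
      unfolding jump_at_def
    proof (intro conjI exI)
      show "z \<in> closure L"
        by (rule clos[of 1, OF _ V(6)]) (use r in \<open>auto simp: sets mul pm\<close>)
      show "z \<in> closure Lm"
        by (rule clos[of "- 1", OF _ V(6)]) (use r in \<open>auto simp: sets mul pm\<close>)
      show "Tpiece \<alpha> k t (PsiD \<alpha> k) c z = Tpiece \<alpha> k t (PsiL \<alpha>) c z ** mat2 1 0 (s3 \<alpha> k * exp (2 * of_real t * theta z) / q) 1"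
        unfolding Tpiece_lower[of "PsiD \<alpha> k" t z "PsiL \<alpha>", OF PsiD_left] eL by simp
    qed (rule limL[OF r(2)] limLm[OF r'])+
  qed
qed

theorem theorem5p3:
  fixes \<alpha> k :: complex and \<delta> :: real
  assumes parameters:
    "(\<alpha> \<in> \<real> \<and> - (1 / 2) < Re \<alpha> \<and> Re \<alpha> < 1 / 2 \<and>
      k \<in> \<real> \<and> - cos (pi * Re \<alpha>) < Re k \<and> Re k < cos (pi * Re \<alpha>)) \<or>
     (Re \<alpha> = 0 \<and> Re k = 0)"
    and delta_pos: "\<delta> > 0"
    and delta_small: "biholomorphic_on eta (ball 0 (2 * \<delta>))"
  defines "q \<equiv> 1 - s1 \<alpha> k * s3 \<alpha> k"
    and "U \<equiv> eta_sector \<delta> (pi / 4) (3 * pi / 4)"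
    and "L \<equiv> eta_sector \<delta> (- (3 * pi / 4)) (- (pi / 4))"
    and "Rp \<equiv> eta_sector \<delta> 0 (pi / 4)"
    and "Rm \<equiv> eta_sector \<delta> (- (pi / 4)) 0"
    and "Lp \<equiv> eta_sector \<delta> (3 * pi / 4) pi"
    and "Lm \<equiv> eta_sector \<delta> (- pi) (- (3 * pi / 4))"
  shows
    "(q = (cos (of_real pi * \<alpha>))\<^sup>2 - k\<^sup>2 \<and> q \<in> \<real> \<and> Re q > 0) \<and>
     (\<forall>t>0.
        (\<forall>i j. (\<lambda>z. T0 \<alpha> k t z $ i $ j) analytic_on (cball 0 \<delta> - Sigma3 \<delta>))) \<and>
     (\<forall>t>0. \<forall>z \<in> cball 0 \<delta> \<inter> Sigma3 \<delta> - {0}.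
        (Arg (eta z) = 0 \<longrightarrow> jump_at (T0 \<alpha> k t) Rp Rm (mat2 q 0 0 (1 / q)) z) \<and>
        (Arg (eta z) = pi \<longrightarrow> jump_at (T0 \<alpha> k t) Lp Lm (mat2 q 0 0 (1 / q)) z) \<and>
        (Arg (eta z) = pi / 4 \<longrightarrow>
           jump_at (T0 \<alpha> k t) U Rp
             (mat2 1 (- (s3 \<alpha> k * exp (- 2 * of_real t * theta z) / q)) 0 1) z) \<and>
        (Arg (eta z) = 3 * pi / 4 \<longrightarrow>
           jump_at (T0 \<alpha> k t) U Lp
             (mat2 1 (s1 \<alpha> k * exp (- 2 * of_real t * theta z) / q) 0 1) z) \<and>
        (Arg (eta z) = - (pi / 4) \<longrightarrow>
           jump_at (T0 \<alpha> k t) L Rm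
             (mat2 1 0 (- (s1 \<alpha> k * exp (2 * of_real t * theta z) / q)) 1) z) \<and>
        (Arg (eta z) = - (3 * pi / 4) \<longrightarrow>
           jump_at (T0 \<alpha> k t) L Lm
             (mat2 1 0 (s3 \<alpha> k * exp (2 * of_real t * theta z) / q) 1) z)) \<and>
     (\<exists>C. \<forall>\<^sub>F t in at_top. \<forall>z \<in> sphere 0 \<delta> - Sigma3 \<delta>.
        norm (T0 \<alpha> k t z ** matrix_inv (N \<alpha> k z) - mat 1) \<le> C / t) \<and>
     (\<forall>t>0. \<forall>i j.
        (0 < Re \<alpha> \<and> Re \<alpha> < 1 / 2 \<longrightarrow>
           (\<lambda>z. norm (T0 \<alpha> k t z $ i $ j))
             \<in> O[at 0 within (cball 0 \<delta> - Sigma3 \<delta>)](\<lambda>z. norm z powr (- Re \<alpha>))) \<and>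
        (- (1 / 2) < Re \<alpha> \<and> Re \<alpha> \<le> 0 \<longrightarrow>
           (\<lambda>z. norm (T0 \<alpha> k t z $ i $ j))
             \<in> O[at 0 within (cball 0 \<delta> - Sigma3 \<delta>)](\<lambda>z. norm z powr (Re \<alpha>))))"
proof -
  have a: "\<bar>Re \<alpha>\<bar> < 1 / 2" using parameters by auto
  have \<delta>: "\<delta> > 0" "\<delta> \<le> 1 / 4" by (rule delta_pos, rule biholomorphic_eta_radius[OF delta_small])
  note q = q_facts[OF parameters, folded q_def]
  have q0: "q \<noteq> 0" using q(3) by auto
  have jumps: "(Arg (eta z) = 0 \<longrightarrow> jump_at (T0 \<alpha> k t) Rp Rm (mat2 q 0 0 (1 / q)) z) \<and>
        (Arg (eta z) = pi \<longrightarrow> jump_at (T0 \<alpha> k t) Lp Lm (mat2 q 0 0 (1 / q)) z) \<and>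
        (Arg (eta z) = pi / 4 \<longrightarrow>
           jump_at (T0 \<alpha> k t) U Rp
             (mat2 1 (- (s3 \<alpha> k * exp (- 2 * of_real t * theta z) / q)) 0 1) z) \<and>
        (Arg (eta z) = 3 * pi / 4 \<longrightarrow>
           jump_at (T0 \<alpha> k t) U Lp
             (mat2 1 (s1 \<alpha> k * exp (- 2 * of_real t * theta z) / q) 0 1) z) \<and>
        (Arg (eta z) = - (pi / 4) \<longrightarrow>
           jump_at (T0 \<alpha> k t) L Rm
             (mat2 1 0 (- (s1 \<alpha> k * exp (2 * of_real t * theta z) / q)) 1) z) \<and>
        (Arg (eta z) = - (3 * pi / 4) \<longrightarrow>
           jump_at (T0 \<alpha> k t) L Lm
             (mat2 1 0 (s3 \<alpha> k * exp (2 * of_real t * theta z) / q) 1) z)"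
    if t: "t > 0" and z: "z \<in> cball 0 \<delta> \<inter> Sigma3 \<delta> - {0}" for t z
    unfolding q_def U_def L_def Rp_def Rm_def Lp_def Lm_def
    by (rule T0_jumps[OF parameters \<delta> t]) (use z in auto)
  have growth: "(\<lambda>z. norm (T0 \<alpha> k t z $ i $ j)) \<in> O[at 0 within (cball 0 \<delta> - Sigma3 \<delta>)](\<lambda>z. norm z powr (- \<bar>Re \<alpha>\<bar>))"
    if "t > 0" for t i j
    by (rule T0_growth[OF a \<delta> that])
  \<comment> \<open>A single bound with exponent - |Re \<alpha>| contains both alternatives of the
    growth condition.\<close>
  have pos: "- \<bar>Re \<alpha>\<bar> = - Re \<alpha>" if "0 < Re \<alpha>" using that by simp
  have neg: "- \<bar>Re \<alpha>\<bar> = Re \<alpha>" if "Re \<alpha> \<le> 0" using that by simp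
  show ?thesis
  proof (intro conjI allI impI ballI)
    show "q = (cos (of_real pi * \<alpha>))\<^sup>2 - k\<^sup>2" "q \<in> \<real>" "Re q > 0" by (rule q)+
    show "(\<lambda>z. T0 \<alpha> k t z $ i $ j) analytic_on (cball 0 \<delta> - Sigma3 \<delta>)" if "t > 0" for t i j
      by (rule T0_analytic[OF a \<delta> that])
    show "\<exists>C. \<forall>\<^sub>F t in at_top. \<forall>z \<in> sphere 0 \<delta> - Sigma3 \<delta>.
        norm (T0 \<alpha> k t z ** matrix_inv (N \<alpha> k z) - mat 1) \<le> C / t"
      by (rule T0_N_asymptotics[OF a \<delta>])
  next
    fix t :: real and i j assume t: "t > 0" and r: "0 < Re \<alpha> \<and> Re \<alpha> < 1 / 2"
    show "(\<lambda>z. norm (T0 \<alpha> k t z $ i $ j)) \<in> O[at 0 within (cball 0 \<delta> - Sigma3 \<delta>)](\<lambda>z. norm z powr (- Re \<alpha>))"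
      using growth[OF t, of i j] unfolding pos[OF conjunct1[OF r]] .
  next
    fix t :: real and i j assume t: "t > 0" and r: "- (1 / 2) < Re \<alpha> \<and> Re \<alpha> \<le> 0"
    show "(\<lambda>z. norm (T0 \<alpha> k t z $ i $ j)) \<in> O[at 0 within (cball 0 \<delta> - Sigma3 \<delta>)](\<lambda>z. norm z powr (Re \<alpha>))"
      using growth[OF t, of i j] unfolding neg[OF conjunct2[OF r]] .
  qed (use jumps in \<open>blast+\<close>)
qed


end
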